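(* Let $n\ge1$ be an integer, $\mathcal{Y}$ a Hilbert space, and $\mathcal{M}$ a closed $S_n$-invariant subspace of $\mathcal{A}_n(\mathcal{Y})$. Then there is a Bergman-inner family $\{\Theta_{n,k}\}_{k\ge0}$, $\Theta_{n,k}:\mathbb{D}\to\mathcal{L}(\mathcal{U}_k,\mathcal{Y})$, such that $$\mathcal{M}=M_\Theta H^2(\{\mathcal{U}_k\}_{k\ge0}),\qquad M_\Theta=\begin{bmatrix}M_{\Theta_{n,0}}&M_{\Theta_{n,1}}&M_{\Theta_{n,2}}&\cdots\end{bmatrix}.$$ Furthermore, given $\mathcal{M}$, the associated representing Bergman-inner family can be constructed by the following algorithm: (1) Set $\mathcal{X}=\mathcal{M}^\perp$ and define $A\in\mathcal{L}(\mathcal{X})$, $C\in\mathcal{L}(\mathcal{X},\mathcal{Y})$ by $A=S_n^*|_{\mathcal{M}^\perp}$ and $Cf=f(0)$ for $f\in\mathcal{M}^\perp$. (2) For each $k\ge0$ construct a Hilbert space $\mathcal{U}_k$ and operators $B_k\in\mathcal{L}(\mathcal{U}_k,\mathcal{X})$, $D_k\in\mathcal{L}(\mathcal{U}_k,\mathcal{Y})$ with $\begin{bmatrix} B_k \\ D_k \end{bmatrix}:\mathcal{U}_k\to\mathcal{X}\oplus\mathcal{Y}$ injective by solving the Cholesky factorization problem $$\begin{bmatrix} B_k \\ D_k \end{bmatrix}\begin{bmatrix} B_k^* & D_k^* \end{bmatrix}=\begin{bmatrix} \mathfrak{G}_{n,k+1,C,A}^{-1} & 0 \\ 0 & \mu_{n,k}I_{\mathcal{Y}}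 \end{bmatrix}-\begin{bmatrix} A \\ C \end{bmatrix}\mathfrak{G}_{n,k,C,A}^{-1}\begin{bmatrix} A^* & C^* \end{bmatrix}.$$ (3) Set $\Theta_{n,k}(z)=\mu_{n,k}^{-1}D_k+zCR_{n,k+1}(zA)B_k$. Alternatively, Bergman-inner families can be constructed from an arbitrary strongly stable $n$-hypercontraction as follows. Let $A\in\mathcal{L}(\mathcal{X})$ be any strongly stable $n$-hypercontraction on a Hilbert space $\mathcal{X}$ and choose $C\in\mathcal{L}(\mathcal{X},\mathcal{Y})$ with dense range so that $C^*C=\sum_{j=0}^n(-1)^j\binom{n}{j}A^{*j}A^j$. Construct $B_k$, $D_k$ as in step (2) and then $\Theta_{n,k}$ as in step (3). Then $\{\Theta_{n,k}\}_{k\ge0}$ is a Bergman-inner family, and any Bergman-inner family arises in this way.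
   Context: For an integer $n\ge1$ and a Hilbert space $\mathcal{Y}$, $\mathcal{A}_n(\mathcal{Y})$ is the Hilbert space of $\mathcal{Y}$-valued functions $f(z)=\sum_{j\ge0}f_jz^j$ analytic on the open unit disk $\mathbb{D}$ with $\|f\|^2=\sum_{j\ge0}\mu_{n,j}\|f_j\|^2<\infty$, where $\mu_{n,j}=1/\binom{n+j-1}{j}$; $S_n$ is the shift $f(z)\mapsto zf(z)$ on $\mathcal{A}_n(\mathcal{Y})$, and $S_n^*$ its adjoint. $R_{n,k}(zA)=\sum_{j\ge0}\binom{n+j+k-1}{j+k}A^jz^j$. The shifted gramian is $\mathfrak{G}_{n,k,C,A}=\sum_{j\ge0}\binom{n+j+k-1}{j+k}A^{*j}C^*CA^j$ (strongly convergent; for the pairs considered here it is bounded and bounded below for every $k\ge0$). $A$ is strongly stable if $\|A^kx\|\to0$ for every $x$; it is an $n$-hypercontraction if $\sum_{j=0}^k(-1)^j\binom{k}{j}A^{*j}A^j\ge0$ for $0\le k\le n$. For a Hilbert space $\mathcal{U}_k$ let $S_1^k\mathcal{U}_k=\{z^ku:u\in\mathcal{U}_k\}$ with $\|z^ku\|=\|u\|_{\mathcal{U}_k}$. The time-varying Hardy space $H^2(\{\mathcal{U}_k\}_{k\ge0})=\bigoplus_{k\ge0}S_1^k\mathcal{U}_k$ consists of $\bigoplus_k z^ku_k$ with norm squared $\sum_k\|u_k\|^2<\infty$, and $M_\Theta$ sends $\bigoplus_kz^ku_k$ to $\sum_k\Theta_{n,k}(z)z^ku_k$. A family of operator-valued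 functions $\{\Theta_{n,k}:\mathbb{D}\to\mathcal{L}(\mathcal{U}_k,\mathcal{Y})\}_{k\ge0}$ is a Bergman-inner family if for each $k=0,1,2,\dots$: (i) $M_{\Theta_{n,k}}:S_1^k\mathcal{U}_k\to\mathcal{A}_n(\mathcal{Y})$ is isometric; (ii) $M_{\Theta_{n,k}}(S_1^k\mathcal{U}_k)$ is orthogonal in $\mathcal{A}_n(\mathcal{Y})$ to $\overline{\operatorname{span}}\{M_{\Theta_{n,\ell}}S_1^\ell\mathcal{U}_\ell:\ell>k\}$; (iii) $S_n^{k+1}M_{\Theta_{n,k}}\mathcal{U}_k\subset\overline{\operatorname{span}}\{S_n^\ell M_{\Theta_{n,\ell}}\mathcal{U}_\ell:\ell>k\}$.
   Formalization: The last clause is false as printed; it is proved for Bergman-inner families with every M_{Θ_{n,k}}U_k contained in M_Θ H^2, and C is asserted to have dense range only when M_Θ H^2 contains no nonzero constant function; both conditions are necessary. *)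

theory Defs
  imports "HOL-Analysis.Analysis" "HOL-Library.Function_Algebras"
begin

class complex_vector = ab_group_add +
  fixes scaleC :: "complex \<Rightarrow> 'a \<Rightarrow> 'a"  (infixr \<open>*\<^sub>C\<close> 75)
  assumes scaleC_add_right: "a *\<^sub>C (x + y) = a *\<^sub>C x + a *\<^sub>C y"
    and scaleC_add_left: "(a + b) *\<^sub>C x = a *\<^sub>C x + b *\<^sub>C x"
    and scaleC_scaleC: "a *\<^sub>C (b *\<^sub>C x) = (a * b) *\<^sub>C x"
    and scaleC_one: "1 *\<^sub>C x = x"

interpretation complex_vector: vector_space "scaleC :: complex \<Rightarrow> 'a \<Rightarrow> 'a::complex_vector"
  by unfold_locales (rule scaleC_add_right scaleC_add_left scaleC_scaleC scaleC_one)+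

instantiation "fun" :: (type, complex_vector) complex_vector
begin

definition scaleC_fun :: "complex \<Rightarrow> ('a \<Rightarrow> 'b) \<Rightarrow> 'a \<Rightarrow> 'b"
  where "scaleC_fun a f = (\<lambda>x. a *\<^sub>C f x)"

instance
  by standard
    (simp_all add: scaleC_fun_def fun_eq_iff scaleC_add_right scaleC_add_left scaleC_scaleC scaleC_one)

end

instantiation prod :: (complex_vector, complex_vector) complex_vector
begin

definition scaleC_prod :: "complex \<Rightarrow> 'a \<times> 'b \<Rightarrow> 'a \<times> 'b"
  where "scaleC_prod a p = (a *\<^sub>C fst p, a *\<^sub>C snd p)"

instance
  by standard
    (simp_all add: scaleC_prod_def prod_eq_iff scaleC_add_right scaleC_add_left scaleC_scaleC scaleC_one)

end

text \<open>
  A space is a linear subspace of a complex vector space together with an inner product, linear in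
  the first argument, whose values outside the carrier are irrelevant. Carriers are needed because
  the Bergman space depends on the number \<open>n\<close>, and because the coefficient spaces \<open>U k\<close> vary with \<open>k\<close>.
\<close>

record 'a hspace =
  hcarrier :: "'a set"
  hinner :: "'a \<Rightarrow> 'a \<Rightarrow> complex"

definition hnorm :: "'a hspace \<Rightarrow> 'a \<Rightarrow> real"
  where "hnorm H x = sqrt (Re (hinner H x x))"

text \<open>The value off the carrier makes this fit the library's locale \<^locale>\<open>Metric_space\<close>, which wants a
  nonnegative symmetric function on the whole type.\<close>

definition hdist :: "'a::complex_vector hspace \<Rightarrow> 'a \<Rightarrow> 'a \<Rightarrow> real"
  where "hdist H x y = (if x \<in> hcarrier H \<and> y \<in> hcarrier H then hnorm H (x - y) else 0)"

abbreviation htopology :: "'a::complex_vector hspace \<Rightarrow> 'a topology"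
  where "htopology H \<equiv> Metric_space.mtopology (hcarrier H) (hdist H)"

locale inner_product_space =
  fixes H :: "'a::complex_vector hspace"
  assumes subspace: "complex_vector.subspace (hcarrier H)"
    and inner_add: "\<lbrakk>x \<in> hcarrier H; y \<in> hcarrier H; v \<in> hcarrier H\<rbrakk>
          \<Longrightarrow> hinner H (x + y) v = hinner H x v + hinner H y v"
    and inner_scale: "\<lbrakk>x \<in> hcarrier H; v \<in> hcarrier H\<rbrakk> \<Longrightarrow> hinner H (a *\<^sub>C x) v = a * hinner H x v"
    and inner_commute: "\<lbrakk>x \<in> hcarrier H; y \<in> hcarrier H\<rbrakk> \<Longrightarrow> hinner H x y = cnj (hinner H y x)"
    and inner_pos: "\<lbrakk>x \<in> hcarrier H; x \<noteq> 0\<rbrakk> \<Longrightarrow> 0 < Re (hinner H x x)"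
begin

lemma inner_add2:
  "\<lbrakk>x \<in> hcarrier H; y \<in> hcarrier H; v \<in> hcarrier H\<rbrakk>
    \<Longrightarrow> hinner H v (x + y) = hinner H v x + hinner H v y"
  by (metis complex_cnj_add inner_add inner_commute complex_vector.subspace_add subspace)

lemma inner_scale2:
  "\<lbrakk>x \<in> hcarrier H; v \<in> hcarrier H\<rbrakk> \<Longrightarrow> hinner H v (a *\<^sub>C x) = cnj a * hinner H v x"
  by (metis complex_cnj_mult inner_scale inner_commute complex_vector.subspace_scale subspace)

lemma inner_zero: "hinner H 0 0 = 0"
proof -
  have "0 \<in> hcarrier H"
    by (rule complex_vector.subspace_0[OF subspace])
  from inner_scale[OF this this, of 0] show ?thesis
    by simp
qed

lemma inner_ge: "x \<in> hcarrier H \<Longrightarrow> 0 \<le> Re (hinner H x x)"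
  using inner_pos[of x] inner_zero by (cases "x = 0") auto

lemma norm_eq_0_iff: "x \<in> hcarrier H \<Longrightarrow> hnorm H x = 0 \<longleftrightarrow> x = 0"
  using inner_pos[of x] inner_zero by (cases "x = 0") (auto simp: hnorm_def)

lemma norm_power2: "x \<in> hcarrier H \<Longrightarrow> (hnorm H x)\<^sup>2 = Re (hinner H x x)"
  by (simp add: hnorm_def inner_ge)

lemma norm_add_power2:
  assumes "x \<in> hcarrier H" "y \<in> hcarrier H"
  shows "(hnorm H (x + y))\<^sup>2 = (hnorm H x)\<^sup>2 + 2 * Re (hinner H x y) + (hnorm H y)\<^sup>2"
proof -
  have "x + y \<in> hcarrier H"
    using assms subspace by (rule complex_vector.subspace_add[rotated])
  moreover have "Re (hinner H y x) = Re (hinner H x y)"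
    using inner_commute[OF assms] by simp
  ultimately show ?thesis
    using assms by (simp add: norm_power2 inner_add inner_add2)
qed

lemma norm_scale: "x \<in> hcarrier H \<Longrightarrow> hnorm H (a *\<^sub>C x) = cmod a * hnorm H x"
proof -
  assume x: "x \<in> hcarrier H"
  have *: "hinner H (a *\<^sub>C x) (a *\<^sub>C x) = of_real ((cmod a)\<^sup>2) * hinner H x x"
    using x complex_vector.subspace_scale[OF subspace x]
    by (simp add: inner_scale inner_scale2 complex_norm_square mult.assoc del: of_real_power)
  show ?thesis
    unfolding hnorm_def * Re_complex_of_real by (simp add: real_sqrt_mult del: of_real_power)
qed

lemma Re_inner_le:
  assumes x: "x \<in> hcarrier H" and y: "y \<in> hcarrier H"
  shows "Re (hinner H x y) \<le> hnorm H x * hnorm H y"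
proof (cases "x = 0 \<or> y = 0")
  case True
  have "hinner H 0 y = 0" "hinner H x 0 = 0"
    using inner_scale[OF x y, of 0] inner_scale2[OF y x, of 0] by simp_all
  then show ?thesis
    using True inner_zero by (auto simp: hnorm_def)
next
  case False
  define s t where "s = hnorm H x" and "t = hnorm H y"
  have st: "0 < s" "0 < t"
    using False inner_pos[OF x] inner_pos[OF y] by (auto simp: s_def t_def hnorm_def)
  define u v where "u = of_real t *\<^sub>C x" and "v = of_real (- s) *\<^sub>C y"
  have uv: "u \<in> hcarrier H" "v \<in> hcarrier H"
    unfolding u_def v_def by (rule complex_vector.subspace_scale[OF subspace] x y)+
  have "0 \<le> (hnorm H (u + v))\<^sup>2"
    by simp
  also have "\<dots> = (t * s)\<^sup>2 - 2 * (t * s) * Re (hinner H x y) + (s * t)\<^sup>2"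
    unfolding norm_add_power2[OF uv] using x y uv st
    by (simp add: u_def v_def norm_scale inner_scale inner_scale2 flip: s_def t_def
        del: of_real_minus)
  finally have "(t * s) * Re (hinner H x y) \<le> (t * s) * (s * t)"
    by (simp add: power2_eq_square algebra_simps)
  then show ?thesis
    using st by (simp add: s_def t_def)
qed

lemma norm_triangle:
  assumes "x \<in> hcarrier H" "y \<in> hcarrier H"
  shows "hnorm H (x + y) \<le> hnorm H x + hnorm H y"
proof (rule power2_le_imp_le)
  show "(hnorm H (x + y))\<^sup>2 \<le> (hnorm H x + hnorm H y)\<^sup>2"
    using Re_inner_le[OF assms] norm_add_power2[OF assms] by (simp add: power2_sum)
  show "0 \<le> hnorm H x + hnorm H y"
    using assms by (simp add: hnorm_def inner_ge)
qed

lemma metric: "Metric_space (hcarrier H) (hdist H)"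
proof
  note diff = complex_vector.subspace_diff[OF subspace]
  show "0 \<le> hdist H x y" for x y
    by (auto simp: hdist_def hnorm_def inner_ge diff)
  show "hdist H x y = hdist H y x" for x y
    using norm_scale[of "x - y" "-1"] by (auto simp: hdist_def diff)
  show "hdist H x y = 0 \<longleftrightarrow> x = y" if "x \<in> hcarrier H" "y \<in> hcarrier H" for x y
    using norm_eq_0_iff[OF diff[OF that]] that by (simp add: hdist_def)
  show "hdist H x z \<le> hdist H x y + hdist H y z"
    if "x \<in> hcarrier H" "y \<in> hcarrier H" "z \<in> hcarrier H" for x y z
    using norm_triangle[of "x - y" "y - z"] that by (simp add: hdist_def diff)
qed

end

locale hilbert_space = inner_product_space H for H :: "'a::complex_vector hspace" +
  assumes complete: "Metric_space.mcomplete (hcarrier H) (hdist H)"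

definition hsums :: "'a::complex_vector hspace \<Rightarrow> (nat \<Rightarrow> 'a) \<Rightarrow> 'a \<Rightarrow> bool"
  where "hsums H f s \<longleftrightarrow> limitin (htopology H) (\<lambda>N. \<Sum>j<N. f j) s sequentially"

definition hsuminf :: "'a::complex_vector hspace \<Rightarrow> (nat \<Rightarrow> 'a) \<Rightarrow> 'a"
  where "hsuminf H f = (THE s. hsums H f s)"

definition closed_subspace :: "'a::complex_vector hspace \<Rightarrow> 'a set \<Rightarrow> bool"
  where "closed_subspace H M \<longleftrightarrow>
    M \<subseteq> hcarrier H \<and> complex_vector.subspace M \<and> closedin (htopology H) M"

definition closed_span :: "'a::complex_vector hspace \<Rightarrow> 'a set \<Rightarrow> 'a set"
  where "closed_span H S = htopology H closure_of (complex_vector.span S)"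

definition horthogonal :: "'a hspace \<Rightarrow> 'a set \<Rightarrow> 'a set \<Rightarrow> bool"
  where "horthogonal H S T \<longleftrightarrow> (\<forall>x\<in>S. \<forall>y\<in>T. hinner H x y = 0)"

definition orth_compl :: "'a hspace \<Rightarrow> 'a set \<Rightarrow> 'a set"
  where "orth_compl H S = {x \<in> hcarrier H. \<forall>y\<in>S. hinner H x y = 0}"

definition hsubspace :: "'a hspace \<Rightarrow> 'a set \<Rightarrow> 'a hspace"
  where "hsubspace H S = \<lparr>hcarrier = S, hinner = hinner H\<rparr>"

definition hdirect_sum :: "(nat \<Rightarrow> 'a hspace) \<Rightarrow> (nat \<Rightarrow> 'a) hspace"
  where "hdirect_sum H =
    \<lparr>hcarrier = {h. (\<forall>k. h k \<in> hcarrier (H k)) \<and> summable (\<lambda>k. (hnorm (H k) (h k))\<^sup>2)},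
     hinner = (\<lambda>g h. \<Sum>k. hinner (H k) (g k) (h k))\<rparr>"

text \<open>Operators are functions that matter on the carrier of their domain only.\<close>

definition bounded_operator ::
    "'a::complex_vector hspace \<Rightarrow> 'b::complex_vector hspace \<Rightarrow> ('a \<Rightarrow> 'b) \<Rightarrow> bool"
  where "bounded_operator H K T \<longleftrightarrow>
    T ` hcarrier H \<subseteq> hcarrier K \<and>
    (\<forall>x\<in>hcarrier H. \<forall>y\<in>hcarrier H. T (x + y) = T x + T y) \<and>
    (\<forall>a. \<forall>x\<in>hcarrier H. T (a *\<^sub>C x) = a *\<^sub>C T x) \<and>
    (\<exists>c. \<forall>x\<in>hcarrier H. hnorm K (T x) \<le> c * hnorm H x)"

definition isometric_operator ::
    "'a::complex_vector hspace \<Rightarrow> 'b::complex_vector hspace \<Rightarrow> ('a \<Rightarrow> 'b) \<Rightarrow> bool"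
  where "isometric_operator H K T \<longleftrightarrow>
    bounded_operator H K T \<and> (\<forall>x\<in>hcarrier H. hnorm K (T x) = hnorm H x)"

definition hadjoint :: "'a hspace \<Rightarrow> 'b hspace \<Rightarrow> ('a \<Rightarrow> 'b) \<Rightarrow> 'b \<Rightarrow> 'a"
  where "hadjoint H K T y =
    (THE x. x \<in> hcarrier H \<and> (\<forall>v\<in>hcarrier H. hinner K (T v) y = hinner H v x))"

definition hpositive :: "'a hspace \<Rightarrow> ('a \<Rightarrow> 'a) \<Rightarrow> bool"
  where "hpositive H T \<longleftrightarrow> (\<forall>x\<in>hcarrier H. hinner H (T x) x \<in> \<real>\<^sub>\<ge>\<^sub>0)"

definition dense_range ::
    "'a hspace \<Rightarrow> 'b::complex_vector hspace \<Rightarrow> ('a \<Rightarrow> 'b) \<Rightarrow> bool"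
  where "dense_range H K T \<longleftrightarrow> htopology K closure_of (T ` hcarrier H) = hcarrier K"

definition strongly_stable :: "'a hspace \<Rightarrow> ('a \<Rightarrow> 'a) \<Rightarrow> bool"
  where "strongly_stable X A \<longleftrightarrow> (\<forall>x\<in>hcarrier X. (\<lambda>k. hnorm X ((A ^^ k) x)) \<longlonglongrightarrow> 0)"

definition defect :: "nat \<Rightarrow> 'a::complex_vector hspace \<Rightarrow> ('a \<Rightarrow> 'a) \<Rightarrow> 'a \<Rightarrow> 'a"
  where "defect m X A x =
    (\<Sum>j\<le>m. ((-1) ^ j * of_nat (m choose j)) *\<^sub>C (hadjoint X X A ^^ j) ((A ^^ j) x))"

definition hypercontraction :: "nat \<Rightarrow> 'a::complex_vector hspace \<Rightarrow> ('a \<Rightarrow> 'a) \<Rightarrow> bool"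
  where "hypercontraction n X A \<longleftrightarrow>
    bounded_operator X X A \<and> (\<forall>m\<le>n. hpositive X (defect m X A))"

definition bweight :: "nat \<Rightarrow> nat \<Rightarrow> real"
  where "bweight n j = 1 / real ((n + j - 1) choose j)"

definition power_series_on_disk ::
    "'y::complex_vector hspace \<Rightarrow> (nat \<Rightarrow> 'y) \<Rightarrow> (complex \<Rightarrow> 'y) \<Rightarrow> bool"
  where "power_series_on_disk Y c f \<longleftrightarrow>
    (\<forall>j. c j \<in> hcarrier Y) \<and> (\<forall>z. cmod z < 1 \<longrightarrow> hsums Y (\<lambda>j. z ^ j *\<^sub>C c j) (f z))"

definition taylor_coeff :: "'y::complex_vector hspace \<Rightarrow> (complex \<Rightarrow> 'y) \<Rightarrow> nat \<Rightarrow> 'y"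
  where "taylor_coeff Y f = (THE c. power_series_on_disk Y c f)"

text \<open>Functions on the open unit disk are extended by 0, so that equality of functions means
  equality on the disk.\<close>

definition bergman :: "nat \<Rightarrow> 'y::complex_vector hspace \<Rightarrow> (complex \<Rightarrow> 'y) hspace"
  where "bergman n Y =
    \<lparr>hcarrier = {f. (\<forall>z. 1 \<le> cmod z \<longrightarrow> f z = 0) \<and>
        (\<exists>c. power_series_on_disk Y c f \<and> summable (\<lambda>j. bweight n j * (hnorm Y (c j))\<^sup>2))},
     hinner = (\<lambda>f g. \<Sum>j. of_real (bweight n j) * hinner Y (taylor_coeff Y f j) (taylor_coeff Y g j))\<rparr>"

definition shift :: "(complex \<Rightarrow> 'y::complex_vector) \<Rightarrow> complex \<Rightarrow> 'y"
  where "shift f = (\<lambda>z. z *\<^sub>C f z)"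

definition monomial :: "nat \<Rightarrow> 'u::complex_vector \<Rightarrow> complex \<Rightarrow> 'u"
  where "monomial k u = (\<lambda>z. if cmod z < 1 then z ^ k *\<^sub>C u else 0)"

text \<open>The space of all \<open>z\<^sup>k u\<close> for \<open>u\<close> in \<open>U\<close>, with the inner product carried over from \<open>U\<close>.\<close>

definition shifted_space :: "nat \<Rightarrow> 'u::complex_vector hspace \<Rightarrow> (complex \<Rightarrow> 'u) hspace"
  where "shifted_space k U =
    \<lparr>hcarrier = monomial k ` hcarrier U,
     hinner = (\<lambda>f g. hinner U (inv_into (hcarrier U) (monomial k) f)
                              (inv_into (hcarrier U) (monomial k) g))\<rparr>"

definition tv_hardy :: "(nat \<Rightarrow> 'u::complex_vector hspace) \<Rightarrow> (nat \<Rightarrow> complex \<Rightarrow> 'u) hspace"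
  where "tv_hardy U = hdirect_sum (\<lambda>k. shifted_space k (U k))"

definition mult_op ::
    "(complex \<Rightarrow> 'u \<Rightarrow> 'y::complex_vector) \<Rightarrow> (complex \<Rightarrow> 'u) \<Rightarrow> complex \<Rightarrow> 'y"
  where "mult_op \<theta> f = (\<lambda>z. if cmod z < 1 then \<theta> z (f z) else 0)"

definition row_mult_op ::
    "nat \<Rightarrow> 'y::complex_vector hspace \<Rightarrow> (nat \<Rightarrow> complex \<Rightarrow> 'u \<Rightarrow> 'y) \<Rightarrow>
      (nat \<Rightarrow> complex \<Rightarrow> 'u) \<Rightarrow> complex \<Rightarrow> 'y"
  where "row_mult_op n Y \<Theta> h = hsuminf (bergman n Y) (\<lambda>k. mult_op (\<Theta> k) (h k))"

text \<open>In \<open>M\<^bsub>\<Theta> k\<^esub> (U k)\<close> elements of \<open>U k\<close> count as constant functions, i.e. as elements of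
  \<^term>\<open>shifted_space 0 (U k)\<close>. The fourth conjunct makes the last one meaningful: the shift acts on
  the Bergman space, so \<open>M\<^bsub>\<Theta> k\<^esub> (U k)\<close> has to lie in it. (The isometry condition alone says this about
  \<open>z\<^sup>k \<Theta> k\<close> only.)\<close>

definition bergman_inner_family ::
    "nat \<Rightarrow> 'y::complex_vector hspace \<Rightarrow> (nat \<Rightarrow> 'u::complex_vector hspace) \<Rightarrow>
      (nat \<Rightarrow> complex \<Rightarrow> 'u \<Rightarrow> 'y) \<Rightarrow> bool"
  where "bergman_inner_family n Y U \<Theta> \<longleftrightarrow>
    (\<forall>k. hilbert_space (U k) \<and>
      (\<forall>z. cmod z < 1 \<longrightarrow> bounded_operator (U k) Y (\<Theta> k z)) \<and>
      isometric_operator (shifted_space k (U k)) (bergman n Y) (mult_op (\<Theta> k)) \<and>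
      mult_op (\<Theta> k) ` hcarrier (shifted_space 0 (U k)) \<subseteq> hcarrier (bergman n Y) \<and>
      horthogonal (bergman n Y)
        (mult_op (\<Theta> k) ` hcarrier (shifted_space k (U k)))
        (closed_span (bergman n Y)
          (\<Union>l\<in>{k<..}. mult_op (\<Theta> l) ` hcarrier (shifted_space l (U l)))) \<and>
      (shift ^^ Suc k) ` mult_op (\<Theta> k) ` hcarrier (shifted_space 0 (U k))
        \<subseteq> closed_span (bergman n Y)
            (\<Union>l\<in>{k<..}. (shift ^^ l) ` mult_op (\<Theta> l) ` hcarrier (shifted_space 0 (U l))))"

text \<open>\<open>R\<^bsub>n,k\<^esub>(zA)\<close>, with the operator series summed at each vector.\<close>

definition hresolvent ::
    "nat \<Rightarrow> nat \<Rightarrow> 'x::complex_vector hspace \<Rightarrow> ('x \<Rightarrow> 'x) \<Rightarrow> complex \<Rightarrow> 'x \<Rightarrow> 'x"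
  where "hresolvent n k X A z x =
    hsuminf X (\<lambda>j. (of_nat ((n + j + k - 1) choose (j + k)) * z ^ j) *\<^sub>C (A ^^ j) x)"

definition gramian ::
    "nat \<Rightarrow> nat \<Rightarrow> 'x::complex_vector hspace \<Rightarrow> 'y hspace \<Rightarrow> ('x \<Rightarrow> 'x) \<Rightarrow> ('x \<Rightarrow> 'y) \<Rightarrow> 'x \<Rightarrow> 'x"
  where "gramian n k X Y A C x =
    hsuminf X (\<lambda>j. of_nat ((n + j + k - 1) choose (j + k)) *\<^sub>C
      (hadjoint X X A ^^ j) (hadjoint X Y C (C ((A ^^ j) x))))"

definition gramian_inv ::
    "nat \<Rightarrow> nat \<Rightarrow> 'x::complex_vector hspace \<Rightarrow> 'y hspace \<Rightarrow> ('x \<Rightarrow> 'x) \<Rightarrow> ('x \<Rightarrow> 'y) \<Rightarrow> 'x \<Rightarrow> 'x"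
  where "gramian_inv n k X Y A C = inv_into (hcarrier X) (gramian n k X Y A C)"

text \<open>The Cholesky factorization problem; the block operator identity is evaluated at \<open>(x, y)\<close>.\<close>

definition cholesky_solution ::
    "nat \<Rightarrow> nat \<Rightarrow> 'x::complex_vector hspace \<Rightarrow> 'y::complex_vector hspace \<Rightarrow> ('x \<Rightarrow> 'x) \<Rightarrow> ('x \<Rightarrow> 'y) \<Rightarrow>
      'u::complex_vector hspace \<Rightarrow> ('u \<Rightarrow> 'x) \<Rightarrow> ('u \<Rightarrow> 'y) \<Rightarrow> bool"
  where "cholesky_solution n k X Y A C U B D \<longleftrightarrow>
    hilbert_space U \<and> bounded_operator U X B \<and> bounded_operator U Y D \<and>
    inj_on (\<lambda>u. (B u, D u)) (hcarrier U) \<and>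
    (\<forall>x\<in>hcarrier X. \<forall>y\<in>hcarrier Y.
      let u = hadjoint U X B x + hadjoint U Y D y;
          w = gramian_inv n k X Y A C (hadjoint X X A x + hadjoint X Y C y)
      in (B u, D u) = (gramian_inv n (k + 1) X Y A C x, of_real (bweight n k) *\<^sub>C y) - (A w, C w))"

definition transfer_function ::
    "nat \<Rightarrow> nat \<Rightarrow> 'x::complex_vector hspace \<Rightarrow> ('x \<Rightarrow> 'x) \<Rightarrow> ('x \<Rightarrow> 'y::complex_vector) \<Rightarrow>
      ('u \<Rightarrow> 'x) \<Rightarrow> ('u \<Rightarrow> 'y) \<Rightarrow> complex \<Rightarrow> 'u \<Rightarrow> 'y"
  where "transfer_function n k X A C B D z u =
    of_real (inverse (bweight n k)) *\<^sub>C D u + z *\<^sub>C C (hresolvent n (k + 1) X A z (B u))"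

end

theory Submission
  imports Defs
begin

text \<open>
  A closed shift-invariant subspace \<open>M\<close> is the orthogonal sum of its wandering subspaces
  \<open>E\<^sub>k = S\<^sup>k M \<ominus> S\<^sup>k\<^sup>+\<^sup>1 M\<close>, because only \<open>0\<close> vanishes to infinite order at the origin. So a Bergman-inner
  family for \<open>M\<close> amounts to unitary maps \<open>u \<mapsto> z\<^sup>k \<Theta>\<^sub>k u\<close> of \<open>U\<^sub>k\<close> onto \<open>E\<^sub>k\<close>, and \<open>E\<^sub>k\<close> has to be described in
  terms of a pair \<open>(A, C)\<close> whose observability operator \<open>x \<mapsto> \<Sum>\<^sub>i \<mu>\<^sub>i\<^sup>-\<^sup>1 C A\<^sup>i x z\<^sup>i\<close> is isometric with range
  \<open>M\<^sup>\<bottom>\<close>. Put \<open>V\<^sub>k x = \<Sum>\<^sub>i\<^sub>\<ge>\<^sub>k \<mu>\<^sub>i\<^sup>-\<^sup>1 C A\<^sup>i\<^sup>-\<^sup>k x z\<^sup>i\<close> and \<open>\<phi>\<^sub>k(b, d) = \<mu>\<^sub>k\<^sup>-\<^sup>1 d z\<^sup>k + V\<^sub>k\<^sub>+\<^sub>1 b\<close>. Then \<open>V\<^sub>k\<^sup>* V\<^sub>k\<close> is the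
  \<open>k\<close>-th gramian, \<open>V\<^sub>k x = \<phi>\<^sub>k(A x, C x)\<close>, and \<open>E\<^sub>k\<close> consists of the values of \<open>\<phi>\<^sub>k\<close> orthogonal to the range
  of \<open>V\<^sub>k\<close>. The right-hand side of the Cholesky problem, applied to \<open>w\<close>, is the unique pair \<open>q\<close> with
  \<open>\<phi>\<^sub>k q \<in> E\<^sub>k\<close> and \<open>\<langle>\<phi>\<^sub>k e, \<phi>\<^sub>k q\<rangle> = \<langle>e, w\<rangle>\<close> whenever \<open>\<phi>\<^sub>k e \<in> E\<^sub>k\<close>; hence \<open>(B\<^sub>k, D\<^sub>k)\<close> solves the problem iff
  \<open>u \<mapsto> \<phi>\<^sub>k(B\<^sub>k u, D\<^sub>k u) = z\<^sup>k \<Theta>\<^sub>k u\<close> is unitary from \<open>U\<^sub>k\<close> onto \<open>E\<^sub>k\<close>.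

  For a strongly stable \<open>n\<close>-hypercontraction the observability operator is isometric by induction on
  the order of the defect operators, using summation by parts. Conversely, for a Bergman-inner family
  the closed spans of the summands of index at least \<open>k\<close> turn out to be \<open>S\<^sup>k M\<close>.
\<close>

subsection \<open>Hilbert spaces with carriers\<close>

text \<open>For n > 1 the shift is not isometric, so the images S^k E_0 of a single wandering
  subspace are in general not the spaces E_k; hence a separate space U_k and a separate gramian for
  every k. What survives is a lower bound: the weights satisfy mu_j <= n mu_(j+1). This one estimate
  keeps every S^k M closed, allows division by z^k inside the Bergman space, and places the k-th
  gramian between I and n^k I, so that it is invertible. Identities about adjoints come down to the
  Bergman weight mu_i cancelling the factor mu_i^-1 in the coefficients of V_k.

  Both constructions rest on one hypothesis, isometry of V_0 (locale \<open>isometric_pair\<close>).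
  The backward shift on the complement of M satisfies it because evaluating its j-th power at 0
  returns mu_j times the j-th Taylor coefficient, so that V_0 acts there as the identity.

  In the converse direction, condition (iii) yields only that S^k M lies in the k-th tail of the
  family; the other inclusion uses that M contains all functions z -> Theta_k(z) u.\<close>

lemma real_tendsto_0_le:
  fixes f g :: "nat \<Rightarrow> real"
  assumes "\<And>n. norm (f n) \<le> g n" "g \<longlonglongrightarrow> 0"
  shows "f \<longlonglongrightarrow> 0"
  using assms by (intro Lim_null_comparison[of f g]) auto

context inner_product_space
begin

lemma zero_mem [simp]: "0 \<in> hcarrier H"
  by (rule complex_vector.subspace_0[OF subspace])

lemma add_mem [simp]: "x \<in> hcarrier H \<Longrightarrow> y \<in> hcarrier H \<Longrightarrow> x + y \<in> hcarrier H"
  by (rule complex_vector.subspace_add[OF subspace])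

lemma diff_mem [simp]: "x \<in> hcarrier H \<Longrightarrow> y \<in> hcarrier H \<Longrightarrow> x - y \<in> hcarrier H"
  by (rule complex_vector.subspace_diff[OF subspace])

lemma scale_mem [simp]: "x \<in> hcarrier H \<Longrightarrow> a *\<^sub>C x \<in> hcarrier H"
  by (rule complex_vector.subspace_scale[OF subspace])

lemma uminus_mem [simp]: "x \<in> hcarrier H \<Longrightarrow> - x \<in> hcarrier H"
  by (rule complex_vector.subspace_neg[OF subspace])

lemma sum_mem [simp]: "(\<And>i. i \<in> I \<Longrightarrow> f i \<in> hcarrier H) \<Longrightarrow> sum f I \<in> hcarrier H"
  by (rule complex_vector.subspace_sum[OF subspace])

lemma inner_zero_left [simp]: "y \<in> hcarrier H \<Longrightarrow> hinner H 0 y = 0"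
  using inner_scale[of 0 y 0] by simp

lemma inner_zero_right [simp]: "y \<in> hcarrier H \<Longrightarrow> hinner H y 0 = 0"
  using inner_scale2[of 0 y 0] by simp

lemma inner_minus_left: "x \<in> hcarrier H \<Longrightarrow> y \<in> hcarrier H \<Longrightarrow> hinner H (- x) y = - hinner H x y"
  using inner_add[of x "- x" y] by (simp add: eq_neg_iff_add_eq_0 add.commute)

lemma inner_minus_right: "x \<in> hcarrier H \<Longrightarrow> y \<in> hcarrier H \<Longrightarrow> hinner H y (- x) = - hinner H y x"
  using inner_add2[of x "- x" y] by (simp add: eq_neg_iff_add_eq_0 add.commute)

lemma inner_diff_left:
  "x \<in> hcarrier H \<Longrightarrow> y \<in> hcarrier H \<Longrightarrow> v \<in> hcarrier H \<Longrightarrow>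
    hinner H (x - y) v = hinner H x v - hinner H y v"
  using inner_add[of x "- y" v] by (simp add: inner_minus_left)

lemma inner_diff_right:
  "x \<in> hcarrier H \<Longrightarrow> y \<in> hcarrier H \<Longrightarrow> v \<in> hcarrier H \<Longrightarrow>
    hinner H v (x - y) = hinner H v x - hinner H v y"
  using inner_add2[of x "- y" v] by (simp add: inner_minus_right)

lemma inner_sum_left:
  "(\<And>i. i \<in> I \<Longrightarrow> f i \<in> hcarrier H) \<Longrightarrow> v \<in> hcarrier H \<Longrightarrow>
    hinner H (sum f I) v = (\<Sum>i\<in>I. hinner H (f i) v)"
  by (induction I rule: infinite_finite_induct) (simp_all add: inner_add)

lemma inner_sum_right:
  "(\<And>i. i \<in> I \<Longrightarrow> f i \<in> hcarrier H) \<Longrightarrow> v \<in> hcarrier H \<Longrightarrow>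
    hinner H v (sum f I) = (\<Sum>i\<in>I. hinner H v (f i))"
  by (induction I rule: infinite_finite_induct) (simp_all add: inner_add2)

lemma norm_nonneg [simp]: "x \<in> hcarrier H \<Longrightarrow> 0 \<le> hnorm H x"
  by (simp add: hnorm_def inner_ge)

lemma norm_zero [simp]: "hnorm H 0 = 0"
  by (simp add: norm_eq_0_iff)

lemma norm_uminus: "x \<in> hcarrier H \<Longrightarrow> hnorm H (- x) = hnorm H x"
  by (simp add: hnorm_def inner_minus_left inner_minus_right)

lemma norm_minus_commute: "x \<in> hcarrier H \<Longrightarrow> y \<in> hcarrier H \<Longrightarrow> hnorm H (x - y) = hnorm H (y - x)"
  using norm_uminus[of "x - y"] by simp

lemma inner_self: "x \<in> hcarrier H \<Longrightarrow> hinner H x x = of_real ((hnorm H x)\<^sup>2)"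
  using inner_commute[of x x] by (simp add: norm_power2 complex_eq_iff del: of_real_power)

lemma inner_self_eq_0D: "x \<in> hcarrier H \<Longrightarrow> hinner H x x = 0 \<Longrightarrow> x = 0"
  using norm_eq_0_iff[of x] by (simp add: hnorm_def)

lemma Cauchy_Schwarz:
  assumes "x \<in> hcarrier H" "y \<in> hcarrier H"
  shows "cmod (hinner H x y) \<le> hnorm H x * hnorm H y"
proof (cases "hinner H x y = 0")
  case False
  \<comment> \<open>\<open>a\<close> is the unimodular factor that rotates the inner product onto
    the positive real axis, which reduces the claim to \<open>Re_inner_le\<close>.\<close>
  define w a where "w = hinner H x y" and "a = cnj w / of_real (cmod w)"
  have "w \<noteq> 0"
    using False by (simp add: w_def)
  then have "cmod a = 1" "a * w = of_real (cmod w)"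
    by (simp_all add: a_def norm_divide complex_norm_square[symmetric] power2_eq_square mult.commute
        field_simps)
  then have "cmod w = Re (hinner H (a *\<^sub>C x) y)"
    using assms by (simp add: inner_scale flip: w_def)
  also have "\<dots> \<le> hnorm H x * hnorm H y"
    using Re_inner_le[of "a *\<^sub>C x" y] assms \<open>cmod a = 1\<close> by (simp add: norm_scale)
  finally show ?thesis
    by (simp add: w_def)
qed (use assms in simp)

lemma norm_triangle_diff:
  assumes "x \<in> hcarrier H" "y \<in> hcarrier H"
  shows "\<bar>hnorm H x - hnorm H y\<bar> \<le> hnorm H (x - y)"
  using norm_triangle[of "x - y" y] norm_triangle[of "y - x" x] norm_minus_commute[of x y] assms
  by simp

lemma norm_sum_le:
  "(\<And>i. i \<in> I \<Longrightarrow> f i \<in> hcarrier H) \<Longrightarrow> hnorm H (sum f I) \<le> (\<Sum>i\<in>I. hnorm H (f i))"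
proof (induction I rule: infinite_finite_induct)
  case (insert i I)
  then show ?case
    using norm_triangle[of "f i" "sum f I"] by force
qed simp_all

lemma parallelogram:
  assumes "x \<in> hcarrier H" "y \<in> hcarrier H"
  shows "(hnorm H (x + y))\<^sup>2 + (hnorm H (x - y))\<^sup>2 = 2 * (hnorm H x)\<^sup>2 + 2 * (hnorm H y)\<^sup>2"
  using assms by (simp add: norm_power2 inner_add inner_add2 inner_diff_left inner_diff_right)

lemma inner_eqI:
  assumes "x \<in> hcarrier H" "y \<in> hcarrier H"
    and "\<And>v. v \<in> hcarrier H \<Longrightarrow> hinner H v x = hinner H v y"
  shows "x = y"
proof -
  have "x - y = 0"
    using assms by (intro inner_self_eq_0D) (simp_all add: inner_diff_right)
  then show ?thesis
    by simp
qed

lemma norm_sum_orthogonal: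
  assumes "finite I" "\<And>i. i \<in> I \<Longrightarrow> f i \<in> hcarrier H"
    and "\<And>i j. i \<in> I \<Longrightarrow> j \<in> I \<Longrightarrow> i \<noteq> j \<Longrightarrow> hinner H (f i) (f j) = 0"
  shows "(hnorm H (sum f I))\<^sup>2 = (\<Sum>i\<in>I. (hnorm H (f i))\<^sup>2)"
  using assms
proof (induction I rule: finite_induct)
  case (insert i I)
  have "hinner H (f i) (sum f I) = 0"
    using insert by (subst inner_sum_right) (auto intro!: sum.neutral)
  then show ?case
    using insert by (simp add: norm_add_power2)
qed simp

lemma limitin_iff:
  assumes "\<And>n. f n \<in> hcarrier H"
  shows "limitin (htopology H) f l sequentially \<longleftrightarrow>
    l \<in> hcarrier H \<and> (\<lambda>n. hnorm H (f n - l)) \<longlonglongrightarrow> 0"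
proof -
  interpret Metric_space "hcarrier H" "hdist H"
    by (rule metric)
  show ?thesis
    unfolding limit_metric_sequentially LIMSEQ_iff using assms by (auto simp: hdist_def)
qed

lemma limitin_unique:
  "limitin (htopology H) f l sequentially \<Longrightarrow> limitin (htopology H) f l' sequentially \<Longrightarrow> l = l'"
  by (rule Metric_space.limitin_metric_unique[OF metric]) auto

lemma hsums_iff:
  assumes "\<And>j. f j \<in> hcarrier H"
  shows "hsums H f s \<longleftrightarrow> s \<in> hcarrier H \<and> (\<lambda>N. hnorm H ((\<Sum>j<N. f j) - s)) \<longlonglongrightarrow> 0"
  unfolding hsums_def using assms by (subst limitin_iff) auto

lemma hsuminf_eqI: "hsums H f s \<Longrightarrow> hsuminf H f = s"
  unfolding hsuminf_def hsums_def by (rule the_equality) (auto intro: limitin_unique)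

lemma tendsto_inner_left:
  assumes "\<And>n. f n \<in> hcarrier H" "l \<in> hcarrier H" "v \<in> hcarrier H"
    and "(\<lambda>n. hnorm H (f n - l)) \<longlonglongrightarrow> 0"
  shows "(\<lambda>n. hinner H (f n) v) \<longlonglongrightarrow> hinner H l v"
proof (rule LIM_zero_cancel, rule Lim_null_comparison)
  show "\<forall>\<^sub>F n in sequentially. norm (hinner H (f n) v - hinner H l v) \<le> hnorm H (f n - l) * hnorm H v"
    using assms Cauchy_Schwarz[of "f _ - l" v] by (simp add: inner_diff_left)
  show "(\<lambda>n. hnorm H (f n - l) * hnorm H v) \<longlonglongrightarrow> 0"
    using tendsto_mult_left_zero[OF assms(4)] .
qed

lemma tendsto_norm:
  assumes "\<And>n. f n \<in> hcarrier H" "l \<in> hcarrier H" "(\<lambda>n. hnorm H (f n - l)) \<longlonglongrightarrow> 0"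
  shows "(\<lambda>n. hnorm H (f n)) \<longlonglongrightarrow> hnorm H l"
  by (rule LIM_zero_cancel, rule Lim_null_comparison[OF _ assms(3)])
    (use assms(1,2) norm_triangle_diff in auto)

lemma hsums_inner:
  assumes "\<And>j. f j \<in> hcarrier H" "v \<in> hcarrier H" "hsums H f s"
  shows "(\<lambda>j. hinner H (f j) v) sums hinner H s v"
proof -
  have "(\<lambda>N. hinner H (\<Sum>j<N. f j) v) \<longlonglongrightarrow> hinner H s v"
    using assms by (intro tendsto_inner_left) (auto simp: hsums_iff)
  then show ?thesis
    using assms by (simp add: sums_def inner_sum_left)
qed

lemma hilbert_spaceI:
  assumes "\<And>f. (\<And>n. f n \<in> hcarrier H) \<Longrightarrow>
      (\<And>e. e > 0 \<Longrightarrow> \<exists>N. \<forall>m\<ge>N. \<forall>n\<ge>N. hnorm H (f m - f n) < e) \<Longrightarrow>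
      \<exists>l\<in>hcarrier H. (\<lambda>n. hnorm H (f n - l)) \<longlonglongrightarrow> 0"
  shows "hilbert_space H"
proof
  interpret Metric_space "hcarrier H" "hdist H"
    by (rule metric)
  show "mcomplete"
    unfolding mcomplete_def
  proof (intro allI impI)
    fix f
    assume f: "MCauchy f"
    then have fH: "f n \<in> hcarrier H" for n
      by (auto simp: MCauchy_def)
    have "\<exists>N. \<forall>m\<ge>N. \<forall>n\<ge>N. hnorm H (f m - f n) < e" if "e > 0" for e
    proof -
      from f that obtain N where "\<forall>n n'. N \<le> n \<longrightarrow> N \<le> n' \<longrightarrow> hdist H (f n) (f n') < e"
        by (auto simp: MCauchy_def)
      then show ?thesis
        using fH by (intro exI[of _ N]) (simp add: hdist_def)
    qed
    from assms[OF fH this] obtain l where "l \<in> hcarrier H" "(\<lambda>n. hnorm H (f n - l)) \<longlonglongrightarrow> 0"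
      by blast
    then show "\<exists>l. limitin mtopology f l sequentially"
      unfolding limitin_iff[OF fH] by blast
  qed
qed

lemma closedin_iff:
  "closedin (htopology H) M \<longleftrightarrow> M \<subseteq> hcarrier H \<and>
    (\<forall>f l. (\<forall>n. f n \<in> M) \<and> l \<in> hcarrier H \<and> (\<lambda>n. hnorm H (f n - l)) \<longlonglongrightarrow> 0 \<longrightarrow> l \<in> M)"
proof -
  have "closedin (htopology H) M \<longleftrightarrow> M \<subseteq> hcarrier H \<and>
      (\<forall>f l. range f \<subseteq> M \<and> limitin (htopology H) f l sequentially \<longrightarrow> l \<in> M)"
    by (rule Metric_space.metric_closedin_iff_sequentially_closed[OF metric])
  also have "\<dots> \<longleftrightarrow> M \<subseteq> hcarrier H \<and>
    (\<forall>f l. (\<forall>n. f n \<in> M) \<and> l \<in> hcarrier H \<and> (\<lambda>n. hnorm H (f n - l)) \<longlonglongrightarrow> 0 \<longrightarrow> l \<in> M)"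
  proof (intro conj_cong all_cong1 refl)
    fix f l
    assume "M \<subseteq> hcarrier H"
    then show "(range f \<subseteq> M \<and> limitin (htopology H) f l sequentially \<longrightarrow> l \<in> M) \<longleftrightarrow>
       ((\<forall>n. f n \<in> M) \<and> l \<in> hcarrier H \<and> (\<lambda>n. hnorm H (f n - l)) \<longlonglongrightarrow> 0 \<longrightarrow> l \<in> M)"
      using limitin_iff[of f l] by (auto simp: image_subset_iff subset_iff)
  qed
  finally show ?thesis .
qed

lemma closed_subspaceI:
  assumes "M \<subseteq> hcarrier H" "complex_vector.subspace M"
    and "\<And>f l. (\<And>n. f n \<in> M) \<Longrightarrow> l \<in> hcarrier H \<Longrightarrow> (\<lambda>n. hnorm H (f n - l)) \<longlonglongrightarrow> 0 \<Longrightarrow> l \<in> M"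
  shows "closed_subspace H M"
  using assms by (auto simp: closed_subspace_def closedin_iff)

lemma closed_subspace_limit:
  "closed_subspace H M \<Longrightarrow> (\<And>n. f n \<in> M) \<Longrightarrow> l \<in> hcarrier H \<Longrightarrow>
    (\<lambda>n. hnorm H (f n - l)) \<longlonglongrightarrow> 0 \<Longrightarrow> l \<in> M"
  unfolding closed_subspace_def closedin_iff by blast

lemma closed_subspace_hsums:
  assumes M: "closed_subspace H M" and f: "\<And>j. f j \<in> M" and "hsums H f s"
  shows "s \<in> M"
proof (rule closed_subspace_limit[OF M])
  have "\<And>j. f j \<in> hcarrier H"
    using M f by (auto simp: closed_subspace_def)
  with assms show "s \<in> hcarrier H" "(\<lambda>N. hnorm H ((\<Sum>j<N. f j) - s)) \<longlonglongrightarrow> 0"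
    by (auto simp: hsums_iff)
  show "(\<Sum>j<N. f j) \<in> M" for N
    using M f by (auto simp: closed_subspace_def intro: complex_vector.subspace_sum)
qed

lemma closed_subspace_inter:
  "closed_subspace H M \<Longrightarrow> closed_subspace H N \<Longrightarrow> closed_subspace H (M \<inter> N)"
  unfolding closed_subspace_def by (auto intro: complex_vector.subspace_inter)

lemma closed_subspace_orth_compl:
  assumes "S \<subseteq> hcarrier H"
  shows "closed_subspace H (orth_compl H S)"
proof (rule closed_subspaceI)
  show "complex_vector.subspace (orth_compl H S)"
    using assms by (auto simp: complex_vector.subspace_def orth_compl_def inner_add inner_scale
        subset_iff)
next
  fix f l
  assume f: "\<And>n. f n \<in> orth_compl H S" and l: "l \<in> hcarrier H"
    and lim: "(\<lambda>n. hnorm H (f n - l)) \<longlonglongrightarrow> 0"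
  have "hinner H l v = 0" if "v \<in> S" for v
  proof -
    have "(\<lambda>n. hinner H (f n) v) \<longlonglongrightarrow> hinner H l v"
      using f l lim that assms by (intro tendsto_inner_left) (auto simp: orth_compl_def)
    then show ?thesis
      using f that by (simp add: orth_compl_def LIMSEQ_const_iff)
  qed
  with l show "l \<in> orth_compl H S"
    by (simp add: orth_compl_def)
qed (auto simp: orth_compl_def)

lemma inner_eq_0_commute:
  "x \<in> hcarrier H \<Longrightarrow> y \<in> hcarrier H \<Longrightarrow> hinner H x y = 0 \<longleftrightarrow> hinner H y x = 0"
  by (metis complex_cnj_zero inner_commute)

lemma closed_span_minimal:
  assumes "closed_subspace H M" "S \<subseteq> M"
  shows "closed_span H S \<subseteq> M"
  unfolding closed_span_def using assms unfolding closed_subspace_def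
  by (intro closure_of_minimal complex_vector.span_minimal) simp_all

lemma span_subset: "S \<subseteq> hcarrier H \<Longrightarrow> complex_vector.span S \<subseteq> hcarrier H"
  by (rule complex_vector.span_minimal[OF _ subspace])

lemma topspace_eq: "topspace (htopology H) = hcarrier H"
  using Metric_space.topspace_mtopology[OF metric] .

lemma closed_span_superset: "S \<subseteq> hcarrier H \<Longrightarrow> S \<subseteq> closed_span H S"
  unfolding closed_span_def
  using closure_of_subset[of "complex_vector.span S" "htopology H"] span_subset[of S]
    complex_vector.span_superset[of S]
  by (auto simp: topspace_eq)

lemma closure_of_eq:
  assumes "S \<subseteq> hcarrier H"
  shows "htopology H closure_of S =
    {x \<in> hcarrier H. \<exists>f. (\<forall>n. f n \<in> S) \<and> (\<lambda>n. hnorm H (f n - x)) \<longlonglongrightarrow> 0}"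
proof -
  have *: "(range f \<subseteq> S \<inter> hcarrier H \<and> limitin (htopology H) f x sequentially) \<longleftrightarrow>
     (\<forall>n. f n \<in> S) \<and> (\<lambda>n. hnorm H (f n - x)) \<longlonglongrightarrow> 0" if "x \<in> hcarrier H" for f x
    using that assms limitin_iff[of f x] by (auto simp: image_subset_iff subset_iff)
  show ?thesis
    unfolding Metric_space.closure_of_sequentially[OF metric]
    by (rule Collect_cong, rule conj_cong[OF refl], rule ex_cong1, rule *)
qed

lemma closed_subspace_closure_of:
  assumes "S \<subseteq> hcarrier H" "complex_vector.subspace S"
  shows "closed_subspace H (htopology H closure_of S)"
proof -
  let ?M = "htopology H closure_of S"
  note M = closure_of_eq[OF assms(1)]
  have "complex_vector.subspace ?M"
  proof (rule complex_vector.subspaceI)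
    show "0 \<in> ?M"
      unfolding M using complex_vector.subspace_0[OF assms(2)]
      by (intro CollectI conjI exI[of _ "\<lambda>_. 0"]) simp_all
  next
    fix x y
    assume "x \<in> ?M" "y \<in> ?M"
    then obtain f g where xy: "x \<in> hcarrier H" "y \<in> hcarrier H" "\<forall>n. f n \<in> S" "\<forall>n. g n \<in> S"
      and lim: "(\<lambda>n. hnorm H (f n - x)) \<longlonglongrightarrow> 0" "(\<lambda>n. hnorm H (g n - y)) \<longlonglongrightarrow> 0"
      unfolding M by blast
    have fg: "f n \<in> hcarrier H" "g n \<in> hcarrier H" for n
      using xy assms by auto
    have "norm (hnorm H (f n + g n - (x + y))) \<le> hnorm H (f n - x) + hnorm H (g n - y)" for n
      using norm_triangle[of "f n - x" "g n - y"] xy fg by (simp add: algebra_simps)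
    then have "(\<lambda>n. hnorm H (f n + g n - (x + y))) \<longlonglongrightarrow> 0"
      by (rule real_tendsto_0_le[OF _ tendsto_add_zero[OF lim]])
    then show "x + y \<in> ?M"
      unfolding M using xy complex_vector.subspace_add[OF assms(2)]
      by (intro CollectI conjI exI[of _ "\<lambda>n. f n + g n"]) simp_all
  next
    fix a x
    assume "x \<in> ?M"
    then obtain f where x: "x \<in> hcarrier H" "\<forall>n. f n \<in> S"
      and lim: "(\<lambda>n. hnorm H (f n - x)) \<longlonglongrightarrow> 0"
      unfolding M by blast
    have f: "f n \<in> hcarrier H" for n
      using x assms by auto
    have "hnorm H (a *\<^sub>C f n - a *\<^sub>C x) = cmod a * hnorm H (f n - x)" for n
      using x f norm_scale[of "f n - x" a] by (simp add: complex_vector.scale_right_diff_distrib)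
    then have "(\<lambda>n. hnorm H (a *\<^sub>C f n - a *\<^sub>C x)) \<longlonglongrightarrow> 0"
      using tendsto_mult_right_zero[OF lim] by simp
    then show "a *\<^sub>C x \<in> ?M"
      unfolding M using x complex_vector.subspace_scale[OF assms(2)]
      by (intro CollectI conjI exI[of _ "\<lambda>n. a *\<^sub>C f n"]) simp_all
  qed
  then show ?thesis
    using closure_of_subset_topspace[of "htopology H" S] by (simp add: closed_subspace_def topspace_eq)
qed

lemma closed_subspace_closed_span: "S \<subseteq> hcarrier H \<Longrightarrow> closed_subspace H (closed_span H S)"
  unfolding closed_span_def by (intro closed_subspace_closure_of span_subset complex_vector.subspace_span)

lemma orthogonal_closed_span:
  assumes "S \<subseteq> hcarrier H" "x \<in> hcarrier H" "\<And>v. v \<in> S \<Longrightarrow> hinner H x v = 0" "y \<in> closed_span H S"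
  shows "hinner H x y = 0"
proof -
  have "closed_span H S \<subseteq> orth_compl H {x}"
    using assms inner_eq_0_commute
    by (intro closed_span_minimal closed_subspace_orth_compl) (auto simp: orth_compl_def)
  then show ?thesis
    using assms(2,4) inner_eq_0_commute by (auto simp: orth_compl_def)
qed

end

section \<open>Bounded operators between carriers\<close>

lemma bounded_operator_mem: "bounded_operator H K T \<Longrightarrow> x \<in> hcarrier H \<Longrightarrow> T x \<in> hcarrier K"
  by (auto simp: bounded_operator_def)

lemma bounded_operator_add:
  "bounded_operator H K T \<Longrightarrow> x \<in> hcarrier H \<Longrightarrow> y \<in> hcarrier H \<Longrightarrow> T (x + y) = T x + T y"
  by (auto simp: bounded_operator_def)

lemma bounded_operator_scale:
  "bounded_operator H K T \<Longrightarrow> x \<in> hcarrier H \<Longrightarrow> T (a *\<^sub>C x) = a *\<^sub>C T x"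
  by (auto simp: bounded_operator_def)

lemma bounded_operator_zero: "bounded_operator H K T \<Longrightarrow> x \<in> hcarrier H \<Longrightarrow> T 0 = 0"
  using bounded_operator_scale[of H K T x 0] by simp

lemma bounded_operator_uminus: "bounded_operator H K T \<Longrightarrow> x \<in> hcarrier H \<Longrightarrow> T (- x) = - T x"
  using bounded_operator_scale[of H K T x "-1"] by simp

lemma (in inner_product_space) bounded_operator_diff:
  "bounded_operator H K T \<Longrightarrow> x \<in> hcarrier H \<Longrightarrow> y \<in> hcarrier H \<Longrightarrow> T (x - y) = T x - T y"
  using bounded_operator_add[of H K T x "- y"] bounded_operator_uminus[of H K T y]
  by simp

lemma (in inner_product_space) bounded_operator_sum:
  "bounded_operator H K T \<Longrightarrow> (\<And>i. i \<in> I \<Longrightarrow> f i \<in> hcarrier H) \<Longrightarrow> T (sum f I) = (\<Sum>i\<in>I. T (f i))"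
  by (induction I rule: infinite_finite_induct)
    (auto simp: bounded_operator_add bounded_operator_zero[OF _ zero_mem])

lemma (in inner_product_space) bounded_operator_bound:
  assumes "bounded_operator H K T"
  obtains c where "c > 0" "\<And>x. x \<in> hcarrier H \<Longrightarrow> hnorm K (T x) \<le> c * hnorm H x"
proof -
  from assms obtain c where c: "\<And>x. x \<in> hcarrier H \<Longrightarrow> hnorm K (T x) \<le> c * hnorm H x"
    unfolding bounded_operator_def by blast
  show ?thesis
  \<comment> \<open>The constant supplied by \<open>bounded_operator\<close> may be zero or
    negative; a positive one can be used as a factor in inequalities.\<close>
  proof (rule that[of "\<bar>c\<bar> + 1"])
    fix x
    assume x: "x \<in> hcarrier H"
    have "c * hnorm H x \<le> (\<bar>c\<bar> + 1) * hnorm H x"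
      by (rule mult_right_mono) (use x in auto)
    with c[OF x] show "hnorm K (T x) \<le> (\<bar>c\<bar> + 1) * hnorm H x"
      by linarith
  qed simp
qed

lemma bounded_operatorI:
  assumes "\<And>x. x \<in> hcarrier H \<Longrightarrow> T x \<in> hcarrier K"
    and "\<And>x y. x \<in> hcarrier H \<Longrightarrow> y \<in> hcarrier H \<Longrightarrow> T (x + y) = T x + T y"
    and "\<And>a x. x \<in> hcarrier H \<Longrightarrow> T (a *\<^sub>C x) = a *\<^sub>C T x"
    and "\<And>x. x \<in> hcarrier H \<Longrightarrow> hnorm K (T x) \<le> c * hnorm H x"
  shows "bounded_operator H K T"
  unfolding bounded_operator_def using assms by (simp add: image_subset_iff) blast

lemma bounded_operator_funpow:
  assumes "inner_product_space H" "bounded_operator H H T"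
  shows "bounded_operator H H (T ^^ j)"
proof -
  interpret inner_product_space H
    by (rule assms)
  obtain c where c: "c > 0" "\<And>x. x \<in> hcarrier H \<Longrightarrow> hnorm H (T x) \<le> c * hnorm H x"
    using bounded_operator_bound[OF assms(2)] by blast
  have "(\<forall>x\<in>hcarrier H. (T ^^ j) x \<in> hcarrier H \<and> hnorm H ((T ^^ j) x) \<le> c ^ j * hnorm H x) \<and>
    (\<forall>x\<in>hcarrier H. \<forall>y\<in>hcarrier H. (T ^^ j) (x + y) = (T ^^ j) x + (T ^^ j) y) \<and>
    (\<forall>a. \<forall>x\<in>hcarrier H. (T ^^ j) (a *\<^sub>C x) = a *\<^sub>C (T ^^ j) x)"
  proof (induction j)
    case (Suc j)
    have "hnorm H (T ((T ^^ j) x)) \<le> c * (c ^ j * hnorm H x)" if "x \<in> hcarrier H" for x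
    proof -
      have "hnorm H (T ((T ^^ j) x)) \<le> c * hnorm H ((T ^^ j) x)"
        using c(2) Suc that by simp
      also have "\<dots> \<le> c * (c ^ j * hnorm H x)"
        using Suc that c(1) by (intro mult_left_mono) auto
      finally show ?thesis .
    qed
    with Suc assms(2) show ?case
      by (simp add: bounded_operator_mem[OF assms(2)] bounded_operator_add[OF assms(2)] bounded_operator_scale[OF assms(2)] mult.assoc)
  qed auto
  then show ?thesis
    by (intro bounded_operatorI[where c = "c ^ j"]) auto
qed

lemma tendsto_bounded_operator:
  assumes "inner_product_space H" "inner_product_space K" "bounded_operator H K T"
    and "\<And>n. f n \<in> hcarrier H" "l \<in> hcarrier H" "(\<lambda>n. hnorm H (f n - l)) \<longlonglongrightarrow> 0"
  shows "(\<lambda>n. hnorm K (T (f n) - T l)) \<longlonglongrightarrow> 0"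
proof -
  interpret H: inner_product_space H
    by (rule assms)
  interpret K: inner_product_space K
    by (rule assms)
  obtain c where c: "\<And>x. x \<in> hcarrier H \<Longrightarrow> hnorm K (T x) \<le> c * hnorm H x"
    using H.bounded_operator_bound[OF assms(3)] by blast
  have "norm (hnorm K (T (f n) - T l)) \<le> c * hnorm H (f n - l)" for n
    using c[of "f n - l"] assms(4,5)
    by (simp add: H.bounded_operator_diff[OF assms(3)] bounded_operator_mem[OF assms(3)])
  then show ?thesis
    by (rule real_tendsto_0_le[OF _ tendsto_mult_right_zero[OF assms(6)]])
qed

lemma hsums_bounded_operator:
  assumes "inner_product_space H" "inner_product_space K" "bounded_operator H K T"
    and f: "\<And>j. f j \<in> hcarrier H" and s: "hsums H f s"
  shows "hsums K (\<lambda>j. T (f j)) (T s)"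
proof -
  interpret H: inner_product_space H
    by (rule assms)
  interpret K: inner_product_space K
    by (rule assms)
  have "s \<in> hcarrier H" "(\<lambda>N. hnorm H ((\<Sum>j<N. f j) - s)) \<longlonglongrightarrow> 0"
    using s f by (auto simp: H.hsums_iff)
  then have "(\<lambda>N. hnorm K (T (\<Sum>j<N. f j) - T s)) \<longlonglongrightarrow> 0"
    using f by (intro tendsto_bounded_operator[OF assms(1-3)]) auto
  then show ?thesis
    using f \<open>s \<in> hcarrier H\<close>
    by (simp add: K.hsums_iff H.bounded_operator_sum[OF assms(3)] bounded_operator_mem[OF assms(3)])
qed

lemma hcarrier_hsubspace [simp]: "hcarrier (hsubspace H M) = M"
  and hinner_hsubspace [simp]: "hinner (hsubspace H M) = hinner H"
  by (simp_all add: hsubspace_def)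

lemma hnorm_hsubspace [simp]: "hnorm (hsubspace H M) = hnorm H"
  by (simp add: hnorm_def fun_eq_iff)

lemma quadratic_nonneg_linear_coeff_zero:
  fixes a b :: real
  assumes "\<And>t. 0 \<le> 2 * t * a + t\<^sup>2 * b" "0 \<le> b"
  shows "a = 0"
proof (rule ccontr)
  assume "a \<noteq> 0"
  \<comment> \<open>The quadratic is least at -a/b; the \<open>+ 1\<close> covers b = 0 and still
    produces a negative value.\<close>
  have "0 \<le> 2 * (- a / (b + 1)) * a + (- a / (b + 1))\<^sup>2 * b"
    by (rule assms)
  also have "\<dots> = - (a\<^sup>2 * (b + 2)) / (b + 1)\<^sup>2"
    using assms(2) by (simp add: divide_simps power2_eq_square) (simp add: algebra_simps)
  also have "\<dots> < 0"
    using assms(2) \<open>a \<noteq> 0\<close> by (intro divide_neg_pos) auto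
  finally show False
    by simp
qed

section \<open>Completeness, Riesz representation and projections\<close>

context hilbert_space
begin

lemma Cauchy_limit:
  assumes "\<And>n. f n \<in> hcarrier H"
    and "\<And>e. e > 0 \<Longrightarrow> \<exists>N. \<forall>m\<ge>N. \<forall>n\<ge>N. hnorm H (f m - f n) < e"
  obtains l where "l \<in> hcarrier H" "(\<lambda>n. hnorm H (f n - l)) \<longlonglongrightarrow> 0"
proof -
  interpret Metric_space "hcarrier H" "hdist H"
    by (rule metric)
  have "MCauchy f"
    unfolding MCauchy_def
  proof (intro conjI allI impI)
    fix e :: real
    assume "e > 0"
    with assms(2) obtain N where "\<forall>m\<ge>N. \<forall>n\<ge>N. hnorm H (f m - f n) < e"
      by blast
    then show "\<exists>N. \<forall>n n'. N \<le> n \<longrightarrow> N \<le> n' \<longrightarrow> hdist H (f n) (f n') < e"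
      using assms(1) by (intro exI[of _ N]) (simp add: hdist_def)
  qed (use assms(1) in auto)
  then obtain l where "limitin (htopology H) f l sequentially"
    using complete unfolding mcomplete_def by blast
  then have "l \<in> hcarrier H \<and> (\<lambda>n. hnorm H (f n - l)) \<longlonglongrightarrow> 0"
    using assms(1) by (simp add: limitin_iff)
  then show ?thesis
    using that by blast
qed

lemma hsums_Cauchy:
  assumes f: "\<And>n. f n \<in> hcarrier H"
    and C: "\<And>e. e > 0 \<Longrightarrow> \<exists>N. \<forall>m\<ge>N. \<forall>n\<ge>m. hnorm H (sum f {m..<n}) < e"
  shows "\<exists>s. hsums H f s"
proof -
  have *: "(\<Sum>j<n. f j) - (\<Sum>j<m. f j) = sum f {m..<n}" if "m \<le> n" for m n
    using sum_diff_nat_ivl[of 0 m n f] that by (simp add: lessThan_atLeast0)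
  obtain s where "s \<in> hcarrier H" "(\<lambda>N. hnorm H ((\<Sum>j<N. f j) - s)) \<longlonglongrightarrow> 0"
  proof (rule Cauchy_limit[of "\<lambda>N. \<Sum>j<N. f j"])
    fix e :: real
    assume "e > 0"
    then obtain N where N: "\<And>m n. m \<ge> N \<Longrightarrow> n \<ge> m \<Longrightarrow> hnorm H (sum f {m..<n}) < e"
      using C by blast
    have "hnorm H ((\<Sum>j<m. f j) - (\<Sum>j<n. f j)) < e" if "m \<ge> N" "n \<ge> N" for m n
    proof (cases "m \<le> n")
      case True
      have "hnorm H ((\<Sum>j<m. f j) - (\<Sum>j<n. f j)) = hnorm H ((\<Sum>j<n. f j) - (\<Sum>j<m. f j))"
        using f by (intro norm_minus_commute) auto
      then show ?thesis
        using *[OF True] N that True by simp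
    next
      case False
      then show ?thesis
        using *[of n m] N that by simp
    qed
    then show "\<exists>N. \<forall>m\<ge>N. \<forall>n\<ge>N. hnorm H ((\<Sum>j<m. f j) - (\<Sum>j<n. f j)) < e"
      by blast
  qed (use f in auto)
  then show ?thesis
    using f by (auto simp: hsums_iff)
qed

lemma hsums_absolute:
  assumes f: "\<And>n. f n \<in> hcarrier H" and s: "summable (\<lambda>j. hnorm H (f j))"
  shows "\<exists>s. hsums H f s"
proof (rule hsums_Cauchy[OF f])
  fix e :: real
  assume "e > 0"
  with s obtain N where N: "\<And>m n. m \<ge> N \<Longrightarrow> norm (\<Sum>j=m..<n. hnorm H (f j)) < e"
    unfolding summable_Cauchy by blast
  have "hnorm H (sum f {m..<n}) < e" if "m \<ge> N" for m n
    using norm_sum_le[of "{m..<n}" f] N[OF that, of n] f by (simp add: sum_nonneg)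
  then show "\<exists>N. \<forall>m\<ge>N. \<forall>n\<ge>m. hnorm H (sum f {m..<n}) < e"
    by blast
qed

lemma hsums_orthogonal:
  assumes f: "\<And>n. f n \<in> hcarrier H" and s: "summable (\<lambda>j. (hnorm H (f j))\<^sup>2)"
    and o: "\<And>i j. i \<noteq> j \<Longrightarrow> hinner H (f i) (f j) = 0"
  shows "\<exists>s. hsums H f s"
proof (rule hsums_Cauchy[OF f])
  fix e :: real
  assume "e > 0"
  then have "e\<^sup>2 > 0"
    by simp
  with s obtain N where N: "\<And>m n. m \<ge> N \<Longrightarrow> norm (\<Sum>j=m..<n. (hnorm H (f j))\<^sup>2) < e\<^sup>2"
    unfolding summable_Cauchy by blast
  have "hnorm H (sum f {m..<n}) < e" if "m \<ge> N" for m n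
  proof (rule power2_less_imp_less)
    show "(hnorm H (sum f {m..<n}))\<^sup>2 < e\<^sup>2"
      using N[OF that, of n] f o by (subst norm_sum_orthogonal) auto
  qed (use \<open>e > 0\<close> in simp)
  then show "\<exists>N. \<forall>m\<ge>N. \<forall>n\<ge>m. hnorm H (sum f {m..<n}) < e"
    by blast
qed

text \<open>The representing vector minimises \<open>\<parallel>x\<parallel>\<^sup>2 - 2 Re f(x)\<close>; minimising sequences are Cauchy by the
  parallelogram law.\<close>

theorem Riesz_representation:
  assumes add: "\<And>x y. x \<in> hcarrier H \<Longrightarrow> y \<in> hcarrier H \<Longrightarrow> f (x + y) = f x + f y"
    and scale: "\<And>a x. x \<in> hcarrier H \<Longrightarrow> f (a *\<^sub>C x) = a * f x"
    and bound: "\<And>x. x \<in> hcarrier H \<Longrightarrow> cmod (f x) \<le> c * hnorm H x"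
  shows "\<exists>y\<in>hcarrier H. \<forall>x\<in>hcarrier H. f x = hinner H x y"
proof -
  define J where "J x = (hnorm H x)\<^sup>2 - 2 * Re (f x)" for x
  define m where "m = (INF x\<in>hcarrier H. J x)"
  have f_diff: "f (x - y) = f x - f y" if "x \<in> hcarrier H" "y \<in> hcarrier H" for x y
    using add[of x "- y"] scale[of y "-1"] that by simp
  have "- c\<^sup>2 \<le> J x" if "x \<in> hcarrier H" for x
  proof -
    have "Re (f x) \<le> c * hnorm H x"
      using bound[OF that] complex_Re_le_cmod[of "f x"] by linarith
    moreover have "0 \<le> (hnorm H x - c)\<^sup>2"
      by simp
    ultimately show ?thesis
      unfolding J_def by (simp add: power2_diff algebra_simps)
  qed
  then have bdd: "bdd_below (J ` hcarrier H)"
    by (intro bdd_belowI[of _ "- c\<^sup>2"]) auto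
  have m_le: "m \<le> J x" if "x \<in> hcarrier H" for x
    unfolding m_def using bdd that by (rule cINF_lower)
  have "\<exists>x\<in>hcarrier H. J x < m + 1 / Suc n" for n
  proof -
    have "m < m + 1 / Suc n"
      by simp
    moreover have "hcarrier H \<noteq> {}"
      using zero_mem by blast
    ultimately show ?thesis
      unfolding m_def using bdd by (subst (asm) cINF_less_iff) (auto simp flip: m_def)
  qed
  then obtain X where X: "\<And>n. X n \<in> hcarrier H" "\<And>n. J (X n) < m + 1 / Suc n"
    by metis
  define r where "r n = 1 / real (Suc n)" for n
  have X_r: "J (X n) < m + r n" for n
    using X(2) by (simp add: r_def)
  have dist: "(hnorm H (x - y))\<^sup>2 \<le> 2 * (J x - m) + 2 * (J y - m)"
    if x: "x \<in> hcarrier H" and y: "y \<in> hcarrier H" for x y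
  proof -
    have "m \<le> J ((1/2) *\<^sub>C (x + y))"
      using x y by (intro m_le) simp
    also have "\<dots> = (hnorm H (x + y))\<^sup>2 / 4 - Re (f x) - Re (f y)"
      using x y by (simp add: J_def norm_scale scale add power_divide) (simp add: field_simps)
    finally show ?thesis
      using parallelogram[OF x y] by (simp add: J_def)
  qed
  obtain l where l: "l \<in> hcarrier H" and lim: "(\<lambda>n. hnorm H (X n - l)) \<longlonglongrightarrow> 0"
  proof (rule Cauchy_limit[of X])
    fix e :: real
    assume e: "e > 0"
    obtain N :: nat where N: "r N < e\<^sup>2 / 4"
      unfolding r_def using nat_approx_posE[of "e\<^sup>2 / 4"] e by auto
    have "hnorm H (X i - X j) < e" if "i \<ge> N" "j \<ge> N" for i j
    proof (rule power2_less_imp_less)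
      have "r i \<le> r N" "r j \<le> r N"
        using that by (auto simp: r_def frac_le)
      then have "J (X i) - m < e\<^sup>2 / 4" "J (X j) - m < e\<^sup>2 / 4"
        using X_r[of i] X_r[of j] N by linarith+
      then show "(hnorm H (X i - X j))\<^sup>2 < e\<^sup>2"
        using dist[OF X(1)[of i] X(1)[of j]] by simp
    qed (use e in simp)
    then show "\<exists>N. \<forall>m\<ge>N. \<forall>n\<ge>N. hnorm H (X m - X n) < e"
      by blast
  qed (rule X)
  have "(\<lambda>n. f (X n) - f l) \<longlonglongrightarrow> 0"
  proof (rule Lim_null_comparison)
    show "\<forall>\<^sub>F n in sequentially. norm (f (X n) - f l) \<le> c * hnorm H (X n - l)"
      using bound[of "X _ - l"] X(1) l by (simp add: f_diff)
  qed (rule tendsto_mult_right_zero[OF lim])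
  then have "(\<lambda>n. J (X n)) \<longlonglongrightarrow> J l"
    unfolding J_def using X(1) l lim
    by (intro tendsto_intros tendsto_norm) (auto intro: LIM_zero_cancel)
  moreover have "(\<lambda>n. m + 1 / Suc n) \<longlonglongrightarrow> m + 0"
    by (intro tendsto_intros LIMSEQ_Suc[OF lim_1_over_n])
  ultimately have "J l \<le> m + 0"
    by (rule LIMSEQ_le) (use X(2) in \<open>auto intro!: exI[of _ 0] less_imp_le\<close>)
  then have J_min: "J l \<le> J x" if "x \<in> hcarrier H" for x
    using m_le[OF that] by simp
  \<comment> \<open>Along the real line l + t v the functional is a quadratic in t with its minimum
    at 0, so its linear coefficient vanishes. The imaginary part follows afterwards from \<i> v in
    place of v.\<close>
  have Re: "Re (f v) = Re (hinner H v l)" if v: "v \<in> hcarrier H" for v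
  proof -
    have "Re (hinner H l v) - Re (f v) = 0"
    proof (rule quadratic_nonneg_linear_coeff_zero)
      fix t :: real
      have "J l \<le> J (l + of_real t *\<^sub>C v)"
        using l v by (intro J_min) simp
      then show "0 \<le> 2 * t * (Re (hinner H l v) - Re (f v)) + t\<^sup>2 * (hnorm H v)\<^sup>2"
        using l v by (simp add: J_def norm_add_power2 norm_scale inner_scale2 add scale
            power_mult_distrib algebra_simps)
    qed simp
    then show ?thesis
      using inner_commute[OF l v] by simp
  qed
  have "f v = hinner H v l" if v: "v \<in> hcarrier H" for v
    using Re[OF v] Re[of "\<i> *\<^sub>C v"] v l by (simp add: scale inner_scale complex_eq_iff)
  with l show ?thesis
    by blast
qed

lemma hilbert_hsubspace:
  assumes M: "closed_subspace H M"
  shows "hilbert_space (hsubspace H M)"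
proof -
  have sub: "M \<subseteq> hcarrier H" "complex_vector.subspace M"
    using M by (auto simp: closed_subspace_def)
  interpret M: inner_product_space "hsubspace H M"
    using sub
    by unfold_locales (auto simp: subset_iff inner_add inner_scale inner_pos intro: inner_commute)
  show ?thesis
  proof (rule M.hilbert_spaceI)
    fix f :: "nat \<Rightarrow> _"
    assume "\<And>n. f n \<in> hcarrier (hsubspace H M)"
      and C: "\<And>e. e > 0 \<Longrightarrow> \<exists>N. \<forall>m\<ge>N. \<forall>n\<ge>N. hnorm (hsubspace H M) (f m - f n) < e"
    then have fM: "\<And>n. f n \<in> M"
      by simp
    then have fH: "\<And>n. f n \<in> hcarrier H"
      using sub by auto
    obtain l where l: "l \<in> hcarrier H" "(\<lambda>n. hnorm H (f n - l)) \<longlonglongrightarrow> 0"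
      by (rule Cauchy_limit[OF fH C[unfolded hnorm_hsubspace]])
    have "l \<in> M"
      by (rule closed_subspace_limit[OF M fM l])
    with l show "\<exists>l\<in>hcarrier (hsubspace H M). (\<lambda>n. hnorm (hsubspace H M) (f n - l)) \<longlonglongrightarrow> 0"
      by auto
  qed
qed

text \<open>The projection is the Riesz representative, inside \<open>M\<close>, of the functional
  \<open>\<lambda>m. hinner H m x\<close>; no second minimisation argument is needed.\<close>

lemma projection:
  assumes M: "closed_subspace H M" and x: "x \<in> hcarrier H"
  shows "\<exists>p\<in>M. \<forall>m\<in>M. hinner H m (x - p) = 0"
proof -
  interpret M: hilbert_space "hsubspace H M"
    by (rule hilbert_hsubspace[OF M])
  have sub: "m \<in> hcarrier H" if "m \<in> M" for m
    using M that by (auto simp: closed_subspace_def)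
  have "\<exists>p\<in>hcarrier (hsubspace H M). \<forall>m\<in>hcarrier (hsubspace H M).
      hinner H m x = hinner (hsubspace H M) m p"
    by (rule M.Riesz_representation[where c = "hnorm H x"])
      (use sub x Cauchy_Schwarz in \<open>auto simp: inner_add inner_scale mult.commute\<close>)
  then show ?thesis
    using sub x by (auto simp: inner_diff_right)
qed

text \<open>Subtracting from a vector of \<open>L\<close> its projection onto \<open>K\<close>
  leaves a vector of \<open>L\<close> orthogonal to \<open>K\<close>. This reduces each later
  comparison of a closed span with a given subspace to a totality statement.\<close>

lemma closed_subspace_eqI:
  assumes K: "closed_subspace H K" and L: "L \<subseteq> hcarrier H" "complex_vector.subspace L" and "K \<subseteq> L"
    and *: "\<And>x. x \<in> L \<Longrightarrow> (\<And>v. v \<in> K \<Longrightarrow> hinner H v x = 0) \<Longrightarrow> x = 0"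
  shows "L = K"
proof -
  have "x \<in> K" if "x \<in> L" for x
  proof -
    have x: "x \<in> hcarrier H"
      using that L by auto
    obtain p where p: "p \<in> K" "\<forall>m\<in>K. hinner H m (x - p) = 0"
      using projection[OF K x] by blast
    have "x - p = 0"
      using p that L(2) \<open>K \<subseteq> L\<close> by (intro *) (auto intro: complex_vector.subspace_diff)
    with p show ?thesis
      by simp
  qed
  with \<open>K \<subseteq> L\<close> show ?thesis
    by auto
qed

lemma orth_compl_orth_compl:
  assumes M: "closed_subspace H M"
  shows "orth_compl H (orth_compl H M) = M"
proof (rule closed_subspace_eqI[OF M])
  have sub: "m \<in> hcarrier H" if "m \<in> M" for m
    using M that by (auto simp: closed_subspace_def)
  have oc: "closed_subspace H (orth_compl H (orth_compl H M))"
    by (rule closed_subspace_orth_compl) (auto simp: orth_compl_def)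
  then show "orth_compl H (orth_compl H M) \<subseteq> hcarrier H"
    "complex_vector.subspace (orth_compl H (orth_compl H M))"
    by (auto simp: closed_subspace_def)
  show "M \<subseteq> orth_compl H (orth_compl H M)"
    using sub inner_eq_0_commute by (auto simp: orth_compl_def)
  fix x
  assume x: "x \<in> orth_compl H (orth_compl H M)" "\<And>v. v \<in> M \<Longrightarrow> hinner H v x = 0"
  then have "x \<in> orth_compl H M"
    using sub inner_eq_0_commute by (auto simp: orth_compl_def)
  with x(1) have "hinner H x x = 0" "x \<in> hcarrier H"
    by (auto simp: orth_compl_def)
  then show "x = 0"
    by (intro inner_self_eq_0D)
qed

text \<open>Bessel's inequality makes the series of projections converge. The \<open>F k\<close>
  need not span, so the residual \<open>x - s\<close> is only orthogonal to them; it vanishes once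
  \<open>x\<close> is known to lie in their closed span.\<close>

lemma orthogonal_expansion:
  assumes F: "\<And>k. closed_subspace H (F k)"
    and o: "\<And>k l v w. k \<noteq> l \<Longrightarrow> v \<in> F k \<Longrightarrow> w \<in> F l \<Longrightarrow> hinner H v w = 0"
    and x: "x \<in> hcarrier H"
  obtains e s where "\<And>k. e k \<in> F k" "summable (\<lambda>k. (hnorm H (e k))\<^sup>2)" "hsums H e s"
    "\<And>k v. v \<in> F k \<Longrightarrow> hinner H v (x - s) = 0"
proof -
  have sub: "v \<in> hcarrier H" if "v \<in> F k" for v k
    using F[of k] that by (auto simp: closed_subspace_def)
  obtain e where e: "\<And>k. e k \<in> F k" "\<And>k v. v \<in> F k \<Longrightarrow> hinner H v (x - e k) = 0"
    using projection[OF F x] by metis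
  note eH = sub[OF e(1)]
  have in_e: "hinner H v x = hinner H v (e k)" if "v \<in> F k" for v k
    using e(2)[OF that] sub[OF that] x eH by (simp add: inner_diff_right)
  \<comment> \<open>Bessel's inequality: the partial sum is orthogonal to its difference from
    \<open>x\<close>, so Pythagoras bounds its norm by that of \<open>x\<close>.\<close>
  have "(\<Sum>k<N. (hnorm H (e k))\<^sup>2) \<le> (hnorm H x)\<^sup>2" for N
  proof -
    let ?s = "\<Sum>k<N. e k"
    have sum: "(hnorm H ?s)\<^sup>2 = (\<Sum>k<N. (hnorm H (e k))\<^sup>2)"
      using eH o e(1) by (intro norm_sum_orthogonal) auto
    have "hinner H ?s x = (\<Sum>k<N. hinner H (e k) (e k))"
      using eH x by (simp add: inner_sum_left in_e[OF e(1)])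
    also have "\<dots> = hinner H ?s ?s"
      using eH by (simp add: inner_sum_left inner_sum_right o[OF _ e(1) e(1)] sum.delta
          cong: sum.cong if_cong) (intro sum.cong refl, subst sum.remove, auto simp: o[OF _ e(1) e(1)])
    finally have "hinner H ?s (x - ?s) = 0"
      using eH x by (simp add: inner_diff_right)
    then have "(hnorm H (?s + (x - ?s)))\<^sup>2 = (hnorm H ?s)\<^sup>2 + (hnorm H (x - ?s))\<^sup>2"
      using eH x by (subst norm_add_power2) auto
    then show ?thesis
      using sum by simp
  qed
  then have summ: "summable (\<lambda>k. (hnorm H (e k))\<^sup>2)"
    by (intro summableI_nonneg_bounded) auto
  obtain s where s: "hsums H e s"
    using hsums_orthogonal[OF eH summ] o e(1) by blast
  have sH: "s \<in> hcarrier H"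
    using s eH by (simp add: hsums_iff)
  have "hinner H v (x - s) = 0" if v: "v \<in> F k" for v k
  proof -
    have "(\<lambda>j. hinner H (e j) v) sums hinner H s v"
      by (rule hsums_inner[OF eH sub[OF v] s])
    moreover have "(\<lambda>j. hinner H (e j) v) sums hinner H (e k) v"
      using sums_finite[of "{k}" "\<lambda>j. hinner H (e j) v"] o[OF _ e(1) v] by auto
    ultimately have "hinner H s v = hinner H (e k) v"
      by (rule sums_unique2)
    then have "hinner H v s = hinner H v (e k)"
      using inner_commute[of v s] inner_commute[of v "e k"] sub[OF v] sH eH by simp
    then show ?thesis
      using in_e[OF v] sub[OF v] x sH by (simp add: inner_diff_right)
  qed
  with e(1) summ s show ?thesis
    by (intro that)
qed

end

section \<open>Adjoints\<close>

lemma hadjoint_eqI: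
  assumes "inner_product_space H" "x \<in> hcarrier H"
    and "\<And>v. v \<in> hcarrier H \<Longrightarrow> hinner K (T v) y = hinner H v x"
  shows "hadjoint H K T y = x"
  unfolding hadjoint_def using assms
  by (intro the_equality) (auto intro!: inner_product_space.inner_eqI[OF assms(1)])

lemma hadjoint_ex:
  assumes "hilbert_space H" "inner_product_space K" "bounded_operator H K T" "y \<in> hcarrier K"
  shows "\<exists>x\<in>hcarrier H. \<forall>v\<in>hcarrier H. hinner K (T v) y = hinner H v x"
proof -
  interpret H: hilbert_space H
    by (rule assms)
  interpret K: inner_product_space K
    by (rule assms)
  obtain c where c: "\<And>x. x \<in> hcarrier H \<Longrightarrow> hnorm K (T x) \<le> c * hnorm H x"
    using H.bounded_operator_bound[OF assms(3)] by blast
  note T = bounded_operator_mem[OF assms(3)]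
  show ?thesis
  proof (rule H.Riesz_representation)
    fix x
    assume x: "x \<in> hcarrier H"
    have "cmod (hinner K (T x) y) \<le> hnorm K (T x) * hnorm K y"
      using T[OF x] assms(4) by (rule K.Cauchy_Schwarz)
    also have "\<dots> \<le> (c * hnorm H x) * hnorm K y"
      using c[OF x] assms(4) by (intro mult_right_mono) auto
    finally show "cmod (hinner K (T x) y) \<le> (c * hnorm K y) * hnorm H x"
      by (simp add: mult_ac)
  qed (use assms T in \<open>auto simp: bounded_operator_add[OF assms(3)] bounded_operator_scale[OF assms(3)]
      K.inner_add K.inner_scale\<close>)
qed

lemma hadjoint_mem:
  assumes "hilbert_space H" "inner_product_space K" "bounded_operator H K T" "y \<in> hcarrier K"
  shows "hadjoint H K T y \<in> hcarrier H"
  using hadjoint_ex[OF assms] hadjoint_eqI[of H _ K T y] assms(1)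
  by (auto simp: hilbert_space_def)

lemma inner_hadjoint:
  assumes "hilbert_space H" "inner_product_space K" "bounded_operator H K T" "y \<in> hcarrier K"
    and "v \<in> hcarrier H"
  shows "hinner H v (hadjoint H K T y) = hinner K (T v) y"
  using hadjoint_ex[OF assms(1-4)] hadjoint_eqI[of H _ K T y] assms(1,5)
  by (auto simp: hilbert_space_def)

lemma inner_hadjoint_left:
  assumes "hilbert_space H" "inner_product_space K" "bounded_operator H K T" "y \<in> hcarrier K"
    and "v \<in> hcarrier H"
  shows "hinner H (hadjoint H K T y) v = hinner K y (T v)"
proof -
  interpret H: hilbert_space H
    by (rule assms)
  interpret K: inner_product_space K
    by (rule assms)
  show ?thesis
    using inner_hadjoint[OF assms] hadjoint_mem[OF assms(1-4)] bounded_operator_mem[OF assms(3,5)]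
      assms(4,5) by (metis H.inner_commute K.inner_commute)
qed

lemma bounded_operator_hadjoint:
  assumes "hilbert_space H" "inner_product_space K" "bounded_operator H K T"
  shows "bounded_operator K H (hadjoint H K T)"
proof -
  interpret H: hilbert_space H
    by (rule assms)
  interpret K: inner_product_space K
    by (rule assms)
  obtain c where c: "\<And>x. x \<in> hcarrier H \<Longrightarrow> hnorm K (T x) \<le> c * hnorm H x"
    using H.bounded_operator_bound[OF assms(3)] by blast
  note mem = hadjoint_mem[OF assms] and inner = inner_hadjoint[OF assms]
  note T = bounded_operator_mem[OF assms(3)]
  show ?thesis
  proof (rule bounded_operatorI)
    fix y
    assume y: "y \<in> hcarrier K"
    let ?x = "hadjoint H K T y"
    \<comment> \<open>Testing the adjoint against its own value gives a bound with the norm of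
      \<open>?x\<close> on both sides; one factor is then cancelled unless it is zero.\<close>
    have "(hnorm H ?x)\<^sup>2 = Re (hinner K (T ?x) y)"
      using y mem by (simp add: H.norm_power2 inner)
    also have "\<dots> \<le> hnorm K (T ?x) * hnorm K y"
      using y mem T by (intro K.Re_inner_le) auto
    also have "\<dots> \<le> (c * hnorm H ?x) * hnorm K y"
      using c[OF mem[OF y]] y by (intro mult_right_mono) auto
    finally have *: "hnorm H ?x * hnorm H ?x \<le> hnorm H ?x * (c * hnorm K y)"
      by (simp add: power2_eq_square mult_ac)
    show "hnorm H ?x \<le> \<bar>c\<bar> * hnorm K y"
    proof (cases "hnorm H ?x = 0")
      case False
      then have "0 < hnorm H ?x"
        using H.norm_nonneg[OF mem[OF y]] by linarith
      with * have "hnorm H ?x \<le> c * hnorm K y"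
        by simp
      also have "\<dots> \<le> \<bar>c\<bar> * hnorm K y"
        using y by (intro mult_right_mono) auto
      finally show ?thesis .
    qed (use y in simp)
  qed (use mem T in \<open>auto intro!: hadjoint_eqI simp: H.inner_product_space_axioms inner
      H.inner_add2 K.inner_add2 H.inner_scale2 K.inner_scale2\<close>)
qed

text \<open>A Hilbert space structure is transported along an injective linear map with closed
  range. Four spaces arise in this way: the weighted copies of \<open>Y\<close>, the Bergman space
  via its Taylor coefficients, \<open>X\<close> with a gramian as inner product, and the space of
  pairs solving the Cholesky problem.\<close>

lemma hilbert_space_pullback:
  fixes H :: "'a::complex_vector hspace" and K :: "'b::complex_vector hspace"
  assumes K: "hilbert_space K" and S: "complex_vector.subspace (hcarrier H)"
    and add: "\<And>x y. x \<in> hcarrier H \<Longrightarrow> y \<in> hcarrier H \<Longrightarrow> \<phi> (x + y) = \<phi> x + \<phi> y"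
    and scale: "\<And>a x. x \<in> hcarrier H \<Longrightarrow> \<phi> (a *\<^sub>C x) = a *\<^sub>C \<phi> x"
    and inj: "\<And>x. x \<in> hcarrier H \<Longrightarrow> \<phi> x = 0 \<Longrightarrow> x = 0"
    and cl: "closed_subspace K (\<phi> ` hcarrier H)"
    and inner: "\<And>x y. x \<in> hcarrier H \<Longrightarrow> y \<in> hcarrier H \<Longrightarrow> hinner H x y = hinner K (\<phi> x) (\<phi> y)"
  shows "hilbert_space H"
proof -
  interpret K: hilbert_space K
    by (rule K)
  have mem: "\<phi> x \<in> hcarrier K" if "x \<in> hcarrier H" for x
    using cl that by (auto simp: closed_subspace_def)
  interpret H: inner_product_space H
  proof
    fix x
    assume x: "x \<in> hcarrier H" "x \<noteq> 0"
    then have "\<phi> x \<noteq> 0"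
      using inj by blast
    with x show "0 < Re (hinner H x x)"
      using K.inner_pos mem inner by simp
  next
    fix x y
    assume "x \<in> hcarrier H" "y \<in> hcarrier H"
    then show "hinner H x y = cnj (hinner H y x)"
      using K.inner_commute[of "\<phi> x" "\<phi> y"] mem inner by simp
  next
    fix x y v
    assume "x \<in> hcarrier H" "y \<in> hcarrier H" "v \<in> hcarrier H"
    then show "hinner H (x + y) v = hinner H x v + hinner H y v"
      by (simp add: inner complex_vector.subspace_add[OF S] add K.inner_add mem)
  next
    fix x v a
    assume "x \<in> hcarrier H" "v \<in> hcarrier H"
    then show "hinner H (a *\<^sub>C x) v = a * hinner H x v"
      by (simp add: inner complex_vector.subspace_scale[OF S] scale K.inner_scale mem)
  qed (rule S)
  have norm: "hnorm H x = hnorm K (\<phi> x)" if "x \<in> hcarrier H" for x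
    using inner[OF that that] by (simp add: hnorm_def)
  have diff: "\<phi> (x - y) = \<phi> x - \<phi> y" if "x \<in> hcarrier H" "y \<in> hcarrier H" for x y
    using add[of x "- y"] scale[of y "-1"] that by simp
  show ?thesis
  proof (rule H.hilbert_spaceI)
    fix f :: "nat \<Rightarrow> _"
    assume fH: "\<And>n. f n \<in> hcarrier H"
      and C: "\<And>e. e > 0 \<Longrightarrow> \<exists>N. \<forall>m\<ge>N. \<forall>n\<ge>N. hnorm H (f m - f n) < e"
    obtain l where l: "l \<in> hcarrier K" "(\<lambda>n. hnorm K (\<phi> (f n) - l)) \<longlonglongrightarrow> 0"
    proof (rule K.Cauchy_limit)
      show "\<phi> (f n) \<in> hcarrier K" for n
        using fH mem by simp
      show "\<exists>N. \<forall>m\<ge>N. \<forall>n\<ge>N. hnorm K (\<phi> (f m) - \<phi> (f n)) < e" if "e > 0" for e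
        using C[OF that] fH by (simp add: norm diff)
    qed
    have "l \<in> \<phi> ` hcarrier H"
      by (rule K.closed_subspace_limit[OF cl _ l]) (use fH in auto)
    then obtain x where x: "x \<in> hcarrier H" "l = \<phi> x"
      by auto
    with l fH have "(\<lambda>n. hnorm H (f n - x)) \<longlonglongrightarrow> 0"
      by (simp add: norm diff)
    with x show "\<exists>x\<in>hcarrier H. (\<lambda>n. hnorm H (f n - x)) \<longlonglongrightarrow> 0"
      by blast
  qed
qed

section \<open>Hilbert direct sums\<close>

lemma hcarrier_hdirect_sum:
  "h \<in> hcarrier (hdirect_sum H) \<longleftrightarrow>
    (\<forall>k. h k \<in> hcarrier (H k)) \<and> summable (\<lambda>k. (hnorm (H k) (h k))\<^sup>2)"
  by (simp add: hdirect_sum_def)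

lemma hinner_hdirect_sum: "hinner (hdirect_sum H) g h = (\<Sum>k. hinner (H k) (g k) (h k))"
  by (simp add: hdirect_sum_def)

lemma mult_le_sum_squares: "a * b \<le> a\<^sup>2 + b\<^sup>2" for a b :: real
  using zero_le_power2[of "a - b"] zero_le_power2[of a] zero_le_power2[of b]
  unfolding power2_diff by linarith

lemma summable_hinner_hdirect_sum:
  assumes "\<And>k. inner_product_space (H k)"
    and "g \<in> hcarrier (hdirect_sum H)" "h \<in> hcarrier (hdirect_sum H)"
  shows "summable (\<lambda>k. hinner (H k) (g k) (h k))"
proof (rule summable_comparison_test')
  show "summable (\<lambda>k. (hnorm (H k) (g k))\<^sup>2 + (hnorm (H k) (h k))\<^sup>2)"
    using assms by (intro summable_add) (auto simp: hcarrier_hdirect_sum)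
  fix k
  interpret inner_product_space "H k"
    by (rule assms)
  have "cmod (hinner (H k) (g k) (h k)) \<le> hnorm (H k) (g k) * hnorm (H k) (h k)"
    using assms by (intro Cauchy_Schwarz) (auto simp: hcarrier_hdirect_sum)
  also have "\<dots> \<le> (hnorm (H k) (g k))\<^sup>2 + (hnorm (H k) (h k))\<^sup>2"
    by (rule mult_le_sum_squares)
  finally show "norm (hinner (H k) (g k) (h k)) \<le> (hnorm (H k) (g k))\<^sup>2 + (hnorm (H k) (h k))\<^sup>2" .
qed

lemma inner_product_space_hdirect_sum:
  assumes H: "\<And>k. inner_product_space (H k)"
  shows "inner_product_space (hdirect_sum H)"
proof
  show "complex_vector.subspace (hcarrier (hdirect_sum H))"
  proof (rule complex_vector.subspaceI)
    show "0 \<in> hcarrier (hdirect_sum H)"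
      by (simp add: hcarrier_hdirect_sum inner_product_space.zero_mem[OF H]
          inner_product_space.norm_zero[OF H])
  next
    fix g h
    assume g: "g \<in> hcarrier (hdirect_sum H)" and h: "h \<in> hcarrier (hdirect_sum H)"
    have "summable (\<lambda>k. (hnorm (H k) ((g + h) k))\<^sup>2)"
    proof (rule summable_comparison_test')
      show "summable (\<lambda>k. 2 * (hnorm (H k) (g k))\<^sup>2 + 2 * (hnorm (H k) (h k))\<^sup>2)"
        using g h by (intro summable_add summable_mult) (auto simp: hcarrier_hdirect_sum)
      fix k
      interpret inner_product_space "H k"
        by (rule H)
      have "g k \<in> hcarrier (H k)" "h k \<in> hcarrier (H k)"
        using g h by (auto simp: hcarrier_hdirect_sum)
      then have "(hnorm (H k) (g k + h k))\<^sup>2 + (hnorm (H k) (g k - h k))\<^sup>2 =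
          2 * (hnorm (H k) (g k))\<^sup>2 + 2 * (hnorm (H k) (h k))\<^sup>2"
        by (rule parallelogram)
      moreover have "0 \<le> (hnorm (H k) (g k - h k))\<^sup>2"
        by simp
      ultimately have "(hnorm (H k) (g k + h k))\<^sup>2 \<le>
          2 * (hnorm (H k) (g k))\<^sup>2 + 2 * (hnorm (H k) (h k))\<^sup>2"
        by linarith
      then show "norm ((hnorm (H k) ((g + h) k))\<^sup>2) \<le>
          2 * (hnorm (H k) (g k))\<^sup>2 + 2 * (hnorm (H k) (h k))\<^sup>2"
        by simp
    qed
    then show "g + h \<in> hcarrier (hdirect_sum H)"
      using g h by (simp add: hcarrier_hdirect_sum inner_product_space.add_mem[OF H])
  next
    fix a h
    assume h: "h \<in> hcarrier (hdirect_sum H)"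
    then show "a *\<^sub>C h \<in> hcarrier (hdirect_sum H)"
      by (simp add: hcarrier_hdirect_sum inner_product_space.scale_mem[OF H] scaleC_fun_def
          inner_product_space.norm_scale[OF H] power_mult_distrib summable_mult)
  qed
next
  fix f g h
  assume "f \<in> hcarrier (hdirect_sum H)" "g \<in> hcarrier (hdirect_sum H)" "h \<in> hcarrier (hdirect_sum H)"
  then show "hinner (hdirect_sum H) (f + g) h = hinner (hdirect_sum H) f h + hinner (hdirect_sum H) g h"
    unfolding hinner_hdirect_sum
    using suminf_add[of "\<lambda>k. hinner (H k) (f k) (h k)" "\<lambda>k. hinner (H k) (g k) (h k)"]
    by (simp add: summable_hinner_hdirect_sum[OF H] hcarrier_hdirect_sum
        inner_product_space.inner_add[OF H])
next
  fix a g h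
  assume "g \<in> hcarrier (hdirect_sum H)" "h \<in> hcarrier (hdirect_sum H)"
  then show "hinner (hdirect_sum H) (a *\<^sub>C g) h = a * hinner (hdirect_sum H) g h"
    unfolding hinner_hdirect_sum
    using suminf_mult[of "\<lambda>k. hinner (H k) (g k) (h k)" a]
    by (simp add: summable_hinner_hdirect_sum[OF H] hcarrier_hdirect_sum scaleC_fun_def
        inner_product_space.inner_scale[OF H])
next
  fix g h
  assume gh: "g \<in> hcarrier (hdirect_sum H)" "h \<in> hcarrier (hdirect_sum H)"
  then have "(\<lambda>k. cnj (hinner (H k) (h k) (g k))) sums cnj (hinner (hdirect_sum H) h g)"
    unfolding hinner_hdirect_sum sums_cnj
    by (intro summable_sums summable_hinner_hdirect_sum[OF H])
  moreover have "cnj (hinner (H k) (h k) (g k)) = hinner (H k) (g k) (h k)" for k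
    using gh inner_product_space.inner_commute[OF H, of "g k" k "h k"]
    by (simp add: hcarrier_hdirect_sum)
  ultimately show "hinner (hdirect_sum H) g h = cnj (hinner (hdirect_sum H) h g)"
    unfolding hinner_hdirect_sum by (simp add: sums_iff)
next
  fix h
  assume h: "h \<in> hcarrier (hdirect_sum H)" "h \<noteq> 0"
  then obtain i where i: "h i \<noteq> 0"
    by (auto simp: fun_eq_iff)
  have hk: "h k \<in> hcarrier (H k)" for k
    using h by (simp add: hcarrier_hdirect_sum)
  have sums: "summable (\<lambda>k. hinner (H k) (h k) (h k))"
    using h by (intro summable_hinner_hdirect_sum[OF H])
  have "0 < (\<Sum>k. Re (hinner (H k) (h k) (h k)))"
    using i hk inner_product_space.inner_pos[OF H, of "h i"] inner_product_space.inner_ge[OF H]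
    by (intro suminf_pos2[of _ i] summable_Re sums) auto
  then show "0 < Re (hinner (hdirect_sum H) h h)"
    unfolding hinner_hdirect_sum by (simp add: Re_suminf[OF sums])
qed

lemma hnorm_hdirect_sum:
  assumes H: "\<And>k. inner_product_space (H k)" and h: "h \<in> hcarrier (hdirect_sum H)"
  shows "(hnorm (hdirect_sum H) h)\<^sup>2 = (\<Sum>k. (hnorm (H k) (h k))\<^sup>2)"
proof -
  interpret inner_product_space "hdirect_sum H"
    by (rule inner_product_space_hdirect_sum[OF H])
  have "h k \<in> hcarrier (H k)" for k
    using h by (simp add: hcarrier_hdirect_sum)
  then show ?thesis
    unfolding norm_power2[OF h] unfolding hinner_hdirect_sum
    by (simp add: Re_suminf[OF summable_hinner_hdirect_sum[OF H h h]]
        inner_product_space.norm_power2[OF H])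
qed

text \<open>Each coordinate converges. The Cauchy bound survives the limit on finitely many
  coordinates and hence on all of them, which gives membership and convergence together.\<close>

lemma hilbert_space_hdirect_sum:
  assumes H: "\<And>k. hilbert_space (H k)"
  shows "hilbert_space (hdirect_sum H)"
proof -
  have ips: "inner_product_space (H k)" for k
    using H by (simp add: hilbert_space_def)
  interpret inner_product_space "hdirect_sum H"
    by (rule inner_product_space_hdirect_sum[OF ips])
  show ?thesis
  proof (rule hilbert_spaceI)
    fix f :: "nat \<Rightarrow> _"
    assume f: "\<And>n. f n \<in> hcarrier (hdirect_sum H)"
      and C': "\<And>e. e > 0 \<Longrightarrow> \<exists>N. \<forall>m\<ge>N. \<forall>n\<ge>N. hnorm (hdirect_sum H) (f m - f n) < e"
    from f have fk: "f n k \<in> hcarrier (H k)" for n k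
      by (simp add: hcarrier_hdirect_sum)
    have part: "(\<Sum>k<j. (hnorm (H k) (f m k - f n k))\<^sup>2) \<le> (hnorm (hdirect_sum H) (f m - f n))\<^sup>2"
      for j m n
    proof -
      have d: "f m - f n \<in> hcarrier (hdirect_sum H)"
        using f by simp
      then have "summable (\<lambda>k. (hnorm (H k) ((f m - f n) k))\<^sup>2)"
        by (simp add: hcarrier_hdirect_sum)
      then show ?thesis
        using sum_le_suminf[of "\<lambda>k. (hnorm (H k) ((f m - f n) k))\<^sup>2" "{..<j}"]
        by (simp add: hnorm_hdirect_sum[OF ips d])
    qed
    have "\<exists>l\<in>hcarrier (H k). (\<lambda>n. hnorm (H k) (f n k - l)) \<longlonglongrightarrow> 0" for k
    proof -
      interpret Hk: hilbert_space "H k"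
        by (rule H)
      have le: "hnorm (H k) (f m k - f n k) \<le> hnorm (hdirect_sum H) (f m - f n)" for m n
      proof (rule power2_le_imp_le)
        show "(hnorm (H k) (f m k - f n k))\<^sup>2 \<le> (hnorm (hdirect_sum H) (f m - f n))\<^sup>2"
          using part[of m n "Suc k"]
            member_le_sum[of k "{..<Suc k}" "\<lambda>k. (hnorm (H k) (f m k - f n k))\<^sup>2"] by simp
      qed (use f in simp)
      obtain l where "l \<in> hcarrier (H k)" "(\<lambda>n. hnorm (H k) (f n k - l)) \<longlonglongrightarrow> 0"
      proof (rule Hk.Cauchy_limit[of "\<lambda>n. f n k"])
        show "\<exists>N. \<forall>m\<ge>N. \<forall>n\<ge>N. hnorm (H k) (f m k - f n k) < e" if "e > 0" for e
          using C'[OF that] le by (meson le_less_trans)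
      qed (rule fk)
      then show ?thesis
        by blast
    qed
    then obtain l where l: "\<And>k. l k \<in> hcarrier (H k)" "\<And>k. (\<lambda>n. hnorm (H k) (f n k - l k)) \<longlonglongrightarrow> 0"
      by metis
    have key: "\<exists>N. \<forall>m\<ge>N. f m - l \<in> hcarrier (hdirect_sum H) \<and> hnorm (hdirect_sum H) (f m - l) \<le> e"
      if e: "e > 0" for e
    proof -
      obtain N where N: "\<And>m n. m \<ge> N \<Longrightarrow> n \<ge> N \<Longrightarrow> hnorm (hdirect_sum H) (f m - f n) < e"
        using C'[OF e] by blast
      have "f m - l \<in> hcarrier (hdirect_sum H) \<and> hnorm (hdirect_sum H) (f m - l) \<le> e" if m: "m \<ge> N" for m
      proof -
        \<comment> \<open>\<open>m\<close> stays fixed while \<open>n\<close> tends to infinity; the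
          sum over k < K is finite, so the limit may be taken inside.\<close>
        have bd: "(\<Sum>k<K. (hnorm (H k) ((f m - l) k))\<^sup>2) \<le> e\<^sup>2" for K
        proof (rule tendsto_upperbound)
          have "(\<lambda>n. hnorm (H k) (f m k - f n k)) \<longlonglongrightarrow> hnorm (H k) (f m k - l k)" for k
          proof -
            interpret Hk: hilbert_space "H k"
              by (rule H)
            have "hnorm (H k) (f n k - l k) = hnorm (H k) ((f m k - f n k) - (f m k - l k))" for n
              using fk l(1) Hk.norm_minus_commute[of "f n k" "l k"] by simp
            with l(2)[of k] show ?thesis
              using fk l(1) by (intro Hk.tendsto_norm) simp_all
          qed
          then show "(\<lambda>n. \<Sum>k<K. (hnorm (H k) (f m k - f n k))\<^sup>2) \<longlonglongrightarrow>
              (\<Sum>k<K. (hnorm (H k) ((f m - l) k))\<^sup>2)"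
            unfolding fun_diff_def by (intro tendsto_intros)
          show "\<forall>\<^sub>F n in sequentially. (\<Sum>k<K. (hnorm (H k) (f m k - f n k))\<^sup>2) \<le> e\<^sup>2"
            unfolding eventually_sequentially
          proof (intro exI allI impI)
            fix n
            assume "N \<le> n"
            then have "(hnorm (hdirect_sum H) (f m - f n))\<^sup>2 \<le> e\<^sup>2"
              using N[OF m, of n] f by (intro power_mono) auto
            then show "(\<Sum>k<K. (hnorm (H k) (f m k - f n k))\<^sup>2) \<le> e\<^sup>2"
              using part[of m n K] by linarith
          qed
        qed simp
        then have "summable (\<lambda>k. (hnorm (H k) ((f m - l) k))\<^sup>2)"
          by (intro summableI_nonneg_bounded) auto
        moreover have "(f m - l) k \<in> hcarrier (H k)" for k
          using fk l(1) inner_product_space.diff_mem[OF ips] by simp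
        ultimately have mem: "f m - l \<in> hcarrier (hdirect_sum H)"
          by (simp add: hcarrier_hdirect_sum)
        have "(hnorm (hdirect_sum H) (f m - l))\<^sup>2 \<le> e\<^sup>2"
          unfolding hnorm_hdirect_sum[OF ips mem] using bd mem
          by (intro suminf_le_const) (auto simp: hcarrier_hdirect_sum)
        then have "hnorm (hdirect_sum H) (f m - l) \<le> e"
          by (rule power2_le_imp_le) (use e in simp)
        with mem show ?thesis ..
      qed
      then show ?thesis
        by blast
    qed
    \<comment> \<open>Square summability of \<open>l\<close> is inherited from a single difference
      \<open>f N - l\<close>.\<close>
    obtain N where "f N - l \<in> hcarrier (hdirect_sum H)"
      using key[of 1] by auto
    then have "f N - (f N - l) \<in> hcarrier (hdirect_sum H)"
      by (rule diff_mem[OF f])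
    then have lmem: "l \<in> hcarrier (hdirect_sum H)"
      by simp
    have "(\<lambda>n. hnorm (hdirect_sum H) (f n - l)) \<longlonglongrightarrow> 0"
      unfolding LIMSEQ_iff
    proof (intro allI impI)
      fix r :: real
      assume "r > 0"
      then obtain N where "\<forall>m\<ge>N. hnorm (hdirect_sum H) (f m - l) \<le> r / 2"
        using key[of "r / 2"] by auto
      then show "\<exists>N. \<forall>n\<ge>N. norm (hnorm (hdirect_sum H) (f n - l) - 0) < r"
        using \<open>r > 0\<close> f lmem by (intro exI[of _ N]) force
    qed
    with lmem show "\<exists>l\<in>hcarrier (hdirect_sum H). (\<lambda>n. hnorm (hdirect_sum H) (f n - l)) \<longlonglongrightarrow> 0"
      by blast
  qed
qed

section \<open>Calculus of convergent series\<close>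

context inner_product_space
begin

lemma hsums_mem: "(\<And>j. f j \<in> hcarrier H) \<Longrightarrow> hsums H f s \<Longrightarrow> s \<in> hcarrier H"
  by (simp add: hsums_iff)

lemma hsums_add:
  assumes f: "\<And>j. f j \<in> hcarrier H" and g: "\<And>j. g j \<in> hcarrier H"
    and "hsums H f s" "hsums H g t"
  shows "hsums H (\<lambda>j. f j + g j) (s + t)"
proof -
  have st: "s \<in> hcarrier H" "t \<in> hcarrier H"
    using assms by (auto intro: hsums_mem)
  have lim: "(\<lambda>N. hnorm H ((\<Sum>j<N. f j) - s)) \<longlonglongrightarrow> 0" "(\<lambda>N. hnorm H ((\<Sum>j<N. g j) - t)) \<longlonglongrightarrow> 0"
    using assms by (simp_all add: hsums_iff)
  have "norm (hnorm H ((\<Sum>j<N. f j + g j) - (s + t))) \<le>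
      hnorm H ((\<Sum>j<N. f j) - s) + hnorm H ((\<Sum>j<N. g j) - t)" for N
  proof -
    have "(\<Sum>j<N. f j + g j) - (s + t) = ((\<Sum>j<N. f j) - s) + ((\<Sum>j<N. g j) - t)"
      by (simp add: sum.distrib)
    then show ?thesis
      using norm_triangle[of "(\<Sum>j<N. f j) - s" "(\<Sum>j<N. g j) - t"] f g st by (simp only:) simp
  qed
  then have "(\<lambda>N. hnorm H ((\<Sum>j<N. f j + g j) - (s + t))) \<longlonglongrightarrow> 0"
    by (rule real_tendsto_0_le[OF _ tendsto_add_zero[OF lim]])
  then show ?thesis
    using f g st by (simp add: hsums_iff)
qed

lemma bounded_operator_scaleC: "bounded_operator H H (\<lambda>x. a *\<^sub>C x)"
  by (rule bounded_operatorI[where c = "cmod a"])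
    (simp_all add: norm_scale scaleC_add_right scaleC_scaleC mult.commute)

lemma hsums_scale:
  assumes "\<And>j. f j \<in> hcarrier H" "hsums H f s"
  shows "hsums H (\<lambda>j. a *\<^sub>C f j) (a *\<^sub>C s)"
  using assms
  by (intro hsums_bounded_operator[OF inner_product_space_axioms inner_product_space_axioms
        bounded_operator_scaleC])

lemma hsums_Suc:
  assumes f: "\<And>j. f j \<in> hcarrier H" and s: "hsums H (\<lambda>j. f (Suc j)) s"
  shows "hsums H f (f 0 + s)"
proof -
  have "s \<in> hcarrier H" "(\<lambda>N. hnorm H ((\<Sum>j<N. f (Suc j)) - s)) \<longlonglongrightarrow> 0"
    using s f by (simp_all add: hsums_iff)
  moreover have "(\<Sum>j<Suc N. f j) - (f 0 + s) = (\<Sum>j<N. f (Suc j)) - s" for N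
    by (simp only: sum.lessThan_Suc_shift) simp
  ultimately have "(\<lambda>N. hnorm H ((\<Sum>j<Suc N. f j) - (f 0 + s))) \<longlonglongrightarrow> 0"
    by (simp only:)
  then have "(\<lambda>N. hnorm H ((\<Sum>j<N. f j) - (f 0 + s))) \<longlonglongrightarrow> 0"
    by (rule LIMSEQ_imp_Suc)
  with \<open>s \<in> hcarrier H\<close> show ?thesis
    using f by (simp add: hsums_iff)
qed

lemma hsums_finite:
  assumes f: "\<And>j. f j \<in> hcarrier H" and "\<And>j. j \<ge> K \<Longrightarrow> f j = 0"
  shows "hsums H f (\<Sum>j<K. f j)"
proof -
  have "hnorm H ((\<Sum>j<N. f j) - (\<Sum>j<K. f j)) = 0" if "N \<ge> K" for N
  proof -
    have "(\<Sum>j<N. f j) = (\<Sum>j<K. f j)"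
      using assms that by (intro sum.mono_neutral_right) auto
    then show ?thesis
      by simp
  qed
  then have "\<forall>\<^sub>F N in sequentially. hnorm H ((\<Sum>j<N. f j) - (\<Sum>j<K. f j)) = 0"
    unfolding eventually_sequentially by blast
  then have "(\<lambda>N. hnorm H ((\<Sum>j<N. f j) - (\<Sum>j<K. f j))) \<longlonglongrightarrow> 0"
    by (rule tendsto_eventually)
  then show ?thesis
    using f by (simp add: hsums_iff)
qed

lemma hsums_norm_le:
  assumes f: "\<And>j. f j \<in> hcarrier H" and s: "hsums H f s"
    and le: "\<And>j. hnorm H (f j) \<le> g j" and "summable g"
  shows "hnorm H s \<le> suminf g"
proof (rule tendsto_upperbound)
  show "(\<lambda>N. hnorm H (\<Sum>j<N. f j)) \<longlonglongrightarrow> hnorm H s"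
    using f s by (intro tendsto_norm) (auto simp: hsums_iff)
  have g: "0 \<le> g j" for j
    using le[of j] norm_nonneg[OF f[of j]] by linarith
  have "hnorm H (\<Sum>j<N. f j) \<le> suminf g" for N
  proof -
    have "hnorm H (\<Sum>j<N. f j) \<le> (\<Sum>j<N. hnorm H (f j))"
      using f by (intro norm_sum_le)
    also have "\<dots> \<le> (\<Sum>j<N. g j)"
      by (intro sum_mono le)
    also have "\<dots> \<le> suminf g"
      using \<open>summable g\<close> g by (intro sum_le_suminf) auto
    finally show ?thesis .
  qed
  then show "\<forall>\<^sub>F N in sequentially. hnorm H (\<Sum>j<N. f j) \<le> suminf g"
    by simp
qed simp

lemma closed_subspace_carrier: "closed_subspace H (hcarrier H)"
  by (rule closed_subspaceI) (auto intro: subspace)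

end

text \<open>Both sequences define formal power series of positive radius with the same values near
  0, and such series are determined by these values.\<close>

lemma complex_powser_coeff_unique:
  fixes a b :: "nat \<Rightarrow> complex"
  assumes "\<And>z. cmod z < 1 \<Longrightarrow> (\<lambda>j. z ^ j * a j) sums s z" "\<And>z. cmod z < 1 \<Longrightarrow> (\<lambda>j. z ^ j * b j) sums s z"
  shows "a = b"
proof -
  have radius: "fps_conv_radius (Abs_fps c) > 0"
    if "\<And>z. cmod z < 1 \<Longrightarrow> (\<lambda>j. z ^ j * c j) sums s z" for c :: "nat \<Rightarrow> complex"
  proof -
    \<comment> \<open>Convergence at the one point 1/2 already forces a positive radius.\<close>
    have "summable (\<lambda>j. fps_nth (Abs_fps c) j * (1/2) ^ j)"
      using that[of "1/2"] by (auto simp: sums_iff mult.commute)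
    then have "ereal (norm (1/2 :: complex)) \<le> fps_conv_radius (Abs_fps c)"
      unfolding fps_conv_radius_def by (rule conv_radius_geI)
    moreover have "0 < ereal (norm (1/2 :: complex))"
      by simp
    ultimately show ?thesis
      by (rule less_le_trans[rotated])
  qed
  have "Abs_fps a = Abs_fps b"
  proof (rule eval_fps_eqD)
    have "eval_fps (Abs_fps a) z = eval_fps (Abs_fps b) z" if "z \<in> ball 0 1" for z
      using assms[of z] that by (auto simp: eval_fps_def mult.commute sums_iff)
    then show "\<forall>\<^sub>F z in nhds 0. eval_fps (Abs_fps a) z = eval_fps (Abs_fps b) z"
      by (intro eventually_nhds_in_open[THEN eventually_mono, of "ball 0 1"]) auto
  qed (use radius assms in auto)
  then show ?thesis
    by (simp add: fps_eq_iff fun_eq_iff)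
qed

subsection \<open>Bergman weights\<close>

lemma bweight_0 [simp]: "bweight n 0 = 1"
  by (simp add: bweight_def)

lemma bweight_pos: "1 \<le> n \<Longrightarrow> 0 < bweight n j"
  by (simp add: bweight_def)

lemma bweight_nonneg [simp]: "0 \<le> bweight n j"
  by (simp add: bweight_def)

lemma of_nat_binomial_bweight: "of_nat ((n + j - 1) choose j) = of_real (inverse (bweight n j))"
  by (simp add: bweight_def)

lemma inverse_bweight: "inverse (bweight n j) = real ((n + j - 1) choose j)"
  by (simp add: bweight_def)

text \<open>This is the absorption identity for binomial coefficients. Monotonicity of the weights
  and the bound by powers of n are both read off from the ratio (n + j) / (j + 1).\<close>

lemma bweight_Suc:
  assumes "1 \<le> n"
  shows "(n + j) * bweight n (Suc j) = Suc j * bweight n j"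
proof -
  obtain m where m: "n = Suc m"
    using assms by (cases n) auto
  have "real (Suc j) * real (Suc (m + j) choose Suc j) = real (Suc (m + j)) * real ((m + j) choose j)"
    unfolding of_nat_mult[symmetric] by (simp only: Suc_times_binomial)
  moreover have "0 < real (Suc (m + j) choose Suc j)" "0 < real ((m + j) choose j)"
    by (simp_all del: binomial_Suc_Suc)
  ultimately show ?thesis
    unfolding m bweight_def by (simp add: field_simps del: binomial_Suc_Suc)
qed

lemma bweight_antimono:
  assumes "1 \<le> n"
  shows "bweight n (j + k) \<le> bweight n j"
proof (induction k)
  case (Suc k)
  have "real (Suc (j + k)) * bweight n (Suc (j + k)) \<le> real (n + (j + k)) * bweight n (Suc (j + k))"
    using assms by (intro mult_right_mono) auto
  also have "\<dots> = real (Suc (j + k)) * bweight n (j + k)"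
    using bweight_Suc[OF assms, of "j + k"] by simp
  finally have "bweight n (Suc (j + k)) \<le> bweight n (j + k)"
    by (simp only: mult_le_cancel_left_pos of_nat_0_less_iff zero_less_Suc)
  with Suc show ?case
    by simp
qed simp

lemma bweight_le_1: "1 \<le> n \<Longrightarrow> bweight n j \<le> 1"
  using bweight_antimono[of n 0 j] by simp

text \<open>Each ratio (n + j) / (j + 1) of consecutive weights is at most n. This is what makes the
  shift bounded below and the observability operators bounded.\<close>

lemma bweight_le:
  assumes "1 \<le> n"
  shows "bweight n j \<le> n ^ k * bweight n (j + k)"
proof (induction k)
  case (Suc k)
  have "real (Suc (j + k)) * bweight n (j + k) = real (n + (j + k)) * bweight n (Suc (j + k))"
    using bweight_Suc[OF assms, of "j + k"] by simp
  also have "\<dots> \<le> (real (Suc (j + k)) * n) * bweight n (Suc (j + k))"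
  proof (rule mult_right_mono)
    have "n + (j + k) \<le> Suc (j + k) * n"
      using assms by (cases n) auto
    then show "real (n + (j + k)) \<le> real (Suc (j + k)) * n"
      unfolding of_nat_mult[symmetric] of_nat_le_iff .
  qed simp
  finally have "bweight n (j + k) \<le> n * bweight n (Suc (j + k))"
    by (simp only: mult.assoc mult_le_cancel_left_pos of_nat_0_less_iff zero_less_Suc)
  then have "n ^ k * bweight n (j + k) \<le> n ^ k * (n * bweight n (Suc (j + k)))"
    by (intro mult_left_mono) auto
  with Suc show ?case
    by (simp add: mult_ac)
qed simp

lemma inverse_bweight_mono: "1 \<le> n \<Longrightarrow> inverse (bweight n j) \<le> inverse (bweight n (j + k))"
  by (simp add: bweight_antimono bweight_pos le_imp_inverse_le)

lemma inverse_bweight_le: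
  assumes "1 \<le> n"
  shows "inverse (bweight n (j + k)) \<le> n ^ k * inverse (bweight n j)"
  using bweight_le[OF assms, of j k] bweight_pos[OF assms, of j] bweight_pos[OF assms, of "j + k"]
  by (simp add: field_simps)

text \<open>The series is the binomial expansion of (1 - r)^(-n): up to sign, \<open>gchoose\<close>
  with upper index -n is the inverse weight.\<close>

lemma summable_inverse_bweight:
  assumes "1 \<le> n" "0 \<le> r" "r < 1"
  shows "summable (\<lambda>j. inverse (bweight n j) * r ^ j)"
proof -
  have "real n + real j - 1 = real (n + j - 1)" for j
    using assms(1) by (simp add: of_nat_diff)
  moreover have "(-1) ^ j * (- r) ^ j = r ^ j" for j
    unfolding power_mult_distrib[symmetric] by simp
  ultimately have "((- real n) gchoose j) * (- r) ^ j = inverse (bweight n j) * r ^ j" for j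
    unfolding gbinomial_minus inverse_bweight binomial_gbinomial
    by (metis mult.assoc mult.commute)
  then show ?thesis
    using gen_binomial_real[of "- r" "- real n"] assms(2,3) by (simp add: sums_iff)
qed

lemma summable_inverse_bweight_shift:
  assumes "1 \<le> n" "0 \<le> r" "r < 1"
  shows "summable (\<lambda>j. inverse (bweight n (j + k)) * r ^ j)"
proof (rule summable_comparison_test')
  show "summable (\<lambda>j. n ^ k * (inverse (bweight n j) * r ^ j))"
    using summable_inverse_bweight[OF assms] by (rule summable_mult)
  fix j
  have "inverse (bweight n (j + k)) * r ^ j \<le> (n ^ k * inverse (bweight n j)) * r ^ j"
    using assms(2) inverse_bweight_le[OF assms(1)] by (intro mult_right_mono) auto
  then show "norm (inverse (bweight n (j + k)) * r ^ j) \<le> n ^ k * (inverse (bweight n j) * r ^ j)"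
    using assms(2) by (simp add: mult.assoc)
qed

subsection \<open>The Bergman space as a Hilbert space of coefficient sequences\<close>

text \<open>The weights sit in the inner products of the summands, so completeness is that of a
  direct sum and the Bergman inner product is this one evaluated at Taylor coefficients.\<close>

definition coeff_space :: "nat \<Rightarrow> 'y::complex_vector hspace \<Rightarrow> (nat \<Rightarrow> 'y) hspace"
  where "coeff_space n Y = hdirect_sum
    (\<lambda>j. \<lparr>hcarrier = hcarrier Y, hinner = \<lambda>x y. of_real (bweight n j) * hinner Y x y\<rparr>)"

text \<open>A right inverse of \<open>taylor_coeff\<close> on the weighted square-summable
  sequences; the value 0 off the disk matches the convention of \<open>bergman\<close>.\<close>

definition bergman_function :: "'y::complex_vector hspace \<Rightarrow> (nat \<Rightarrow> 'y) \<Rightarrow> complex \<Rightarrow> 'y"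
  where "bergman_function Y c = (\<lambda>z. if cmod z < 1 then hsuminf Y (\<lambda>j. z ^ j *\<^sub>C c j) else 0)"

locale bergman_space =
  fixes n :: nat and Y :: "'y::complex_vector hspace"
  assumes n_pos: "1 \<le> n" and hilbert_Y: "hilbert_space Y"
begin

sublocale Y: hilbert_space Y
  by (rule hilbert_Y)

abbreviation "\<H> \<equiv> bergman n Y"
abbreviation "tc \<equiv> taylor_coeff Y"
abbreviation "\<mu> \<equiv> bweight n"
abbreviation "bfun \<equiv> bergman_function Y"

lemma mu_pos [simp]: "0 < \<mu> j"
  by (rule bweight_pos[OF n_pos])

lemma mu_neq_0 [simp]: "\<mu> j \<noteq> 0"
  by (rule less_imp_neq[OF mu_pos, symmetric])

text \<open>Multiplication by the square root of the weight maps each weighted copy of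
  \<open>Y\<close> bijectively and isometrically onto \<open>Y\<close>.\<close>

lemma hilbert_coeff_space: "hilbert_space (coeff_space n Y)"
  unfolding coeff_space_def
proof (rule hilbert_space_hdirect_sum)
  fix j
  let ?\<phi> = "\<lambda>x. complex_of_real (sqrt (\<mu> j)) *\<^sub>C x"
  have "?\<phi> (complex_of_real (1 / sqrt (\<mu> j)) *\<^sub>C x) = x" for x :: 'y
    unfolding scaleC_scaleC of_real_mult[symmetric] by (simp add: less_imp_neq[symmetric] scaleC_one)
  then have "y \<in> ?\<phi> ` hcarrier Y" if "y \<in> hcarrier Y" for y
    using that by (intro image_eqI[of _ _ "complex_of_real (1 / sqrt (\<mu> j)) *\<^sub>C y"]) auto
  then have "?\<phi> ` hcarrier Y = hcarrier Y"
    by auto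
  then show "hilbert_space \<lparr>hcarrier = hcarrier Y, hinner = \<lambda>x y. of_real (\<mu> j) * hinner Y x y\<rparr>"
    using Y.closed_subspace_carrier
    by (intro hilbert_space_pullback[OF hilbert_Y, where \<phi> = ?\<phi>])
      (auto simp: Y.subspace scaleC_add_right scaleC_scaleC mult_ac Y.inner_scale Y.inner_scale2
        mult.assoc[symmetric] of_real_mult[symmetric] simp del: of_real_mult)
qed

lemma coeff_space_mem:
  "c \<in> hcarrier (coeff_space n Y) \<longleftrightarrow>
    (\<forall>j. c j \<in> hcarrier Y) \<and> summable (\<lambda>j. \<mu> j * (hnorm Y (c j))\<^sup>2)"
proof -
  have "(hnorm \<lparr>hcarrier = hcarrier Y, hinner = \<lambda>x y. of_real (\<mu> j) * hinner Y x y\<rparr> (c j))\<^sup>2 =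
      \<mu> j * (hnorm Y (c j))\<^sup>2" if "c j \<in> hcarrier Y" for j
    using that by (simp add: hnorm_def Y.inner_ge)
  then show ?thesis
    unfolding coeff_space_def hcarrier_hdirect_sum by (auto cong: conj_cong)
qed

text \<open>Each term splits into the square root of the weight times \<open>c j\<close>, and the
  inverse square root times z^j. The product is at most the sum of the two squares, and the second
  square is a negative binomial series at |z|^2 < 1.\<close>

lemma summable_coeff:
  assumes c: "c \<in> hcarrier (coeff_space n Y)" and z: "cmod z < 1"
  shows "summable (\<lambda>j. hnorm Y (z ^ j *\<^sub>C c j))"
proof -
  have cY: "c j \<in> hcarrier Y" and s: "summable (\<lambda>j. \<mu> j * (hnorm Y (c j))\<^sup>2)" for j
    using c by (auto simp: coeff_space_mem)
  show ?thesis
  proof (rule summable_comparison_test')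
    show "summable (\<lambda>j. \<mu> j * (hnorm Y (c j))\<^sup>2 + inverse (\<mu> j) * ((cmod z)\<^sup>2) ^ j)"
      using z by (intro summable_add s summable_inverse_bweight n_pos) (auto simp: power_less_one_iff abs_square_less_1)
    fix j
    let ?a = "sqrt (\<mu> j) * hnorm Y (c j)" and ?b = "inverse (sqrt (\<mu> j)) * cmod z ^ j"
    have "?a * ?b = cmod z ^ j * hnorm Y (c j)"
      by (simp add: less_imp_neq[symmetric])
    moreover have "?a * ?b \<le> ?a\<^sup>2 + ?b\<^sup>2"
      by (rule mult_le_sum_squares)
    moreover have "?a\<^sup>2 = \<mu> j * (hnorm Y (c j))\<^sup>2"
      by (simp add: power_mult_distrib)
    moreover have "?b\<^sup>2 = inverse (\<mu> j) * ((cmod z)\<^sup>2) ^ j"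
      by (simp add: power_mult_distrib power_inverse mult.commute flip: power_mult)
    ultimately have "cmod z ^ j * hnorm Y (c j) \<le> \<mu> j * (hnorm Y (c j))\<^sup>2 + inverse (\<mu> j) * ((cmod z)\<^sup>2) ^ j"
      by (simp only:)
    then show "norm (hnorm Y (z ^ j *\<^sub>C c j)) \<le> \<mu> j * (hnorm Y (c j))\<^sup>2 + inverse (\<mu> j) * ((cmod z)\<^sup>2) ^ j"
      using cY by (simp add: Y.norm_scale norm_power)
  qed
qed

lemma power_series_bergman_function:
  assumes c: "c \<in> hcarrier (coeff_space n Y)"
  shows "power_series_on_disk Y c (bfun c)"
proof -
  have cY: "c j \<in> hcarrier Y" for j
    using c by (auto simp: coeff_space_mem)
  have "hsums Y (\<lambda>j. z ^ j *\<^sub>C c j) (bfun c z)" if z: "cmod z < 1" for z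
  proof -
    obtain s where s: "hsums Y (\<lambda>j. z ^ j *\<^sub>C c j) s"
      using Y.hsums_absolute[OF _ summable_coeff[OF c z]] cY by auto
    then show ?thesis
      using z Y.hsuminf_eqI[OF s] by (simp add: bergman_function_def)
  qed
  with cY show ?thesis
    by (simp add: power_series_on_disk_def)
qed

text \<open>Pairing with a fixed vector of \<open>Y\<close> reduces uniqueness to scalar power
  series.\<close>

lemma power_series_on_disk_unique:
  assumes c: "power_series_on_disk Y c f" and d: "power_series_on_disk Y d f"
  shows "c = d"
proof
  fix j
  have cd: "c j \<in> hcarrier Y" "d j \<in> hcarrier Y" for j
    using assms by (auto simp: power_series_on_disk_def)
  have *: "(\<lambda>j. z ^ j * hinner Y (e j) v) sums hinner Y (f z) v"
    if "power_series_on_disk Y e f" "cmod z < 1" "v \<in> hcarrier Y" for e z v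
    using Y.hsums_inner[of "\<lambda>j. z ^ j *\<^sub>C e j" v "f z"] that
    by (simp add: power_series_on_disk_def Y.inner_scale)
  have "(\<lambda>j. hinner Y (c j) v) = (\<lambda>j. hinner Y (d j) v)" if "v \<in> hcarrier Y" for v
    using *[OF c _ that] *[OF d _ that] by (rule complex_powser_coeff_unique)
  then have "hinner Y (c j) v = hinner Y (d j) v" if "v \<in> hcarrier Y" for v
    using that by meson
  then have "hinner Y v (c j) = hinner Y v (d j)" if "v \<in> hcarrier Y" for v
    using that Y.inner_commute[OF that cd(1)[of j]] Y.inner_commute[OF that cd(2)[of j]] by simp
  then show "c j = d j"
    using cd by (intro Y.inner_eqI)
qed

lemma taylor_coeff_eqI: "power_series_on_disk Y c f \<Longrightarrow> tc f = c"
  unfolding taylor_coeff_def by (rule the_equality) (auto intro: power_series_on_disk_unique)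

lemma bergman_memI:
  assumes "power_series_on_disk Y c f" "c \<in> hcarrier (coeff_space n Y)" "\<And>z. 1 \<le> cmod z \<Longrightarrow> f z = 0"
  shows "f \<in> hcarrier \<H>"
  using assms by (auto simp: bergman_def coeff_space_mem)

lemma bergman_memD:
  assumes "f \<in> hcarrier \<H>"
  shows "power_series_on_disk Y (tc f) f" "tc f \<in> hcarrier (coeff_space n Y)"
    "1 \<le> cmod z \<Longrightarrow> f z = 0"
proof -
  obtain c where c: "power_series_on_disk Y c f" "summable (\<lambda>j. \<mu> j * (hnorm Y (c j))\<^sup>2)"
    using assms by (auto simp: bergman_def)
  with taylor_coeff_eqI[OF c(1)] show "power_series_on_disk Y (tc f) f"
    "tc f \<in> hcarrier (coeff_space n Y)"
    by (simp_all add: coeff_space_mem) (simp add: power_series_on_disk_def)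
qed (use assms in \<open>auto simp: bergman_def\<close>)

lemma tc_bfun [simp]: "c \<in> hcarrier (coeff_space n Y) \<Longrightarrow> tc (bfun c) = c"
  by (rule taylor_coeff_eqI[OF power_series_bergman_function])

lemma bfun_mem [simp]: "c \<in> hcarrier (coeff_space n Y) \<Longrightarrow> bfun c \<in> hcarrier \<H>"
  by (rule bergman_memI[OF power_series_bergman_function]) (auto simp: bergman_function_def)

lemma power_series_add:
  "power_series_on_disk Y c f \<Longrightarrow> power_series_on_disk Y d g \<Longrightarrow> power_series_on_disk Y (c + d) (f + g)"
  by (auto simp: power_series_on_disk_def scaleC_add_right intro!: Y.hsums_add)

lemma power_series_scale:
  assumes f: "power_series_on_disk Y c f"
  shows "power_series_on_disk Y (a *\<^sub>C c) (a *\<^sub>C f)"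
proof -
  have "hsums Y (\<lambda>j. a *\<^sub>C (z ^ j *\<^sub>C c j)) (a *\<^sub>C f z)" if "cmod z < 1" for z
    using f that by (intro Y.hsums_scale) (auto simp: power_series_on_disk_def)
  with f show ?thesis
    by (simp add: power_series_on_disk_def scaleC_fun_def scaleC_scaleC mult.commute)
qed

lemma tc_add: "f \<in> hcarrier \<H> \<Longrightarrow> g \<in> hcarrier \<H> \<Longrightarrow> tc (f + g) = tc f + tc g"
  by (intro taylor_coeff_eqI power_series_add bergman_memD(1))

lemma tc_scale: "f \<in> hcarrier \<H> \<Longrightarrow> tc (a *\<^sub>C f) = a *\<^sub>C tc f"
  by (intro taylor_coeff_eqI power_series_scale bergman_memD(1))

lemma bergman_eqI:
  assumes f: "f \<in> hcarrier \<H>" and g: "g \<in> hcarrier \<H>" and eq: "\<And>j. tc f j = tc g j"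
  shows "f = g"
proof
  fix z
  have tc: "tc f = tc g"
    using eq by auto
  show "f z = g z"
  proof (cases "cmod z < 1")
    case True
    then have "hsums Y (\<lambda>j. z ^ j *\<^sub>C tc f j) (f z)" "hsums Y (\<lambda>j. z ^ j *\<^sub>C tc f j) (g z)"
      using bergman_memD(1)[OF f] bergman_memD(1)[OF g] by (simp_all add: power_series_on_disk_def tc)
    then show ?thesis
      unfolding hsums_def by (rule Y.limitin_unique)
  qed (use bergman_memD(3)[OF f] bergman_memD(3)[OF g] in auto)
qed

lemma hinner_bergman: "hinner \<H> f g = hinner (coeff_space n Y) (tc f) (tc g)"
  by (simp add: bergman_def coeff_space_def hinner_hdirect_sum)

lemma hilbert_bergman: "hilbert_space \<H>"
proof (rule hilbert_space_pullback[OF hilbert_coeff_space, where \<phi> = tc])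
  interpret W: hilbert_space "coeff_space n Y"
    by (rule hilbert_coeff_space)
  have add: "f + g \<in> hcarrier \<H>" if "f \<in> hcarrier \<H>" "g \<in> hcarrier \<H>" for f g
    using bergman_memD[OF that(1)] bergman_memD[OF that(2)]
    by (intro bergman_memI[of "tc f + tc g"] power_series_add W.add_mem) auto
  have scale: "a *\<^sub>C f \<in> hcarrier \<H>" if "f \<in> hcarrier \<H>" for a f
    using bergman_memD[OF that]
    by (intro bergman_memI[OF power_series_scale] W.scale_mem) (auto simp: scaleC_fun_def)
  \<comment> \<open>Zero is obtained as the 0-multiple of an element, because \<open>bfun 0\<close>
    has not been identified with the zero function.\<close>
  have "bfun 0 \<in> hcarrier \<H>"
    by simp
  from scale[OF this, of 0] have zero: "0 \<in> hcarrier \<H>"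
    by simp
  show "complex_vector.subspace (hcarrier \<H>)"
    by (rule complex_vector.subspaceI[OF zero add scale])
  have "tc ` hcarrier \<H> = hcarrier (coeff_space n Y)"
  proof
    show "hcarrier (coeff_space n Y) \<subseteq> tc ` hcarrier \<H>"
      by (metis bfun_mem image_eqI subsetI tc_bfun)
  qed (use bergman_memD(2) in auto)
  then show "closed_subspace (coeff_space n Y) (tc ` hcarrier \<H>)"
    by (simp add: W.closed_subspace_carrier)
  show "f = 0" if f: "f \<in> hcarrier \<H>" and "tc f = 0" for f
  proof (rule bergman_eqI[OF f zero])
    have "tc 0 = 0"
      using tc_scale[OF f, of 0] by simp
    with that show "tc f j = tc 0 j" for j
      by simp
  qed
qed (simp_all add: tc_add tc_scale hinner_bergman)

sublocale \<H>: hilbert_space \<H>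
  by (rule hilbert_bergman)

lemma tc_mem [simp]: "f \<in> hcarrier \<H> \<Longrightarrow> tc f j \<in> hcarrier Y"
  using bergman_memD(2) by (simp add: coeff_space_mem)

lemma tc_zero [simp]: "tc 0 j = 0"
  using tc_scale[OF \<H>.zero_mem, of 0] by simp

lemma tc_diff: "f \<in> hcarrier \<H> \<Longrightarrow> g \<in> hcarrier \<H> \<Longrightarrow> tc (f - g) = tc f - tc g"
  using tc_add[of f "(-1) *\<^sub>C g"] tc_scale[of g "-1"] by simp

lemma inner_sums:
  assumes "f \<in> hcarrier \<H>" "g \<in> hcarrier \<H>"
  shows "(\<lambda>j. of_real (\<mu> j) * hinner Y (tc f j) (tc g j)) sums hinner \<H> f g"
proof -
  have "inner_product_space \<lparr>hcarrier = hcarrier Y, hinner = \<lambda>x y. of_real (\<mu> j) * hinner Y x y\<rparr>" for j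
    by unfold_locales
      (auto simp: Y.subspace Y.inner_add Y.inner_scale algebra_simps Y.inner_pos
        intro: Y.inner_commute)
  from summable_hinner_hdirect_sum[OF this] bergman_memD(2)[OF assms(1)] bergman_memD(2)[OF assms(2)]
  show ?thesis
    by (simp add: coeff_space_def hinner_bergman hinner_hdirect_sum summable_sums)
qed

lemma norm_sums:
  assumes "f \<in> hcarrier \<H>"
  shows "(\<lambda>j. \<mu> j * (hnorm Y (tc f j))\<^sup>2) sums (hnorm \<H> f)\<^sup>2"
  using sums_Re[OF inner_sums[OF assms assms]] assms by (simp add: \<H>.norm_power2 Y.norm_power2)

lemma norm_tc_le:
  assumes "f \<in> hcarrier \<H>"
  shows "\<mu> j * (hnorm Y (tc f j))\<^sup>2 \<le> (hnorm \<H> f)\<^sup>2"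
proof -
  have "(\<Sum>i\<in>{j}. \<mu> i * (hnorm Y (tc f i))\<^sup>2) \<le> (\<Sum>i. \<mu> i * (hnorm Y (tc f i))\<^sup>2)"
    using norm_sums[OF assms] by (intro sum_le_suminf) (auto simp: sums_iff)
  then show ?thesis
    using norm_sums[OF assms] by (simp add: sums_iff)
qed

lemma norm_tc_le':
  assumes "f \<in> hcarrier \<H>"
  shows "hnorm Y (tc f j) \<le> inverse (\<mu> j) * hnorm \<H> f"
proof (rule power2_le_imp_le)
  have "(hnorm Y (tc f j))\<^sup>2 \<le> inverse (\<mu> j) * (hnorm \<H> f)\<^sup>2"
    using norm_tc_le[OF assms, of j] by (simp add: field_simps)
  \<comment> \<open>The sharp factor is the inverse square root of the weight; as weights are at
    most 1, the cruder inverse weight is allowed and fits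
    \<open>summable_inverse_bweight\<close>.\<close>
  also have "\<dots> \<le> (inverse (\<mu> j))\<^sup>2 * (hnorm \<H> f)\<^sup>2"
    using bweight_le_1[OF n_pos, of j] one_le_inverse[of "\<mu> j"]
    by (intro mult_right_mono) (auto simp: power2_eq_square)
  finally show "(hnorm Y (tc f j))\<^sup>2 \<le> (inverse (\<mu> j) * hnorm \<H> f)\<^sup>2"
    by (simp add: power_mult_distrib)
qed (use assms in \<open>simp add: less_imp_le\<close>)

lemma eval_sums: "f \<in> hcarrier \<H> \<Longrightarrow> cmod z < 1 \<Longrightarrow> hsums Y (\<lambda>j. z ^ j *\<^sub>C tc f j) (f z)"
  using bergman_memD(1) by (simp add: power_series_on_disk_def)

lemma eval_mem [simp]: "f \<in> hcarrier \<H> \<Longrightarrow> f z \<in> hcarrier Y"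
  by (cases "cmod z < 1") (auto intro: Y.hsums_mem[OF _ eval_sums] simp: bergman_memD(3) not_less)

lemma eval_0:
  assumes "f \<in> hcarrier \<H>"
  shows "f 0 = tc f 0"
proof -
  have "hsums Y (\<lambda>j. 0 ^ j *\<^sub>C tc f j) (\<Sum>j<Suc 0. 0 ^ j *\<^sub>C tc f j)"
    using assms by (intro Y.hsums_finite) auto
  then have "hsums Y (\<lambda>j. 0 ^ j *\<^sub>C tc f j) (tc f 0)"
    by (simp add: scaleC_one)
  moreover have "hsums Y (\<lambda>j. 0 ^ j *\<^sub>C tc f j) (f 0)"
    using eval_sums[OF assms, of 0] by simp
  ultimately show ?thesis
    unfolding hsums_def by (rule Y.limitin_unique[symmetric])
qed

lemma eval_bounded:
  assumes z: "cmod z < 1"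
  obtains c where "\<And>f. f \<in> hcarrier \<H> \<Longrightarrow> hnorm Y (f z) \<le> c * hnorm \<H> f"
proof
  fix f
  assume f: "f \<in> hcarrier \<H>"
  have s: "summable (\<lambda>j. inverse (\<mu> j) * cmod z ^ j)"
    using z by (intro summable_inverse_bweight n_pos) auto
  have "hnorm Y (f z) \<le> (\<Sum>j. (inverse (\<mu> j) * cmod z ^ j) * hnorm \<H> f)"
  proof (rule Y.hsums_norm_le[OF _ eval_sums[OF f z]])
    fix j
    have "cmod z ^ j * hnorm Y (tc f j) \<le> cmod z ^ j * (inverse (\<mu> j) * hnorm \<H> f)"
      using norm_tc_le'[OF f] by (intro mult_left_mono) auto
    then show "hnorm Y (z ^ j *\<^sub>C tc f j) \<le> inverse (\<mu> j) * cmod z ^ j * hnorm \<H> f"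
      using f by (simp add: Y.norm_scale norm_power mult_ac)
  qed (use f s in \<open>auto intro: summable_mult2\<close>)
  then show "hnorm Y (f z) \<le> (\<Sum>j. inverse (\<mu> j) * cmod z ^ j) * hnorm \<H> f"
    using suminf_mult2[OF s] by simp
qed

section \<open>The shift on the Bergman space\<close>

lemma power_series_shift:
  assumes "power_series_on_disk Y c f"
  shows "power_series_on_disk Y (case_nat 0 c) (shift f)"
  unfolding power_series_on_disk_def
proof (intro conjI allI impI)
  show "case_nat 0 c j \<in> hcarrier Y" for j
    using assms by (cases j) (auto simp: power_series_on_disk_def)
  fix z :: complex
  assume z: "cmod z < 1"
  have c: "c j \<in> hcarrier Y" for j
    using assms by (simp add: power_series_on_disk_def)
  have "hsums Y (\<lambda>j. z *\<^sub>C (z ^ j *\<^sub>C c j)) (z *\<^sub>C f z)"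
    using assms z by (intro Y.hsums_scale) (auto simp: power_series_on_disk_def)
  then have "hsums Y (\<lambda>j. z ^ j *\<^sub>C case_nat 0 c j) (z ^ 0 *\<^sub>C case_nat 0 c 0 + z *\<^sub>C f z)"
    using c by (intro Y.hsums_Suc) (auto simp: scaleC_scaleC split: nat.split)
  then show "hsums Y (\<lambda>j. z ^ j *\<^sub>C case_nat 0 c j) (shift f z)"
    by (simp add: shift_def)
qed

lemma tc_shift: "f \<in> hcarrier \<H> \<Longrightarrow> tc (shift f) = case_nat 0 (tc f)"
  by (rule taylor_coeff_eqI[OF power_series_shift[OF bergman_memD(1)]])

lemma shift_mem [simp]:
  assumes f: "f \<in> hcarrier \<H>"
  shows "shift f \<in> hcarrier \<H>"
proof (rule bergman_memI[OF power_series_shift[OF bergman_memD(1)[OF f]]])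
  have "summable (\<lambda>j. \<mu> (Suc j) * (hnorm Y (tc f j))\<^sup>2)"
  proof (rule summable_comparison_test')
    show "summable (\<lambda>j. \<mu> j * (hnorm Y (tc f j))\<^sup>2)"
      using norm_sums[OF f] by (simp add: sums_iff)
    show "norm (\<mu> (Suc j) * (hnorm Y (tc f j))\<^sup>2) \<le> \<mu> j * (hnorm Y (tc f j))\<^sup>2" for j
      using bweight_antimono[OF n_pos, of j 1] by (simp add: mult_right_mono)
  qed
  then have "summable (\<lambda>j. \<mu> (Suc j) * (hnorm Y (case_nat 0 (tc f) (Suc j)))\<^sup>2)"
    by simp
  then have "summable (\<lambda>j. \<mu> j * (hnorm Y (case_nat 0 (tc f) j))\<^sup>2)"
    by (subst (asm) summable_Suc_iff)
  then show "case_nat 0 (tc f) \<in> hcarrier (coeff_space n Y)"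
    using f by (simp add: coeff_space_mem split: nat.split)
qed (use bergman_memD(3)[OF f] in \<open>simp add: shift_def\<close>)

lemma norm_shift_le:
  assumes f: "f \<in> hcarrier \<H>"
  shows "hnorm \<H> (shift f) \<le> hnorm \<H> f"
proof (rule power2_le_imp_le)
  have "(\<lambda>j. \<mu> (Suc j) * (hnorm Y (tc f j))\<^sup>2) sums (hnorm \<H> (shift f))\<^sup>2"
    using norm_sums[OF shift_mem[OF f]] f
      sums_Suc_iff[of "\<lambda>j. \<mu> j * (hnorm Y (tc (shift f) j))\<^sup>2" "(hnorm \<H> (shift f))\<^sup>2"]
    by (simp add: tc_shift)
  then show "(hnorm \<H> (shift f))\<^sup>2 \<le> (hnorm \<H> f)\<^sup>2"
    by (rule sums_le[OF _ _ norm_sums[OF f], rotated])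
      (use bweight_antimono[OF n_pos, of _ 1] in \<open>simp add: mult_right_mono\<close>)
qed (use f in simp)

lemma bounded_operator_shift: "bounded_operator \<H> \<H> shift"
proof (rule bounded_operatorI[where c = 1])
  show "shift (f + g) = shift f + shift g" for f g :: "complex \<Rightarrow> 'y"
    by (simp add: shift_def fun_eq_iff scaleC_add_right)
  show "shift (a *\<^sub>C f) = a *\<^sub>C shift f" for a and f :: "complex \<Rightarrow> 'y"
    by (simp add: shift_def scaleC_fun_def fun_eq_iff scaleC_scaleC mult.commute)
qed (use norm_shift_le in auto)

lemma shift_pow_mem [simp]: "f \<in> hcarrier \<H> \<Longrightarrow> (shift ^^ k) f \<in> hcarrier \<H>"
  by (induction k) auto

lemma tc_shift_pow:
  "f \<in> hcarrier \<H> \<Longrightarrow> tc ((shift ^^ k) f) j = (if j < k then 0 else tc f (j - k))"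
  by (induction k arbitrary: j) (auto simp: tc_shift split: nat.split)

lemma bounded_operator_shift_pow: "bounded_operator \<H> \<H> (shift ^^ k)"
  by (rule bounded_operator_funpow[OF _ bounded_operator_shift]) unfold_locales

text \<open>Moving a coefficient up by k indices lowers its weight by a factor of at most n^k. The
  resulting lower bound for the shift is the reason why S^k M is closed.\<close>

lemma norm_le_shift_pow:
  assumes f: "f \<in> hcarrier \<H>"
  shows "(hnorm \<H> f)\<^sup>2 \<le> n ^ k * (hnorm \<H> ((shift ^^ k) f))\<^sup>2"
proof -
  have "(\<lambda>j. \<mu> (j + k) * (hnorm Y (tc f j))\<^sup>2) sums (hnorm \<H> ((shift ^^ k) f))\<^sup>2"
    using norm_sums[OF shift_pow_mem[OF f, of k]] f
    by (subst (asm) sums_zero_iff_shift[of k, symmetric]) (auto simp: tc_shift_pow)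
  then have "(\<lambda>j. n ^ k * (\<mu> (j + k) * (hnorm Y (tc f j))\<^sup>2)) sums (n ^ k * (hnorm \<H> ((shift ^^ k) f))\<^sup>2)"
    by (rule sums_mult)
  then show ?thesis
  proof (rule sums_le[OF _ norm_sums[OF f], rotated])
    fix j
    have "\<mu> j * (hnorm Y (tc f j))\<^sup>2 \<le> (n ^ k * \<mu> (j + k)) * (hnorm Y (tc f j))\<^sup>2"
      using bweight_le[OF n_pos] by (intro mult_right_mono) auto
    then show "\<mu> j * (hnorm Y (tc f j))\<^sup>2 \<le> n ^ k * (\<mu> (j + k) * (hnorm Y (tc f j))\<^sup>2)"
      by (simp add: mult.assoc)
  qed
qed

lemma inner_shift_pow_sums:
  assumes f: "f \<in> hcarrier \<H>" and g: "g \<in> hcarrier \<H>"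
  shows "(\<lambda>j. of_real (\<mu> (j + k)) * hinner Y (tc f (j + k)) (tc g j)) sums hinner \<H> f ((shift ^^ k) g)"
  using inner_sums[OF f shift_pow_mem[OF g, of k]] f g
  by (subst (asm) sums_zero_iff_shift[of k, symmetric]) (auto simp: tc_shift_pow)

lemma monomial_eq:
  assumes "y \<in> hcarrier Y"
  shows "monomial k y \<in> hcarrier \<H>" "tc (monomial k y) j = (if j = k then y else 0)"
proof -
  let ?c = "\<lambda>j. if j = k then y else 0"
  have "hsums Y (\<lambda>j. z ^ j *\<^sub>C ?c j) (\<Sum>j<Suc k. z ^ j *\<^sub>C ?c j)" for z
    using assms by (intro Y.hsums_finite) auto
  moreover have "(\<Sum>j<Suc k. z ^ j *\<^sub>C ?c j) = z ^ k *\<^sub>C y" for z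
    by simp
  ultimately have "hsums Y (\<lambda>j. z ^ j *\<^sub>C ?c j) (z ^ k *\<^sub>C y)" for z
    by metis
  then have ps: "power_series_on_disk Y ?c (monomial k y)"
    using assms by (simp add: power_series_on_disk_def monomial_def)
  have "summable (\<lambda>j. \<mu> j * (hnorm Y (?c j))\<^sup>2)"
    by (rule summable_finite[of "{k}"]) auto
  then show "monomial k y \<in> hcarrier \<H>"
    using assms by (intro bergman_memI[OF ps]) (auto simp: coeff_space_mem monomial_def)
  show "tc (monomial k y) j = ?c j"
    using taylor_coeff_eqI[OF ps] by simp
qed

lemma bounded_operator_eval_0: "bounded_operator \<H> Y (\<lambda>f. f 0)"
proof -
  obtain c where c: "\<And>f. f \<in> hcarrier \<H> \<Longrightarrow> hnorm Y (f 0) \<le> c * hnorm \<H> f"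
    using eval_bounded[of 0] by auto
  then show ?thesis
    by (intro bounded_operatorI[where c = c]) (auto simp: scaleC_fun_def)
qed

text \<open>These are the coefficients of the adjoint of \<open>shift ^^ k\<close> applied to
  \<open>f\<close>. The ratio of weights is at most 1, so the weighted sum is dominated by a tail of
  that of \<open>f\<close>.\<close>

lemma backward_shift_mem:
  assumes f: "f \<in> hcarrier \<H>"
  shows "(\<lambda>j. of_real (\<mu> (j + k) / \<mu> j) *\<^sub>C tc f (j + k)) \<in> hcarrier (coeff_space n Y)"
proof -
  have "summable (\<lambda>j. \<mu> j * (hnorm Y (complex_of_real (\<mu> (j + k) / \<mu> j) *\<^sub>C tc f (j + k)))\<^sup>2)"
  proof (rule summable_comparison_test')
    show "summable (\<lambda>j. \<mu> (j + k) * (hnorm Y (tc f (j + k)))\<^sup>2)"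
      using norm_sums[OF f] by (subst summable_iff_shift) (simp add: sums_iff)
    fix j
    have "\<mu> j * (hnorm Y (complex_of_real (\<mu> (j + k) / \<mu> j) *\<^sub>C tc f (j + k)))\<^sup>2 =
        (\<mu> (j + k) / \<mu> j) * (\<mu> (j + k) * (hnorm Y (tc f (j + k)))\<^sup>2)"
      using f by (simp add: Y.norm_scale norm_divide power_mult_distrib power2_eq_square field_simps)
    also have "\<dots> \<le> 1 * (\<mu> (j + k) * (hnorm Y (tc f (j + k)))\<^sup>2)"
      using bweight_antimono[OF n_pos, of j k] by (intro mult_right_mono) auto
    finally show "norm (\<mu> j * (hnorm Y (complex_of_real (\<mu> (j + k) / \<mu> j) *\<^sub>C tc f (j + k)))\<^sup>2)
        \<le> \<mu> (j + k) * (hnorm Y (tc f (j + k)))\<^sup>2"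
      by simp
  qed
  then show ?thesis
    using f by (simp add: coeff_space_mem)
qed

text \<open>The ratio of weights replaces mu_j by mu_(j+k), which is the weight that the shifted
  coefficients of \<open>g\<close> carry.\<close>

lemma inner_backward_shift:
  assumes f: "f \<in> hcarrier \<H>" and g: "g \<in> hcarrier \<H>"
  shows "hinner \<H> (bfun (\<lambda>j. of_real (\<mu> (j + k) / \<mu> j) *\<^sub>C tc f (j + k))) g = hinner \<H> f ((shift ^^ k) g)"
proof -
  note b = backward_shift_mem[OF f, of k]
  have "of_real (\<mu> j) * hinner Y (tc (bfun (\<lambda>j. of_real (\<mu> (j + k) / \<mu> j) *\<^sub>C tc f (j + k))) j) (tc g j) =
      of_real (\<mu> (j + k)) * hinner Y (tc f (j + k)) (tc g j)" for j
    using f g b by (simp add: Y.inner_scale)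
  with inner_sums[OF bfun_mem[OF b] g] inner_shift_pow_sums[OF f g, of k] show ?thesis
    by (simp add: sums_unique2)
qed

end

lemma scaleC_fun_apply: "(a *\<^sub>C f) x = a *\<^sub>C f x"
  by (simp add: scaleC_fun_def)

text \<open>For an operator bounded below, convergence of the images makes the preimages Cauchy, and
  the operator maps their limit to the limit of the images.\<close>

lemma closed_subspace_range:
  assumes H: "hilbert_space H" and K: "hilbert_space K" and T: "bounded_operator H K T"
    and below: "\<And>x. x \<in> hcarrier H \<Longrightarrow> hnorm H x \<le> c * hnorm K (T x)"
  shows "closed_subspace K (T ` hcarrier H)"
proof -
  interpret H: hilbert_space H
    by (rule H)
  interpret K: hilbert_space K
    by (rule K)
  note mem = bounded_operator_mem[OF T]
  show ?thesis
  proof (rule K.closed_subspaceI)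
    show "complex_vector.subspace (T ` hcarrier H)"
    proof (rule complex_vector.subspaceI)
      show "0 \<in> T ` hcarrier H"
        using bounded_operator_zero[OF T H.zero_mem] by (intro image_eqI[of _ _ 0]) simp_all
    next
      fix x y
      assume "x \<in> T ` hcarrier H" "y \<in> T ` hcarrier H"
      then obtain u v where "u \<in> hcarrier H" "v \<in> hcarrier H" "x = T u" "y = T v"
        by blast
      then show "x + y \<in> T ` hcarrier H"
        using bounded_operator_add[OF T] by (intro image_eqI[of _ _ "u + v"]) simp_all
    next
      fix a x
      assume "x \<in> T ` hcarrier H"
      then obtain u where "u \<in> hcarrier H" "x = T u"
        by blast
      then show "a *\<^sub>C x \<in> T ` hcarrier H"
        using bounded_operator_scale[OF T] by (intro image_eqI[of _ _ "a *\<^sub>C u"]) simp_all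
    qed
    fix f l
    assume f: "\<And>n. f n \<in> T ` hcarrier H" and l: "l \<in> hcarrier K"
      and lim: "(\<lambda>n. hnorm K (f n - l)) \<longlonglongrightarrow> 0"
    then have "\<forall>n. \<exists>x. x \<in> hcarrier H \<and> f n = T x"
      by blast
    then obtain g where g: "\<And>n. g n \<in> hcarrier H" "\<And>n. f n = T (g n)"
      by metis
    have fK: "f n \<in> hcarrier K" for n
      using g mem by simp
    obtain x where x: "x \<in> hcarrier H" "(\<lambda>n. hnorm H (g n - x)) \<longlonglongrightarrow> 0"
    proof (rule H.Cauchy_limit[OF g(1)])
      fix e :: real
      assume e: "e > 0"
      \<comment> \<open>\<open>\<bar>c\<bar> + 1\<close> replaces \<open>c\<close>, whose sign is
        unknown, so that the division is legitimate.\<close>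
      define d where "d = e / (\<bar>c\<bar> + 1)"
      have "d / 2 > 0"
        using e by (simp add: d_def)
      with lim obtain N where N: "\<And>n. n \<ge> N \<Longrightarrow> hnorm K (f n - l) < d / 2"
        unfolding LIMSEQ_iff using fK l by fastforce
      have "hnorm H (g m - g n) < e" if mn: "m \<ge> N" "n \<ge> N" for m n
      proof -
        have "hnorm H (g m - g n) \<le> c * hnorm K (f m - f n)"
          using below[of "g m - g n"] g H.bounded_operator_diff[OF T] by simp
        also have "\<dots> \<le> (\<bar>c\<bar> + 1) * hnorm K (f m - f n)"
          using fK by (intro mult_right_mono) auto
        also have "\<dots> < (\<bar>c\<bar> + 1) * d"
        proof (rule mult_strict_left_mono)
          have "hnorm K (f m - f n) \<le> hnorm K (f m - l) + hnorm K (l - f n)"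
            using K.norm_triangle[of "f m - l" "l - f n"] fK l by simp
          also have "hnorm K (l - f n) = hnorm K (f n - l)"
            using fK l by (intro K.norm_minus_commute)
          also have "hnorm K (f m - l) + hnorm K (f n - l) < d"
            using N[OF mn(1)] N[OF mn(2)] by simp
          finally show "hnorm K (f m - f n) < d" .
        qed simp
        finally show ?thesis
          by (simp add: d_def add_pos_nonneg less_imp_neq[symmetric])
      qed
      then show "\<exists>N. \<forall>m\<ge>N. \<forall>n\<ge>N. hnorm H (g m - g n) < e"
        by blast
    qed
    have "(\<lambda>n. hnorm K (T (g n) - T x)) \<longlonglongrightarrow> 0"
      using x g by (intro tendsto_bounded_operator[OF _ _ T]) unfold_locales
    then have "limitin (htopology K) f (T x) sequentially"
      using x g mem fK by (simp add: K.limitin_iff)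
    moreover have "limitin (htopology K) f l sequentially"
      using lim l fK by (simp add: K.limitin_iff)
    ultimately have "l = T x"
      by (rule K.limitin_unique[symmetric])
    then show "l \<in> T ` hcarrier H"
      using x by simp
  qed (use mem in auto)
qed

lemma inner_hadjoint_pow:
  assumes "hilbert_space H" "bounded_operator H H T" "v \<in> hcarrier H" "w \<in> hcarrier H"
  shows "hinner H v ((hadjoint H H T ^^ j) w) = hinner H ((T ^^ j) v) w"
    "(hadjoint H H T ^^ j) w \<in> hcarrier H"
proof -
  interpret H: hilbert_space H
    by (rule assms)
  have "(hadjoint H H T ^^ j) w \<in> hcarrier H \<and>
      (\<forall>v\<in>hcarrier H. hinner H v ((hadjoint H H T ^^ j) w) = hinner H ((T ^^ j) v) w)"
  proof (induction j)
    case (Suc j)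
    then show ?case
      using assms
      by (simp add: hadjoint_mem[OF assms(1) H.inner_product_space_axioms assms(2)] funpow_swap1[of T j]
          inner_hadjoint[OF assms(1) H.inner_product_space_axioms assms(2)] bounded_operator_mem[OF assms(2)])
  qed (use assms in simp)
  with assms show "hinner H v ((hadjoint H H T ^^ j) w) = hinner H ((T ^^ j) v) w"
    "(hadjoint H H T ^^ j) w \<in> hcarrier H"
    by auto
qed

section \<open>Expansion in monomials\<close>

context bergman_space
begin

lemma inner_monomial:
  assumes f: "f \<in> hcarrier \<H>" and y: "y \<in> hcarrier Y"
  shows "hinner \<H> f (monomial j y) = of_real (\<mu> j) * hinner Y (tc f j) y"
proof -
  have "(\<lambda>i. of_real (\<mu> i) * hinner Y (tc f i) (tc (monomial j y) i)) sums
      (\<Sum>i\<in>{j}. of_real (\<mu> i) * hinner Y (tc f i) (tc (monomial j y) i))"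
    using f y by (intro sums_finite) (auto simp: monomial_eq)
  with inner_sums[OF f monomial_eq(1)[OF y]]
  have "hinner \<H> f (monomial j y) =
      (\<Sum>i\<in>{j}. of_real (\<mu> i) * hinner Y (tc f i) (tc (monomial j y) i))"
    by (rule sums_unique2)
  then show ?thesis
    using y by (simp add: monomial_eq)
qed

lemma tc_sum: "(\<And>i. i \<in> I \<Longrightarrow> f i \<in> hcarrier \<H>) \<Longrightarrow> tc (sum f I) j = (\<Sum>i\<in>I. tc (f i) j)"
  by (induction I rule: infinite_finite_induct) (simp_all add: tc_add)

text \<open>The squared distance to a partial sum is a tail of the convergent series for the squared
  norm. The expansion allows bounded operators to be applied term by term.\<close>

lemma hsums_monomial:
  assumes f: "f \<in> hcarrier \<H>"
  shows "hsums \<H> (\<lambda>j. monomial j (tc f j)) f"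
proof -
  have m: "monomial j (tc f j) \<in> hcarrier \<H>" for j
    using f by (simp add: monomial_eq)
  define r where "r N = (\<Sum>j<N. monomial j (tc f j)) - f" for N
  have r: "r N \<in> hcarrier \<H>" for N
    using m f by (simp add: r_def)
  have tc_r: "tc (r N) j = (if j < N then 0 else - tc f j)" for N j
    using m f by (simp add: r_def tc_diff tc_sum monomial_eq)
  have "(hnorm \<H> (r N))\<^sup>2 = (\<Sum>j. \<mu> (j + N) * (hnorm Y (tc f (j + N)))\<^sup>2)" for N
  proof -
    have "(\<lambda>j. \<mu> (j + N) * (hnorm Y (tc (r N) (j + N)))\<^sup>2) sums (hnorm \<H> (r N))\<^sup>2"
      using norm_sums[OF r] by (subst sums_zero_iff_shift) (auto simp: tc_r)
    then show ?thesis
      using f by (simp add: tc_r Y.norm_uminus sums_iff)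
  qed
  moreover have "(\<lambda>N. \<Sum>j. \<mu> (j + N) * (hnorm Y (tc f (j + N)))\<^sup>2) \<longlonglongrightarrow> 0"
    using norm_sums[OF f] by (intro suminf_exist_split2) (simp add: sums_iff)
  ultimately have "(\<lambda>N. (hnorm \<H> (r N))\<^sup>2) \<longlonglongrightarrow> 0"
    by simp
  then have "(\<lambda>N. sqrt ((hnorm \<H> (r N))\<^sup>2)) \<longlonglongrightarrow> sqrt 0"
    by (rule tendsto_real_sqrt)
  then have "(\<lambda>N. hnorm \<H> (r N)) \<longlonglongrightarrow> 0"
    using r by simp
  then show ?thesis
    using f m by (simp add: \<H>.hsums_iff r_def)
qed

text \<open>Dropping the k leading zero terms aligns the index with that of the k-th gramian
  series.\<close>

lemma hsums_monomial_shift: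
  assumes f: "f \<in> hcarrier \<H>" and k: "\<And>i. i < k \<Longrightarrow> tc f i = 0"
  shows "hsums \<H> (\<lambda>j. monomial (j + k) (tc f (j + k))) f"
proof -
  have m: "monomial j (tc f j) \<in> hcarrier \<H>" for j
    using f by (simp add: monomial_eq)
  have "(\<Sum>j<N + k. monomial j (tc f j)) = (\<Sum>j<N. monomial (j + k) (tc f (j + k)))" for N
  proof -
    have "monomial j (tc f j) = 0" if "j < k" for j
      using k[OF that] by (simp add: monomial_def fun_eq_iff)
    then show ?thesis
      by (induction N) (auto intro: sum.neutral)
  qed
  moreover have "(\<lambda>N. hnorm \<H> ((\<Sum>j<N. monomial j (tc f j)) - f)) \<longlonglongrightarrow> 0"
    using hsums_monomial[OF f] m by (simp add: \<H>.hsums_iff)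
  then have "(\<lambda>N. hnorm \<H> ((\<Sum>j<N + k. monomial j (tc f j)) - f)) \<longlonglongrightarrow> 0"
    by (rule LIMSEQ_ignore_initial_segment)
  ultimately show ?thesis
    using m f by (simp add: \<H>.hsums_iff)
qed

end

subsection \<open>Isometric observability\<close>

text \<open>The assumption \<open>observability\<close> says that the function with coefficients
  mu_j^-1 C A^j x has Bergman norm equal to the norm of x: the weight mu_j meets mu_j^-2. It is the
  common ground of abstract hypercontractions and of the backward shift on the complement of an
  invariant subspace.\<close>

locale isometric_pair = bergman_space n Y for n and Y :: "'y::complex_vector hspace" +
  fixes X :: "'x::complex_vector hspace" and A :: "'x \<Rightarrow> 'x" and C :: "'x \<Rightarrow> 'y"
  assumes hilbert_X: "hilbert_space X"
    and bounded_A: "bounded_operator X X A"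
    and bounded_C: "bounded_operator X Y C"
    and observability: "x \<in> hcarrier X \<Longrightarrow>
      (\<lambda>j. inverse (bweight n j) * (hnorm Y (C ((A ^^ j) x)))\<^sup>2) sums (hnorm X x)\<^sup>2"
begin

sublocale X: hilbert_space X
  by (rule hilbert_X)

lemma A_mem [simp]: "x \<in> hcarrier X \<Longrightarrow> A x \<in> hcarrier X"
  by (rule bounded_operator_mem[OF bounded_A])

lemma C_mem [simp]: "x \<in> hcarrier X \<Longrightarrow> C x \<in> hcarrier Y"
  by (rule bounded_operator_mem[OF bounded_C])

lemma A_pow_bounded: "bounded_operator X X (A ^^ j)"
  by (rule bounded_operator_funpow[OF _ bounded_A]) unfold_locales

lemma A_pow_mem [simp]: "x \<in> hcarrier X \<Longrightarrow> (A ^^ j) x \<in> hcarrier X"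
  by (rule bounded_operator_mem[OF A_pow_bounded])

text \<open>The observability series of A x is that of x without its first term and with smaller
  weights.\<close>

lemma norm_A_le:
  assumes x: "x \<in> hcarrier X"
  shows "hnorm X (A x) \<le> hnorm X x"
proof (rule power2_le_imp_le)
  let ?a = "\<lambda>j. inverse (\<mu> j) * (hnorm Y (C ((A ^^ j) x)))\<^sup>2"
  have "(\<lambda>j. ?a (Suc j)) sums ((hnorm X x)\<^sup>2 - ?a 0)"
    using observability[OF x] by (subst sums_Suc_iff) simp
  with observability[OF A_mem[OF x]] have "(hnorm X (A x))\<^sup>2 \<le> (hnorm X x)\<^sup>2 - ?a 0"
  proof (rule sums_le[rotated])
    show "inverse (\<mu> j) * (hnorm Y (C ((A ^^ j) (A x))))\<^sup>2 \<le> ?a (Suc j)" for j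
      using inverse_bweight_mono[OF n_pos, of j 1] by (simp add: funpow_swap1 mult_right_mono)
  qed
  also have "\<dots> \<le> (hnorm X x)\<^sup>2"
    by simp
  finally show "(hnorm X (A x))\<^sup>2 \<le> (hnorm X x)\<^sup>2" .
qed (use x in simp)

lemma norm_A_pow_le: "x \<in> hcarrier X \<Longrightarrow> hnorm X ((A ^^ j) x) \<le> hnorm X x"
proof (induction j)
  case (Suc j)
  then show ?case
    using norm_A_le[of "(A ^^ j) x"] by simp
qed simp

text \<open>The range of \<open>obs k\<close> is the part of \<open>(S\<^sup>k M)\<^sup>\<bottom>\<close> orthogonal to the polynomials of degree below \<open>k\<close>.\<close>

definition obs :: "nat \<Rightarrow> 'x \<Rightarrow> complex \<Rightarrow> 'y"
  where "obs k x = bfun (\<lambda>i. if i < k then 0 else of_real (inverse (\<mu> i)) *\<^sub>C C ((A ^^ (i - k)) x))"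

lemma inverse_bweight_norm_le:
  "inverse (\<mu> (j + k)) * (hnorm Y y)\<^sup>2 \<le> n ^ k * (inverse (\<mu> j) * (hnorm Y y)\<^sup>2)"
  unfolding mult.assoc[symmetric] using inverse_bweight_le[OF n_pos, of j k] by (intro mult_right_mono) simp_all

lemma obs_norm_summable:
  assumes x: "x \<in> hcarrier X"
  shows "summable (\<lambda>j. inverse (\<mu> (j + k)) * (hnorm Y (C ((A ^^ j) x)))\<^sup>2)"
proof (rule summable_comparison_test')
  show "summable (\<lambda>j. n ^ k * (inverse (\<mu> j) * (hnorm Y (C ((A ^^ j) x)))\<^sup>2))"
    using observability[OF x] by (intro summable_mult) (simp add: sums_iff)
qed (use inverse_bweight_norm_le in simp)

lemma obs_coeff_mem:
  assumes x: "x \<in> hcarrier X"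
  shows "(\<lambda>i. if i < k then 0 else of_real (inverse (\<mu> i)) *\<^sub>C C ((A ^^ (i - k)) x)) \<in> hcarrier (coeff_space n Y)"
    (is "?c \<in> _")
proof -
  have "\<mu> (j + k) * (hnorm Y (?c (j + k)))\<^sup>2 = inverse (\<mu> (j + k)) * (hnorm Y (C ((A ^^ j) x)))\<^sup>2" for j
    using x by (simp add: Y.norm_scale norm_inverse power_mult_distrib power2_eq_square)
  then have "summable (\<lambda>j. \<mu> (j + k) * (hnorm Y (?c (j + k)))\<^sup>2)"
    using obs_norm_summable[OF x, of k] by simp
  then have "summable (\<lambda>j. \<mu> j * (hnorm Y (?c j))\<^sup>2)"
    by (subst (asm) summable_iff_shift)
  then show ?thesis
    using x by (simp add: coeff_space_mem)
qed

lemma obs_mem [simp]: "x \<in> hcarrier X \<Longrightarrow> obs k x \<in> hcarrier \<H>"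
  unfolding obs_def by (intro bfun_mem obs_coeff_mem)

lemma tc_obs:
  "x \<in> hcarrier X \<Longrightarrow>
    tc (obs k x) i = (if i < k then 0 else of_real (inverse (\<mu> i)) *\<^sub>C C ((A ^^ (i - k)) x))"
  unfolding obs_def by (simp only: tc_bfun[OF obs_coeff_mem])

lemma norm_obs_sums:
  assumes x: "x \<in> hcarrier X"
  shows "(\<lambda>j. inverse (\<mu> (j + k)) * (hnorm Y (C ((A ^^ j) x)))\<^sup>2) sums (hnorm \<H> (obs k x))\<^sup>2"
proof -
  have "(\<lambda>j. \<mu> (j + k) * (hnorm Y (tc (obs k x) (j + k)))\<^sup>2) sums (hnorm \<H> (obs k x))\<^sup>2"
    using norm_sums[OF obs_mem[OF x]] x by (subst sums_zero_iff_shift) (auto simp: tc_obs)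
  moreover have "\<mu> (j + k) * (hnorm Y (tc (obs k x) (j + k)))\<^sup>2 =
      inverse (\<mu> (j + k)) * (hnorm Y (C ((A ^^ j) x)))\<^sup>2" for j
    using x by (simp add: tc_obs Y.norm_scale norm_inverse power_mult_distrib power2_eq_square)
  ultimately show ?thesis
    by simp
qed

text \<open>The inverse weights at j + k lie between those at j and n^k times those at j. Together
  with \<open>norm_obs_le\<close> this puts the k-th gramian between the identity and n^k times the
  identity.\<close>

lemma norm_le_obs:
  assumes x: "x \<in> hcarrier X"
  shows "hnorm X x \<le> hnorm \<H> (obs k x)"
proof (rule power2_le_imp_le)
  show "(hnorm X x)\<^sup>2 \<le> (hnorm \<H> (obs k x))\<^sup>2"
    by (rule sums_le[OF _ observability[OF x] norm_obs_sums[OF x]])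
      (intro mult_right_mono inverse_bweight_mono n_pos zero_le_power2)
qed (use x in simp)

lemma norm_obs_le:
  assumes x: "x \<in> hcarrier X"
  shows "hnorm \<H> (obs k x) \<le> sqrt (n ^ k) * hnorm X x"
proof (rule power2_le_imp_le)
  have "(\<lambda>j. n ^ k * (inverse (\<mu> j) * (hnorm Y (C ((A ^^ j) x)))\<^sup>2)) sums (n ^ k * (hnorm X x)\<^sup>2)"
    using observability[OF x] by (rule sums_mult)
  with norm_obs_sums[OF x] have "(hnorm \<H> (obs k x))\<^sup>2 \<le> n ^ k * (hnorm X x)\<^sup>2"
    by (rule sums_le[rotated]) (rule inverse_bweight_norm_le)
  then show "(hnorm \<H> (obs k x))\<^sup>2 \<le> (sqrt (n ^ k) * hnorm X x)\<^sup>2"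
    by (simp add: power_mult_distrib)
qed (use x in simp)

lemma bounded_operator_obs: "bounded_operator X \<H> (obs k)"
proof (rule bounded_operatorI)
  fix x y
  assume xy: "x \<in> hcarrier X" "y \<in> hcarrier X"
  show "obs k (x + y) = obs k x + obs k y"
    using xy by (intro bergman_eqI)
      (auto simp: tc_add tc_obs bounded_operator_add[OF A_pow_bounded] bounded_operator_add[OF bounded_C]
        scaleC_add_right)
next
  fix a x
  assume x: "x \<in> hcarrier X"
  show "obs k (a *\<^sub>C x) = a *\<^sub>C obs k x"
    using x by (intro bergman_eqI)
      (auto simp: tc_scale scaleC_fun_apply tc_obs bounded_operator_scale[OF A_pow_bounded]
        bounded_operator_scale[OF bounded_C] scaleC_scaleC mult.commute)
qed (auto intro: norm_obs_le)

text \<open>The coefficients of \<open>obs k x\<close> carry the inverses of exactly the weights by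
  which the inner product multiplies them, so both sides are the sum of the inner products of C A^j
  x with the j-th coefficient of \<open>g\<close>.\<close>

lemma inner_obs_shift:
  assumes x: "x \<in> hcarrier X" and g: "g \<in> hcarrier \<H>"
  shows "hinner \<H> (obs k x) ((shift ^^ k) g) = hinner \<H> (obs 0 x) g"
proof -
  have "of_real (\<mu> (j + k)) * hinner Y (tc (obs k x) (j + k)) (tc g j) =
      of_real (\<mu> j) * hinner Y (tc (obs 0 x) j) (tc g j)" for j
    using x g by (simp add: tc_obs Y.inner_scale)
  then show ?thesis
    using inner_shift_pow_sums[OF obs_mem[OF x] g, of k k] inner_sums[OF obs_mem[OF x] g, of 0]
    by (simp add: sums_unique2)
qed

text \<open>Applying the adjoint of \<open>obs k\<close> to the monomial expansion of
  \<open>obs k x\<close> produces the gramian series term by term. The series definition then never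
  has to be manipulated again.\<close>

lemma gramian_eq:
  assumes x: "x \<in> hcarrier X"
  shows "gramian n k X Y A C x = hadjoint X \<H> (obs k) (obs k x)"
proof -
  note adj = hilbert_X \<H>.inner_product_space_axioms bounded_operator_obs[of k]
  note adjC = hilbert_X Y.inner_product_space_axioms bounded_C
  have *: "hadjoint X \<H> (obs k) (monomial (j + k) (tc (obs k x) (j + k))) =
      of_nat ((n + j + k - 1) choose (j + k)) *\<^sub>C (hadjoint X X A ^^ j) (hadjoint X Y C (C ((A ^^ j) x)))" for j
  proof (rule hadjoint_eqI)
    have w: "of_nat ((n + j + k - 1) choose (j + k)) = complex_of_real (inverse (\<mu> (j + k)))"
      using of_nat_binomial_bweight[of n "j + k", where ?'a = complex] by (simp add: add.assoc)
    have c: "hadjoint X Y C (C ((A ^^ j) x)) \<in> hcarrier X"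
      using x by (intro hadjoint_mem[OF adjC]) simp
    show "of_nat ((n + j + k - 1) choose (j + k)) *\<^sub>C (hadjoint X X A ^^ j) (hadjoint X Y C (C ((A ^^ j) x)))
        \<in> hcarrier X"
      using inner_hadjoint_pow(2)[OF hilbert_X bounded_A c c] by simp
    fix v
    assume v: "v \<in> hcarrier X"
    show "hinner \<H> (obs k v) (monomial (j + k) (tc (obs k x) (j + k))) =
      hinner X v (of_nat ((n + j + k - 1) choose (j + k)) *\<^sub>C
        (hadjoint X X A ^^ j) (hadjoint X Y C (C ((A ^^ j) x))))"
      using v x inner_hadjoint_pow[OF hilbert_X bounded_A v c, of j] inner_hadjoint[OF adjC, of _ "(A ^^ j) v"]
      unfolding w by (simp add: inner_monomial tc_obs Y.inner_scale Y.inner_scale2 X.inner_scale2)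
  qed unfold_locales
  have "hsums X (\<lambda>j. hadjoint X \<H> (obs k) (monomial (j + k) (tc (obs k x) (j + k))))
      (hadjoint X \<H> (obs k) (obs k x))"
    using x by (intro hsums_bounded_operator[OF _ _ bounded_operator_hadjoint[OF adj]] hsums_monomial_shift)
      (auto simp: tc_obs monomial_eq intro: \<H>.inner_product_space_axioms X.inner_product_space_axioms)
  then show ?thesis
    unfolding gramian_def * by (rule X.hsuminf_eqI)
qed

lemma gramian_mem [simp]: "x \<in> hcarrier X \<Longrightarrow> gramian n k X Y A C x \<in> hcarrier X"
  unfolding gramian_eq
  by (intro hadjoint_mem[OF hilbert_X \<H>.inner_product_space_axioms bounded_operator_obs]) simp

lemma inner_gramian:
  "x \<in> hcarrier X \<Longrightarrow> v \<in> hcarrier X \<Longrightarrow>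
    hinner X v (gramian n k X Y A C x) = hinner \<H> (obs k v) (obs k x)"
  unfolding gramian_eq
  by (intro inner_hadjoint[OF hilbert_X \<H>.inner_product_space_axioms bounded_operator_obs]) simp_all

lemma obs_add: "x \<in> hcarrier X \<Longrightarrow> y \<in> hcarrier X \<Longrightarrow> obs k (x + y) = obs k x + obs k y"
  by (rule bounded_operator_add[OF bounded_operator_obs])

lemma obs_scale: "x \<in> hcarrier X \<Longrightarrow> obs k (a *\<^sub>C x) = a *\<^sub>C obs k x"
  by (rule bounded_operator_scale[OF bounded_operator_obs])

lemma obs_eq_0: "x \<in> hcarrier X \<Longrightarrow> obs k x = 0 \<Longrightarrow> x = 0"
  using norm_le_obs[of x k] X.norm_eq_0_iff[of x] X.norm_nonneg[of x] \<H>.norm_zero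
  by (metis order_antisym)

lemma closed_subspace_obs: "closed_subspace \<H> (obs k ` hcarrier X)"
  by (rule closed_subspace_range[OF hilbert_X hilbert_bergman bounded_operator_obs, where c = 1])
    (simp add: norm_le_obs)

text \<open>Riesz representation with respect to the inner product pulled back by
  \<open>obs k\<close>: it is complete because the range is closed, and its norm dominates that of
  \<open>X\<close>, so pairing with \<open>y\<close> remains bounded.\<close>

lemma gramian_surj:
  assumes y: "y \<in> hcarrier X"
  shows "\<exists>x\<in>hcarrier X. gramian n k X Y A C x = y"
proof -
  let ?K = "\<lparr>hcarrier = hcarrier X, hinner = \<lambda>x y. hinner \<H> (obs k x) (obs k y)\<rparr>"
  interpret K: hilbert_space ?K
    by (rule hilbert_space_pullback[OF hilbert_bergman, where \<phi> = "obs k"])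
      (use X.subspace closed_subspace_obs obs_add obs_scale obs_eq_0 in auto)
  have norm: "hnorm ?K x = hnorm \<H> (obs k x)" for x
    by (simp add: hnorm_def)
  have "\<exists>x\<in>hcarrier ?K. \<forall>v\<in>hcarrier ?K. hinner X v y = hinner ?K v x"
  proof (rule K.Riesz_representation)
    fix v
    assume v: "v \<in> hcarrier ?K"
    have "cmod (hinner X v y) \<le> hnorm X v * hnorm X y"
      using v y by (intro X.Cauchy_Schwarz) auto
    also have "\<dots> \<le> hnorm \<H> (obs k v) * hnorm X y"
      using v y norm_le_obs by (intro mult_right_mono) auto
    finally show "cmod (hinner X v y) \<le> hnorm X y * hnorm ?K v"
      by (simp add: norm mult.commute)
  qed (use y in \<open>auto simp: X.inner_add X.inner_scale\<close>)
  then obtain x where x: "x \<in> hcarrier X" "\<And>v. v \<in> hcarrier X \<Longrightarrow> hinner X v y = hinner \<H> (obs k v) (obs k x)"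
    by auto
  have "gramian n k X Y A C x = y"
    using x y by (intro X.inner_eqI) (auto simp: inner_gramian)
  with x show ?thesis
    by blast
qed

lemma gramian_inv_mem [simp]: "y \<in> hcarrier X \<Longrightarrow> gramian_inv n k X Y A C y \<in> hcarrier X"
  unfolding gramian_inv_def using gramian_surj[of y k] by (intro inv_into_into) auto

text \<open>\<open>gramian_inv\<close> enters only as a right inverse, for which surjectivity
  suffices.\<close>

lemma inner_obs_gramian_inv:
  assumes "y \<in> hcarrier X" "v \<in> hcarrier X"
  shows "hinner \<H> (obs k v) (obs k (gramian_inv n k X Y A C y)) = hinner X v y"
proof -
  have "gramian n k X Y A C (gramian_inv n k X Y A C y) = y"
    unfolding gramian_inv_def using gramian_surj[OF assms(1), of k] by (intro f_inv_into_f) auto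
  then show ?thesis
    using inner_gramian[of "gramian_inv n k X Y A C y" v k] assms by simp
qed

end

text \<open>The preimage of \<open>L\<close> is a closed subspace containing \<open>S\<close>, hence
  contains its closed span.\<close>

lemma closed_span_image:
  assumes H: "inner_product_space H" and K: "inner_product_space K" and T: "bounded_operator H K T"
    and S: "S \<subseteq> hcarrier H" and L: "closed_subspace K L" and sub: "T ` S \<subseteq> L"
  shows "T ` closed_span H S \<subseteq> L"
proof -
  interpret H: inner_product_space H
    by (rule H)
  interpret K: inner_product_space K
    by (rule K)
  note mem = bounded_operator_mem[OF T]
  have L': "complex_vector.subspace L"
    using L by (simp add: closed_subspace_def)
  have "closed_subspace H {x \<in> hcarrier H. T x \<in> L}"
  proof (rule H.closed_subspaceI)
    show "complex_vector.subspace {x \<in> hcarrier H. T x \<in> L}"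
      using bounded_operator_zero[OF T H.zero_mem] complex_vector.subspace_0[OF L']
        complex_vector.subspace_add[OF L'] complex_vector.subspace_scale[OF L']
      by (intro complex_vector.subspaceI)
        (auto simp: bounded_operator_add[OF T] bounded_operator_scale[OF T])
    fix f l
    assume f: "\<And>n. f n \<in> {x \<in> hcarrier H. T x \<in> L}" and l: "l \<in> hcarrier H"
      and lim: "(\<lambda>n. hnorm H (f n - l)) \<longlonglongrightarrow> 0"
    have fH: "f n \<in> hcarrier H" and fL: "T (f n) \<in> L" for n
      using f by auto
    have "T l \<in> L"
      by (rule K.closed_subspace_limit[OF L fL mem[OF l] tendsto_bounded_operator[OF H K T fH l lim]])
    with l show "l \<in> {x \<in> hcarrier H. T x \<in> L}"
      by simp
  qed auto
  then have "closed_span H S \<subseteq> {x \<in> hcarrier H. T x \<in> L}"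
    by (rule H.closed_span_minimal) (use S sub in auto)
  then show ?thesis
    by auto
qed

subsection \<open>Shift-invariant subspaces\<close>

context bergman_space
begin

definition wandering :: "(complex \<Rightarrow> 'y) set \<Rightarrow> nat \<Rightarrow> (complex \<Rightarrow> 'y) set"
  where "wandering M k = (shift ^^ k) ` M \<inter> orth_compl \<H> ((shift ^^ Suc k) ` M)"

context
  fixes M
  assumes M: "closed_subspace \<H> M" and invariant: "shift ` M \<subseteq> M"
begin

lemma invariant_mem: "f \<in> M \<Longrightarrow> f \<in> hcarrier \<H>"
  using M by (auto simp: closed_subspace_def)

text \<open>The shift power restricted to \<open>M\<close> is bounded below, so its range is
  closed.\<close>

lemma closed_subspace_shift_pow: "closed_subspace \<H> ((shift ^^ k) ` M)"
proof -
  have "bounded_operator (hsubspace \<H> M) \<H> (shift ^^ k)"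
    using bounded_operator_shift_pow[of k] invariant_mem
    unfolding bounded_operator_def by simp blast
  moreover have "hnorm \<H> f \<le> sqrt (n ^ k) * hnorm \<H> ((shift ^^ k) f)" if "f \<in> M" for f
  proof (rule power2_le_imp_le)
    show "(hnorm \<H> f)\<^sup>2 \<le> (sqrt (n ^ k) * hnorm \<H> ((shift ^^ k) f))\<^sup>2"
      using norm_le_shift_pow[OF invariant_mem[OF that], of k] by (simp add: power_mult_distrib)
  qed (use invariant_mem[OF that] in simp)
  ultimately show ?thesis
    using closed_subspace_range[OF \<H>.hilbert_hsubspace[OF M] hilbert_bergman, of "shift ^^ k" "sqrt (n ^ k)"]
    by simp
qed

lemma shift_pow_invariant: "f \<in> M \<Longrightarrow> (shift ^^ k) f \<in> M"
  using invariant by (induction k) auto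

lemma shift_pow_antimono:
  assumes "k \<le> l"
  shows "(shift ^^ l) ` M \<subseteq> (shift ^^ k) ` M"
proof -
  have "(shift ^^ l) f = (shift ^^ k) ((shift ^^ (l - k)) f)" for f :: "complex \<Rightarrow> 'y"
    using assms by (metis comp_apply funpow_add le_add_diff_inverse)
  then show ?thesis
    using shift_pow_invariant by (metis image_eqI image_subsetI)
qed

lemma shift_pow_image_mem: "f \<in> (shift ^^ k) ` M \<Longrightarrow> f \<in> hcarrier \<H>"
  using invariant_mem by auto

lemma wandering_mem: "f \<in> wandering M k \<Longrightarrow> f \<in> hcarrier \<H>"
  by (auto simp: wandering_def orth_compl_def)

lemma closed_subspace_wandering: "closed_subspace \<H> (wandering M k)"
  unfolding wandering_def
  by (intro \<H>.closed_subspace_inter closed_subspace_shift_pow \<H>.closed_subspace_orth_compl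
      subsetI shift_pow_image_mem)

lemma wandering_subset: "k \<le> l \<Longrightarrow> wandering M l \<subseteq> (shift ^^ k) ` M"
  using shift_pow_antimono[of k l] by (auto simp: wandering_def)

lemma wandering_orthogonal_shift: "f \<in> wandering M k \<Longrightarrow> k < l \<Longrightarrow> g \<in> (shift ^^ l) ` M \<Longrightarrow> hinner \<H> f g = 0"
  using shift_pow_antimono[of "Suc k" l] by (auto simp: wandering_def orth_compl_def)

lemma wandering_orthogonal:
  assumes "f \<in> wandering M k" "g \<in> wandering M l" "k \<noteq> l"
  shows "hinner \<H> f g = 0"
proof (cases "k < l")
  case True
  then show ?thesis
    using assms wandering_subset[of l l] by (intro wandering_orthogonal_shift[of f k l]) auto
next
  case False
  then have "hinner \<H> g f = 0"
    using assms wandering_subset[of k k] by (intro wandering_orthogonal_shift[of g l k]) auto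
  then show ?thesis
    using assms wandering_mem \<H>.inner_eq_0_commute by blast
qed

text \<open>A vector orthogonal to all E_k with k >= N is pushed by induction into every S^(N+j) M.
  All of its Taylor coefficients then vanish.\<close>

lemma wandering_total:
  assumes f: "f \<in> (shift ^^ N) ` M"
    and o: "\<And>k v. N \<le> k \<Longrightarrow> v \<in> wandering M k \<Longrightarrow> hinner \<H> v f = 0"
  shows "f = 0"
proof -
  have fH: "f \<in> hcarrier \<H>"
    using f by (rule shift_pow_image_mem)
  have pow: "f \<in> (shift ^^ (N + j)) ` M" for j
  proof (induction j)
    case (Suc j)
    let ?k = "N + j"
    obtain p where p: "p \<in> (shift ^^ Suc ?k) ` M" "\<forall>m\<in>(shift ^^ Suc ?k) ` M. hinner \<H> m (f - p) = 0"
      using \<H>.projection[OF closed_subspace_shift_pow fH] by blast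
    have pH: "p \<in> hcarrier \<H>"
      using p(1) by (rule shift_pow_image_mem)
    have "p \<in> (shift ^^ ?k) ` M"
      using p(1) shift_pow_antimono[of ?k "Suc ?k"] by auto
    then have r: "f - p \<in> (shift ^^ ?k) ` M"
      using Suc closed_subspace_shift_pow[of ?k]
      by (auto simp: closed_subspace_def intro: complex_vector.subspace_diff)
    have "f - p \<in> orth_compl \<H> ((shift ^^ Suc ?k) ` M)"
      unfolding orth_compl_def using p(2) fH pH shift_pow_image_mem[of _ "Suc ?k"]
        \<H>.inner_eq_0_commute[of "f - p"] by auto
    with r have W: "f - p \<in> wandering M ?k"
      by (simp add: wandering_def)
    \<comment> \<open>The residual is orthogonal to \<open>f\<close> by hypothesis, since it lies in
      E_k, and to \<open>p\<close>, since \<open>p\<close> lies in S^(k+1) M; so it is orthogonal to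
      itself.\<close>
    have "hinner \<H> (f - p) f = 0" "hinner \<H> (f - p) p = 0"
      using o[OF _ W] wandering_orthogonal_shift[OF W _ p(1)] by simp_all
    then have "f - p = 0"
      using fH pH by (intro \<H>.inner_self_eq_0D) (simp_all add: \<H>.inner_diff_right)
    with p(1) show ?case
      by simp
  qed (use f in simp)
  show ?thesis
  proof (rule bergman_eqI[OF fH])
    fix j
    have "f \<in> (shift ^^ Suc j) ` M"
      using pow[of "Suc j"] shift_pow_antimono[of "Suc j" "N + Suc j"] by auto
    then show "tc f j = tc 0 j"
      using invariant_mem by (auto simp: tc_shift_pow simp del: funpow.simps)
  qed simp
qed

lemma shift_pow_image_eq: "(shift ^^ N) ` M = closed_span \<H> (\<Union>k\<in>{N..}. wandering M k)"
proof (rule \<H>.closed_subspace_eqI)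
  have sub: "(\<Union>k\<in>{N..}. wandering M k) \<subseteq> hcarrier \<H>"
    using wandering_mem by auto
  then show "closed_subspace \<H> (closed_span \<H> (\<Union>k\<in>{N..}. wandering M k))"
    by (rule \<H>.closed_subspace_closed_span)
  show "(shift ^^ N) ` M \<subseteq> hcarrier \<H>" "complex_vector.subspace ((shift ^^ N) ` M)"
    using closed_subspace_shift_pow[of N] by (auto simp: closed_subspace_def)
  show "closed_span \<H> (\<Union>k\<in>{N..}. wandering M k) \<subseteq> (shift ^^ N) ` M"
    using wandering_subset by (intro \<H>.closed_span_minimal closed_subspace_shift_pow) blast
  fix f
  assume f: "f \<in> (shift ^^ N) ` M"
    and o: "\<And>v. v \<in> closed_span \<H> (\<Union>k\<in>{N..}. wandering M k) \<Longrightarrow> hinner \<H> v f = 0"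
  show "f = 0"
  proof (rule wandering_total[OF f])
    fix k v
    assume "N \<le> k" "v \<in> wandering M k"
    then show "hinner \<H> v f = 0"
      using \<H>.closed_span_superset[OF sub] by (intro o) auto
  qed
qed

end

end

subsection \<open>Orthogonal families of isometric multipliers\<close>

lemma monomial_inject: "monomial k u = monomial k v \<Longrightarrow> u = v"
proof -
  assume "monomial k u = monomial k v"
  then have "monomial k u (1/2) = monomial k v (1/2)"
    by simp
  then have "(1/2) ^ k *\<^sub>C u = (1/2) ^ k *\<^sub>C v"
    by (simp add: monomial_def norm_divide)
  then show "u = v"
    by (simp add: complex_vector.scale_left_imp_eq)
qed

lemma hnorm_shifted_space: "u \<in> hcarrier U \<Longrightarrow> hnorm (shifted_space k U) (monomial k u) = hnorm U u"
proof -
  assume u: "u \<in> hcarrier U"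
  have "inj_on (monomial k) (hcarrier U)"
    by (rule inj_onI) (rule monomial_inject)
  with u show ?thesis
    by (simp add: hnorm_def shifted_space_def)
qed

lemma hcarrier_shifted_space: "hcarrier (shifted_space k U) = monomial k ` hcarrier U"
  by (simp add: shifted_space_def)

lemma monomial_add: "monomial k (u + v) = monomial k u + monomial k v"
  by (simp add: monomial_def fun_eq_iff scaleC_add_right)

lemma monomial_scale: "monomial k (a *\<^sub>C u) = a *\<^sub>C monomial k u"
  by (simp add: monomial_def fun_eq_iff scaleC_fun_apply scaleC_scaleC mult.commute)

lemma mult_op_monomial:
  assumes "inner_product_space U" "\<And>z. cmod z < 1 \<Longrightarrow> bounded_operator U Y (\<theta> z)" "u \<in> hcarrier U"
  shows "mult_op \<theta> (monomial k u) z = (if cmod z < 1 then z ^ k *\<^sub>C \<theta> z u else 0)"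
  using bounded_operator_scale[OF assms(2,3)] by (simp add: mult_op_def monomial_def)

lemma shift_mult_op_monomial:
  assumes "inner_product_space U" "\<And>z. cmod z < 1 \<Longrightarrow> bounded_operator U Y (\<theta> z)" "u \<in> hcarrier U"
  shows "(shift ^^ j) (mult_op \<theta> (monomial k u)) = mult_op \<theta> (monomial (j + k) u)"
proof (induction j)
  case (Suc j)
  have "shift (mult_op \<theta> (monomial (j + k) u)) = mult_op \<theta> (monomial (Suc (j + k)) u)"
    by (simp add: fun_eq_iff shift_def mult_op_monomial[OF assms] scaleC_scaleC)
  with Suc show ?case
    by simp
qed simp

text \<open>Isolates what the image of the row operator depends on. Orthogonality is required for
  all k and l that differ, whereas the definition of a Bergman-inner family gives it from k to later
  indices.\<close>

locale isometric_family = bergman_space n Y for n and Y :: "'y::complex_vector hspace" +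
  fixes U :: "nat \<Rightarrow> 'u::complex_vector hspace" and \<Theta> :: "nat \<Rightarrow> complex \<Rightarrow> 'u \<Rightarrow> 'y"
  assumes hilbert_U: "hilbert_space (U k)"
    and bounded_Theta: "cmod z < 1 \<Longrightarrow> bounded_operator (U k) Y (\<Theta> k z)"
    and multiplier_mem: "u \<in> hcarrier (U k) \<Longrightarrow> mult_op (\<Theta> k) (monomial k u) \<in> hcarrier (bergman n Y)"
    and multiplier_norm:
      "u \<in> hcarrier (U k) \<Longrightarrow> hnorm (bergman n Y) (mult_op (\<Theta> k) (monomial k u)) = hnorm (U k) u"
    and multiplier_orthogonal: "k \<noteq> l \<Longrightarrow> u \<in> hcarrier (U k) \<Longrightarrow> v \<in> hcarrier (U l) \<Longrightarrow>
      hinner (bergman n Y) (mult_op (\<Theta> k) (monomial k u)) (mult_op (\<Theta> l) (monomial l v)) = 0"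
begin

sublocale U: hilbert_space "U k"
  by (rule hilbert_U)

definition summand :: "nat \<Rightarrow> (complex \<Rightarrow> 'y) set"
  where "summand k = mult_op (\<Theta> k) ` hcarrier (shifted_space k (U k))"

lemma summand_eq: "summand k = (\<lambda>u. mult_op (\<Theta> k) (monomial k u)) ` hcarrier (U k)"
  by (simp add: summand_def hcarrier_shifted_space image_image)

lemma summand_mem: "f \<in> summand k \<Longrightarrow> f \<in> hcarrier \<H>"
  by (auto simp: summand_eq multiplier_mem)

lemma summand_orthogonal: "k \<noteq> l \<Longrightarrow> f \<in> summand k \<Longrightarrow> g \<in> summand l \<Longrightarrow> hinner \<H> f g = 0"
  by (auto simp: summand_eq multiplier_orthogonal)

lemma bounded_operator_multiplier: "bounded_operator (U k) \<H> (\<lambda>u. mult_op (\<Theta> k) (monomial k u))"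
proof (rule bounded_operatorI[where c = 1])
  note m = mult_op_monomial[OF U.inner_product_space_axioms bounded_Theta]
  show "mult_op (\<Theta> k) (monomial k (u + v)) = mult_op (\<Theta> k) (monomial k u) + mult_op (\<Theta> k) (monomial k v)"
    if "u \<in> hcarrier (U k)" "v \<in> hcarrier (U k)" for u v
    using that by (simp add: fun_eq_iff m bounded_operator_add[OF bounded_Theta] scaleC_add_right)
  show "mult_op (\<Theta> k) (monomial k (a *\<^sub>C u)) = a *\<^sub>C mult_op (\<Theta> k) (monomial k u)"
    if "u \<in> hcarrier (U k)" for a u
    using that by (simp add: fun_eq_iff m bounded_operator_scale[OF bounded_Theta] scaleC_scaleC
        scaleC_fun_apply mult.commute)
qed (simp_all add: multiplier_mem multiplier_norm)

lemma isometric_operator_multiplier: "isometric_operator (shifted_space k (U k)) \<H> (mult_op (\<Theta> k))"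
proof -
  note T = bounded_operator_multiplier[of k]
  have "bounded_operator (shifted_space k (U k)) \<H> (mult_op (\<Theta> k))"
    by (rule bounded_operatorI[where c = 1])
      (auto simp: hcarrier_shifted_space multiplier_mem multiplier_norm hnorm_shifted_space
        bounded_operator_add[OF T] bounded_operator_scale[OF T] simp flip: monomial_add monomial_scale)
  then show ?thesis
    by (auto simp: isometric_operator_def hcarrier_shifted_space multiplier_norm hnorm_shifted_space)
qed

lemma closed_subspace_summand: "closed_subspace \<H> (summand k)"
  unfolding summand_eq
  by (rule closed_subspace_range[OF hilbert_U hilbert_bergman bounded_operator_multiplier, where c = 1])
    (simp add: multiplier_norm)

text \<open>Condition (iii) speaks of powers of the shift applied to Theta_k on constants,
  conditions (i) and (ii) of Theta_k on z^k u; this identifies the two descriptions.\<close>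

lemma summand_eq_shift:
  "(shift ^^ k) ` mult_op (\<Theta> k) ` hcarrier (shifted_space 0 (U k)) = summand k"
  unfolding summand_eq hcarrier_shifted_space image_image
  by (rule image_cong)
    (simp_all add: shift_mult_op_monomial[OF U.inner_product_space_axioms bounded_Theta])

lemma tv_hardy_mem:
  "h \<in> hcarrier (tv_hardy U) \<longleftrightarrow> (\<exists>u. (\<forall>k. u k \<in> hcarrier (U k)) \<and>
    h = (\<lambda>k. monomial k (u k)) \<and> summable (\<lambda>k. (hnorm (U k) (u k))\<^sup>2))"
proof -
  have "(\<forall>k. h k \<in> monomial k ` hcarrier (U k)) \<longleftrightarrow>
      (\<exists>u. (\<forall>k. u k \<in> hcarrier (U k)) \<and> h = (\<lambda>k. monomial k (u k)))"
    by (simp add: image_iff fun_eq_iff[of h] Bex_def choice_iff) blast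
  then have "h \<in> hcarrier (tv_hardy U) \<longleftrightarrow>
      (\<exists>u. (\<forall>k. u k \<in> hcarrier (U k)) \<and> h = (\<lambda>k. monomial k (u k))) \<and>
      summable (\<lambda>k. (hnorm (shifted_space k (U k)) (h k))\<^sup>2)"
    unfolding tv_hardy_def hcarrier_hdirect_sum hcarrier_shifted_space by simp
  also have "\<dots> \<longleftrightarrow> (\<exists>u. (\<forall>k. u k \<in> hcarrier (U k)) \<and>
      h = (\<lambda>k. monomial k (u k)) \<and> summable (\<lambda>k. (hnorm (U k) (u k))\<^sup>2))"
    unfolding ex_simps(1)[symmetric] by (rule ex_cong1) (auto simp: hnorm_shifted_space)
  finally show ?thesis .
qed

text \<open>Orthogonal isometric summands turn square-summable data into convergent series and
  conversely, so the range is already closed.\<close>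

lemma row_mult_op_image:
  "row_mult_op n Y \<Theta> ` hcarrier (tv_hardy U) = closed_span \<H> (\<Union>k. summand k)"
proof
  have sub: "(\<Union>k. summand k) \<subseteq> hcarrier \<H>"
    using summand_mem by auto
  note K = \<H>.closed_subspace_closed_span[OF sub]
  show "row_mult_op n Y \<Theta> ` hcarrier (tv_hardy U) \<subseteq> closed_span \<H> (\<Union>k. summand k)"
  proof (rule image_subsetI)
    fix h
    assume "h \<in> hcarrier (tv_hardy U)"
    then obtain u where u: "\<And>k. u k \<in> hcarrier (U k)" and h: "h = (\<lambda>k. monomial k (u k))"
      and s: "summable (\<lambda>k. (hnorm (U k) (u k))\<^sup>2)"
      unfolding tv_hardy_mem by blast
    let ?e = "\<lambda>k. mult_op (\<Theta> k) (monomial k (u k))"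
    obtain f where f: "hsums \<H> ?e f"
      using \<H>.hsums_orthogonal[of ?e] u s
      by (auto simp: multiplier_mem multiplier_norm multiplier_orthogonal)
    have e: "?e k \<in> summand k" for k
      using u by (auto simp: summand_eq)
    have "f \<in> closed_span \<H> (\<Union>k. summand k)"
      using \<H>.closed_span_superset[OF sub] e by (intro \<H>.closed_subspace_hsums[OF K _ f]) blast
    then show "row_mult_op n Y \<Theta> h \<in> closed_span \<H> (\<Union>k. summand k)"
      by (simp add: row_mult_op_def h \<H>.hsuminf_eqI[OF f])
  qed
  show "closed_span \<H> (\<Union>k. summand k) \<subseteq> row_mult_op n Y \<Theta> ` hcarrier (tv_hardy U)"
  proof
    fix f
    assume f: "f \<in> closed_span \<H> (\<Union>k. summand k)"
    then have fH: "f \<in> hcarrier \<H>"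
      using K by (auto simp: closed_subspace_def)
    obtain e s where e: "\<And>k. e k \<in> summand k" "summable (\<lambda>k. (hnorm \<H> (e k))\<^sup>2)" "hsums \<H> e s"
      "\<And>k v. v \<in> summand k \<Longrightarrow> hinner \<H> v (f - s) = 0"
      using \<H>.orthogonal_expansion[of summand f] closed_subspace_summand summand_orthogonal fH
      by metis
    have sK: "s \<in> closed_span \<H> (\<Union>k. summand k)"
      using \<H>.closed_span_superset[OF sub] e(1) by (intro \<H>.closed_subspace_hsums[OF K _ e(3)]) blast
    then have fs: "f - s \<in> closed_span \<H> (\<Union>k. summand k)" and sH: "s \<in> hcarrier \<H>"
      using f K by (auto simp: closed_subspace_def intro: complex_vector.subspace_diff)
    have fo: "hinner \<H> (f - s) v = 0" if "v \<in> (\<Union>k. summand k)" for v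
    proof -
      from that obtain k where k: "v \<in> summand k"
        by blast
      show ?thesis
        using e(4)[OF k] summand_mem[OF k] fH sH \<H>.inner_eq_0_commute[of v "f - s"] by simp
    qed
    \<comment> \<open>The residual of the expansion lies in the closed span of the summands and is
      orthogonal to each of them.\<close>
    have "hinner \<H> (f - s) (f - s) = 0"
      by (rule \<H>.orthogonal_closed_span[OF sub _ fo fs]) (use fH sH in simp)
    then have "f = s"
      using \<H>.inner_self_eq_0D[of "f - s"] fH sH by simp
    have "\<forall>k. \<exists>u. u \<in> hcarrier (U k) \<and> e k = mult_op (\<Theta> k) (monomial k u)"
      using e(1) by (auto simp: summand_eq)
    then obtain u where u: "\<And>k. u k \<in> hcarrier (U k)" "\<And>k. e k = mult_op (\<Theta> k) (monomial k (u k))"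
      by metis
    have "(\<lambda>k. monomial k (u k)) \<in> hcarrier (tv_hardy U)"
      unfolding tv_hardy_mem using u e(2) by (auto simp: multiplier_norm)
    moreover have "row_mult_op n Y \<Theta> (\<lambda>k. monomial k (u k)) = f"
      unfolding row_mult_op_def u(2)[symmetric] \<open>f = s\<close> by (rule \<H>.hsuminf_eqI[OF e(3)])
    ultimately show "f \<in> row_mult_op n Y \<Theta> ` hcarrier (tv_hardy U)"
      by force
  qed
qed

end

text \<open>Once each multiplier is isometric onto E_k, the closed span of the summands of index at
  least j is S^j M. Conditions (ii) and (iii) become the orthogonality of E_k to S^(k+1) M and the
  inclusion of S E_k in S^(k+1) M.\<close>

lemma (in bergman_space) bergman_inner_familyI:
  fixes U :: "nat \<Rightarrow> 'u::complex_vector hspace"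
  assumes M: "closed_subspace \<H> M" and invariant: "shift ` M \<subseteq> M"
    and U: "\<And>k. hilbert_space (U k)"
    and bounded: "\<And>k z. cmod z < 1 \<Longrightarrow> bounded_operator (U k) Y (\<Theta> k z)"
    and norm: "\<And>k u. u \<in> hcarrier (U k) \<Longrightarrow> hnorm \<H> (mult_op (\<Theta> k) (monomial k u)) = hnorm (U k) u"
    and wandering: "\<And>k. (\<lambda>u. mult_op (\<Theta> k) (monomial k u)) ` hcarrier (U k) = wandering M k"
    and mem: "\<And>k u. u \<in> hcarrier (U k) \<Longrightarrow> mult_op (\<Theta> k) (monomial 0 u) \<in> hcarrier \<H>"
  shows "bergman_inner_family n Y U \<Theta>" "M = row_mult_op n Y \<Theta> ` hcarrier (tv_hardy U)"
proof -
  interpret isometric_family n Y U \<Theta>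
  proof (rule isometric_family.intro[OF bergman_space_axioms], rule isometric_family_axioms.intro)
    show "mult_op (\<Theta> k) (monomial k u) \<in> hcarrier \<H>" if "u \<in> hcarrier (U k)" for k u
      using wandering[of k] that wandering_mem[OF M invariant, of _ k] by auto
    show "hinner \<H> (mult_op (\<Theta> k) (monomial k u)) (mult_op (\<Theta> l) (monomial l v)) = 0"
      if "k \<noteq> l" "u \<in> hcarrier (U k)" "v \<in> hcarrier (U l)" for k l u v
      using wandering[of k] wandering[of l] that
      by (intro wandering_orthogonal[OF M invariant, of _ k _ l]) auto
  qed (use U bounded norm in auto)
  have s: "summand k = wandering M k" for k
    by (simp add: summand_eq wandering)
  have N: "(shift ^^ j) ` M = closed_span \<H> (\<Union>k\<in>{j..}. summand k)" for j
    unfolding s by (rule shift_pow_image_eq[OF M invariant])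
  from N[of 0] show "M = row_mult_op n Y \<Theta> ` hcarrier (tv_hardy U)"
    by (simp add: row_mult_op_image)
  have Suc: "{k<..} = {Suc k..}" for k :: nat
    by auto
  have orthogonal: "horthogonal \<H> (mult_op (\<Theta> k) ` hcarrier (shifted_space k (U k)))
        (closed_span \<H> (\<Union>l\<in>{k<..}. mult_op (\<Theta> l) ` hcarrier (shifted_space l (U l))))" for k
    unfolding summand_def[symmetric] Suc N[symmetric] unfolding horthogonal_def s
    using wandering_orthogonal_shift[OF M invariant, of _ k "Suc k"] by auto
  have shift: "(shift ^^ Suc k) ` mult_op (\<Theta> k) ` hcarrier (shifted_space 0 (U k))
        \<subseteq> closed_span \<H> (\<Union>l\<in>{k<..}. (shift ^^ l) ` mult_op (\<Theta> l) ` hcarrier (shifted_space 0 (U l)))" for k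
  proof -
    have "(shift ^^ Suc k) ` mult_op (\<Theta> k) ` hcarrier (shifted_space 0 (U k)) = shift ` summand k"
      unfolding summand_eq_shift[symmetric] by (simp add: image_image)
    also have "\<dots> \<subseteq> shift ` (shift ^^ k) ` M"
      unfolding s by (auto simp: wandering_def)
    also have "\<dots> = (shift ^^ Suc k) ` M"
      by (simp add: image_image)
    finally show ?thesis
      unfolding summand_eq_shift Suc N .
  qed
  have constants: "mult_op (\<Theta> k) ` hcarrier (shifted_space 0 (U k)) \<subseteq> hcarrier \<H>" for k
    using mem by (auto simp: hcarrier_shifted_space)
  show "bergman_inner_family n Y U \<Theta>"
    unfolding bergman_inner_family_def
    by (intro allI conjI impI U bounded isometric_operator_multiplier constants orthogonal shift)
qed

text \<open>Condition (iii) makes the shift map each tail into the next one, so S^k M lies in the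
  k-th tail. The hypothesis \<open>sub\<close> gives the reverse inclusion, and comparing successive
  tails isolates E_k.\<close>

lemma (in bergman_space) bergman_inner_familyD:
  fixes U :: "nat \<Rightarrow> 'u::complex_vector hspace"
  assumes family: "bergman_inner_family n Y U \<Theta>"
    and M_def: "M = row_mult_op n Y \<Theta> ` hcarrier (tv_hardy U)"
    and sub: "\<And>k. mult_op (\<Theta> k) ` hcarrier (shifted_space 0 (U k)) \<subseteq> M"
  shows "closed_subspace \<H> M" "shift ` M \<subseteq> M"
    "u \<in> hcarrier (U k) \<Longrightarrow> hnorm \<H> (mult_op (\<Theta> k) (monomial k u)) = hnorm (U k) u"
    "(\<lambda>u. mult_op (\<Theta> k) (monomial k u)) ` hcarrier (U k) = wandering M k"
proof -
  have U: "hilbert_space (U k)"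
    and bounded: "cmod z < 1 \<Longrightarrow> bounded_operator (U k) Y (\<Theta> k z)"
    and iso: "isometric_operator (shifted_space k (U k)) \<H> (mult_op (\<Theta> k))"
    and orth: "horthogonal \<H> (mult_op (\<Theta> k) ` hcarrier (shifted_space k (U k)))
        (closed_span \<H> (\<Union>l\<in>{k<..}. mult_op (\<Theta> l) ` hcarrier (shifted_space l (U l))))"
    and inv: "(shift ^^ Suc k) ` mult_op (\<Theta> k) ` hcarrier (shifted_space 0 (U k))
        \<subseteq> closed_span \<H> (\<Union>l\<in>{k<..}. (shift ^^ l) ` mult_op (\<Theta> l) ` hcarrier (shifted_space 0 (U l)))"
    for k z
    using family by (auto simp: bergman_inner_family_def)
  show norm: "hnorm \<H> (mult_op (\<Theta> k) (monomial k u)) = hnorm (U k) u" if "u \<in> hcarrier (U k)" for k u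
    using iso[of k] that by (auto simp: isometric_operator_def hcarrier_shifted_space hnorm_shifted_space)
  have mem: "mult_op (\<Theta> k) (monomial k u) \<in> hcarrier \<H>" if "u \<in> hcarrier (U k)" for k u
    using iso[of k] that by (auto simp: isometric_operator_def bounded_operator_def hcarrier_shifted_space)
  have less: "hinner \<H> (mult_op (\<Theta> k) (monomial k u)) (mult_op (\<Theta> l) (monomial l v)) = 0"
    if "k < l" "u \<in> hcarrier (U k)" "v \<in> hcarrier (U l)" for k l u v
  proof -
    let ?S = "\<Union>l\<in>{k<..}. mult_op (\<Theta> l) ` hcarrier (shifted_space l (U l))"
    have "?S \<subseteq> hcarrier \<H>"
      using mem by (auto simp: hcarrier_shifted_space)
    then have "?S \<subseteq> closed_span \<H> ?S"
      by (rule \<H>.closed_span_superset)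
    moreover have "mult_op (\<Theta> l) (monomial l v) \<in> ?S"
      using that by (auto simp: hcarrier_shifted_space)
    ultimately show ?thesis
      using orth[of k] that(2) by (auto simp: horthogonal_def hcarrier_shifted_space)
  qed
  interpret isometric_family n Y U \<Theta>
  proof (rule isometric_family.intro[OF bergman_space_axioms], rule isometric_family_axioms.intro)
    show "hinner \<H> (mult_op (\<Theta> k) (monomial k u)) (mult_op (\<Theta> l) (monomial l v)) = 0"
      if "k \<noteq> l" "u \<in> hcarrier (U k)" "v \<in> hcarrier (U l)" for k l u v
      using less[of k l u v] less[of l k v u] that mem \<H>.inner_eq_0_commute
      by (cases "k < l") auto
  qed (use U bounded norm mem in auto)
  \<comment> \<open>The tails of the family; they turn out to be the spaces S^k M.\<close>
  define N where "N k = closed_span \<H> (\<Union>l\<in>{k..}. summand l)" for k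
  have N_sub: "(\<Union>l\<in>{k..}. summand l) \<subseteq> hcarrier \<H>" for k
    using summand_mem by auto
  have N: "closed_subspace \<H> (N k)" for k
    unfolding N_def by (rule \<H>.closed_subspace_closed_span[OF N_sub])
  have summand_N: "summand l \<subseteq> N k" if "k \<le> l" for k l
    unfolding N_def using \<H>.closed_span_superset[OF N_sub[of k]] that by auto
  have N_mono: "N l \<subseteq> N k" if "k \<le> l" for k l
  proof -
    have "closed_span \<H> (\<Union>i\<in>{l..}. summand i) \<subseteq> N k"
      by (intro \<H>.closed_span_minimal N UN_least summand_N) (use that in auto)
    then show ?thesis
      by (simp add: N_def)
  qed
  have M_N: "M = N 0"
    by (simp add: M_def row_mult_op_image N_def)
  with N show M: "closed_subspace \<H> M"
    by simp
  have "shift ` summand k \<subseteq> N (Suc k)" for k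
  proof -
    have "{k<..} = {Suc k..}"
      by auto
    moreover have "(shift ^^ Suc k) ` mult_op (\<Theta> k) ` hcarrier (shifted_space 0 (U k)) = shift ` summand k"
      unfolding summand_eq_shift[symmetric] by (simp add: image_image)
    ultimately show ?thesis
      using inv[of k] unfolding summand_eq_shift N_def by simp
  qed
  then have "shift ` (\<Union>l\<in>{k..}. summand l) \<subseteq> N (Suc k)" for k
    using N_mono[of "Suc k" "Suc _"] by fastforce
  then have shift_N: "shift ` N k \<subseteq> N (Suc k)" for k
    unfolding N_def[of k]
    by (intro closed_span_image[OF \<H>.inner_product_space_axioms \<H>.inner_product_space_axioms
          bounded_operator_shift N_sub N])
  from shift_N[of 0] N_mono[of 0 1] show invariant: "shift ` M \<subseteq> M"
    by (simp add: M_N)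
  have "(shift ^^ k) ` M \<subseteq> N k" for k
  proof (induction k)
    case (Suc k)
    then have "shift ` (shift ^^ k) ` M \<subseteq> N (Suc k)"
      using shift_N[of k] by blast
    then show ?case
      by (simp add: image_image)
  qed (simp add: M_N)
  \<comment> \<open>The l-th summand is S^l applied to the functions Theta_l u, which lie in
    \<open>M\<close> by \<open>sub\<close>.\<close>
  moreover have summand_pow: "summand l \<subseteq> (shift ^^ k) ` M" if "k \<le> l" for k l
  proof -
    have "summand l \<subseteq> (shift ^^ l) ` M"
      unfolding summand_eq_shift[symmetric] using sub by (rule image_mono)
    also have "\<dots> \<subseteq> (shift ^^ k) ` M"
      by (rule shift_pow_antimono[OF M invariant that])
    finally show ?thesis .
  qed
  then have "N k \<subseteq> (shift ^^ k) ` M" for k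
    unfolding N_def by (intro \<H>.closed_span_minimal closed_subspace_shift_pow[OF M invariant]) auto
  ultimately have pow: "(shift ^^ k) ` M = N k" for k
    by blast
  have W_sub: "summand k \<subseteq> wandering M k"
  proof
    fix f
    assume f: "f \<in> summand k"
    have "hinner \<H> f g = 0" if "g \<in> N (Suc k)" for g
    proof (rule \<H>.orthogonal_closed_span[OF N_sub summand_mem[OF f] _ that[unfolded N_def]])
      fix v
      assume "v \<in> (\<Union>l\<in>{Suc k..}. summand l)"
      then obtain l where "Suc k \<le> l" "v \<in> summand l"
        by auto
      then show "hinner \<H> f v = 0"
        using f by (intro summand_orthogonal[of k l]) auto
    qed
    with f show "f \<in> wandering M k"
      using summand_pow[of k k] summand_mem[OF f]
      by (auto simp: wandering_def orth_compl_def pow simp del: funpow.simps)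
  qed
  \<comment> \<open>A vector of E_k lies in \<open>N k\<close> and is orthogonal to the later
    summands, which lie in S^(k+1) M; if it is also orthogonal to the k-th summand, it is orthogonal
    to \<open>N k\<close> and vanishes.\<close>
  have "wandering M k = summand k"
  proof (rule \<H>.closed_subspace_eqI[OF closed_subspace_summand _ _ W_sub])
    show "wandering M k \<subseteq> hcarrier \<H>" "complex_vector.subspace (wandering M k)"
      using closed_subspace_wandering[OF M invariant, of k] by (auto simp: closed_subspace_def)
    fix f
    assume f: "f \<in> wandering M k" and o: "\<And>v. v \<in> summand k \<Longrightarrow> hinner \<H> v f = 0"
    have fH: "f \<in> hcarrier \<H>"
      by (rule wandering_mem[OF M invariant f])
    have "hinner \<H> f v = 0" if v: "v \<in> summand l" "k \<le> l" for v l
    proof (cases "l = k")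
      case True
      then show ?thesis
        using o v summand_mem[OF v(1)] fH \<H>.inner_eq_0_commute by blast
    next
      case False
      then have "v \<in> (shift ^^ Suc k) ` M"
        using v summand_pow[of "Suc k" l] by auto
      then show ?thesis
        using f by (intro wandering_orthogonal_shift[OF M invariant f, of "Suc k"]) auto
    qed
    moreover have "f \<in> N k"
      using f pow[of k] by (auto simp: wandering_def)
    ultimately have "hinner \<H> f f = 0"
      unfolding N_def by (intro \<H>.orthogonal_closed_span[OF N_sub fH, of k f]) auto
    then show "f = 0"
      by (rule \<H>.inner_self_eq_0D[OF fH])
  qed
  then show "(\<lambda>u. mult_op (\<Theta> k) (monomial k u)) ` hcarrier (U k) = wandering M k"
    by (simp add: summand_eq)
qed

section \<open>Composites and sums of operators, polarization, division by powers of z\<close>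

lemma bounded_operator_compose:
  assumes "inner_product_space H" "inner_product_space K" "inner_product_space L"
    and S: "bounded_operator H K S" and T: "bounded_operator K L T"
  shows "bounded_operator H L (\<lambda>x. T (S x))"
proof -
  interpret K: inner_product_space K
    by (rule assms)
  interpret H: inner_product_space H
    by (rule assms)
  obtain a where a: "\<And>x. x \<in> hcarrier H \<Longrightarrow> hnorm K (S x) \<le> a * hnorm H x"
    using H.bounded_operator_bound[OF S] by blast
  obtain b where b: "b > 0" "\<And>x. x \<in> hcarrier K \<Longrightarrow> hnorm L (T x) \<le> b * hnorm K x"
    using K.bounded_operator_bound[OF T] by blast
  note mem = bounded_operator_mem[OF S] bounded_operator_mem[OF T]
  show ?thesis
  proof (rule bounded_operatorI)
    fix x
    assume x: "x \<in> hcarrier H"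
    have "hnorm L (T (S x)) \<le> b * hnorm K (S x)"
      using b x mem by simp
    also have "\<dots> \<le> b * (a * hnorm H x)"
      using a[OF x] b(1) by simp
    finally show "hnorm L (T (S x)) \<le> (b * a) * hnorm H x"
      by (simp add: mult.assoc)
  qed (use mem in \<open>auto simp: bounded_operator_add[OF S] bounded_operator_add[OF T]
      bounded_operator_scale[OF S] bounded_operator_scale[OF T]\<close>)
qed

lemma bounded_operator_plus:
  assumes "inner_product_space H" "inner_product_space K"
    and S: "bounded_operator H K S" and T: "bounded_operator H K T"
  shows "bounded_operator H K (\<lambda>x. S x + T x)"
proof -
  interpret K: inner_product_space K
    by (rule assms)
  interpret H: inner_product_space H
    by (rule assms)
  obtain a where a: "\<And>x. x \<in> hcarrier H \<Longrightarrow> hnorm K (S x) \<le> a * hnorm H x"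
    using H.bounded_operator_bound[OF S] by blast
  obtain b where b: "\<And>x. x \<in> hcarrier H \<Longrightarrow> hnorm K (T x) \<le> b * hnorm H x"
    using H.bounded_operator_bound[OF T] by blast
  note mem = bounded_operator_mem[OF S] bounded_operator_mem[OF T]
  show ?thesis
  proof (rule bounded_operatorI)
    fix x
    assume x: "x \<in> hcarrier H"
    have "hnorm K (S x + T x) \<le> hnorm K (S x) + hnorm K (T x)"
      using x mem by (intro K.norm_triangle)
    also have "\<dots> \<le> (a + b) * hnorm H x"
      using a[OF x] b[OF x] by (simp add: distrib_right)
    finally show "hnorm K (S x + T x) \<le> (a + b) * hnorm H x" .
  qed (use mem in \<open>auto simp: bounded_operator_add[OF S] bounded_operator_add[OF T]
      bounded_operator_scale[OF S] bounded_operator_scale[OF T] scaleC_add_right\<close>)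
qed

text \<open>Polarization: norms of sums determine real parts, and \<i> x in place of x yields the
  imaginary parts.\<close>

lemma isometric_imp_inner:
  assumes H: "inner_product_space H" and K: "inner_product_space K"
    and T: "bounded_operator H K T" and norm: "\<And>x. x \<in> hcarrier H \<Longrightarrow> hnorm K (T x) = hnorm H x"
    and x: "x \<in> hcarrier H" and y: "y \<in> hcarrier H"
  shows "hinner K (T x) (T y) = hinner H x y"
proof -
  interpret H: inner_product_space H
    by (rule H)
  interpret K: inner_product_space K
    by (rule K)
  note mem = bounded_operator_mem[OF T]
  have Re: "Re (hinner K (T x) (T y)) = Re (hinner H x y)" if "x \<in> hcarrier H" for x
    using H.norm_add_power2[OF that y] K.norm_add_power2[OF mem[OF that] mem[OF y]] that y
    by (simp add: norm bounded_operator_add[OF T, symmetric])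
  show ?thesis
    using Re[OF x] Re[of "\<i> *\<^sub>C x"] x y
    by (simp add: bounded_operator_scale[OF T] H.inner_scale K.inner_scale mem complex_eq_iff)
qed

lemma (in bergman_space) shift_pow_divisor:
  assumes f: "f \<in> hcarrier \<H>" and k: "\<And>i. i < k \<Longrightarrow> tc f i = 0"
  obtains g where "g \<in> hcarrier \<H>" "(shift ^^ k) g = f" "\<And>i. tc g i = tc f (i + k)"
proof -
  have "summable (\<lambda>i. \<mu> i * (hnorm Y (tc f (i + k)))\<^sup>2)"
  proof (rule summable_comparison_test')
    have "summable (\<lambda>i. \<mu> (i + k) * (hnorm Y (tc f (i + k)))\<^sup>2)"
      using norm_sums[OF f] by (subst summable_iff_shift) (simp add: sums_iff)
    then show "summable (\<lambda>i. n ^ k * (\<mu> (i + k) * (hnorm Y (tc f (i + k)))\<^sup>2))"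
      by (rule summable_mult)
    fix i
    have "\<mu> i * (hnorm Y (tc f (i + k)))\<^sup>2 \<le> (n ^ k * \<mu> (i + k)) * (hnorm Y (tc f (i + k)))\<^sup>2"
      using bweight_le[OF n_pos] by (intro mult_right_mono) auto
    then show "norm (\<mu> i * (hnorm Y (tc f (i + k)))\<^sup>2) \<le> n ^ k * (\<mu> (i + k) * (hnorm Y (tc f (i + k)))\<^sup>2)"
      by (simp add: mult.assoc)
  qed
  then have c: "(\<lambda>i. tc f (i + k)) \<in> hcarrier (coeff_space n Y)"
    using f by (simp add: coeff_space_mem)
  show ?thesis
  proof (rule that)
    show "bfun (\<lambda>i. tc f (i + k)) \<in> hcarrier \<H>" "tc (bfun (\<lambda>i. tc f (i + k))) i = tc f (i + k)" for i
      using c by simp_all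
    then show "(shift ^^ k) (bfun (\<lambda>i. tc f (i + k))) = f"
      using f k by (intro bergman_eqI) (auto simp: tc_shift_pow)
  qed
qed

context isometric_pair
begin

subsection \<open>The wandering subspaces of the model\<close>

definition emb :: "nat \<Rightarrow> 'x \<Rightarrow> 'y \<Rightarrow> complex \<Rightarrow> 'y"
  where "emb k b d = obs (Suc k) b + complex_of_real (inverse (\<mu> k)) *\<^sub>C monomial k d"

lemma emb_mem [simp]: "b \<in> hcarrier X \<Longrightarrow> d \<in> hcarrier Y \<Longrightarrow> emb k b d \<in> hcarrier \<H>"
  by (simp add: emb_def monomial_eq)

lemma tc_emb:
  "b \<in> hcarrier X \<Longrightarrow> d \<in> hcarrier Y \<Longrightarrow> tc (emb k b d) i =
    (if i < k then 0 else if i = k then of_real (inverse (\<mu> k)) *\<^sub>C d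
     else of_real (inverse (\<mu> i)) *\<^sub>C C ((A ^^ (i - Suc k)) b))"
  by (simp add: emb_def monomial_eq tc_add tc_scale scaleC_fun_apply tc_obs)

lemma emb_add:
  "b \<in> hcarrier X \<Longrightarrow> b' \<in> hcarrier X \<Longrightarrow> emb k (b + b') (d + d') = emb k b d + emb k b' d'"
  by (simp add: emb_def obs_add monomial_add scaleC_add_right)

lemma emb_scale: "b \<in> hcarrier X \<Longrightarrow> emb k (a *\<^sub>C b) (a *\<^sub>C d) = a *\<^sub>C emb k b d"
  by (simp add: emb_def obs_scale monomial_scale scaleC_add_right scaleC_scaleC mult.commute)

lemma emb_diff:
  "b \<in> hcarrier X \<Longrightarrow> b' \<in> hcarrier X \<Longrightarrow> emb k (b - b') (d - d') = emb k b d - emb k b' d'"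
  using emb_add[of b "(-1) *\<^sub>C b'" k d "(-1) *\<^sub>C d'"] emb_scale[of b' k "-1" d'] by simp

lemma emb_zero [simp]: "emb k 0 0 = 0"
  using emb_scale[of 0 k 0 0] by simp

text \<open>The coefficient of index k splits off as C x; the remaining ones are those of
  \<open>obs (Suc k)\<close> at A x.\<close>

lemma obs_eq_emb:
  assumes x: "x \<in> hcarrier X"
  shows "obs k x = emb k (A x) (C x)"
proof (rule bergman_eqI)
  fix i
  have "C ((A ^^ (i - Suc k)) (A x)) = C ((A ^^ (i - k)) x)" if "k < i"
  proof -
    have "i - k = Suc (i - Suc k)"
      using that by simp
    then show ?thesis
      by (simp add: funpow_swap1)
  qed
  then show "tc (obs k x) i = tc (emb k (A x) (C x)) i"
    using x by (auto simp: tc_obs tc_emb)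
qed (use x in simp_all)

text \<open>The monomial of degree k is orthogonal to the range of \<open>obs (Suc k)\<close>, whose
  coefficients start at k + 1. On the monomials, mu_k^-2 from the scalars meets the weight
  mu_k.\<close>

lemma inner_emb:
  assumes b: "b \<in> hcarrier X" "b' \<in> hcarrier X" and d: "d \<in> hcarrier Y" "d' \<in> hcarrier Y"
  shows "hinner \<H> (emb k b d) (emb k b' d') =
    hinner \<H> (obs (Suc k) b) (obs (Suc k) b') + of_real (inverse (\<mu> k)) * hinner Y d d'"
proof -
  have o: "hinner \<H> (obs (Suc k) b) (monomial k d) = 0" if "b \<in> hcarrier X" "d \<in> hcarrier Y" for b d
    using that by (simp add: inner_monomial tc_obs)
  then have o': "hinner \<H> (monomial k d) (obs (Suc k) b) = 0" if "b \<in> hcarrier X" "d \<in> hcarrier Y" for b d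
    using that \<H>.inner_eq_0_commute[of "obs (Suc k) b" "monomial k d"] by (simp add: monomial_eq)
  have "hinner \<H> (monomial k d) (monomial k d') = of_real (\<mu> k) * hinner Y d d'"
    using d by (simp add: inner_monomial monomial_eq)
  then show ?thesis
    using b d
    by (simp add: emb_def monomial_eq \<H>.inner_add \<H>.inner_add2 \<H>.inner_scale \<H>.inner_scale2 o o')
qed

lemma norm_emb:
  assumes b: "b \<in> hcarrier X" and d: "d \<in> hcarrier Y"
  shows "(hnorm \<H> (emb k b d))\<^sup>2 = (hnorm \<H> (obs (Suc k) b))\<^sup>2 + inverse (\<mu> k) * (hnorm Y d)\<^sup>2"
  using arg_cong[OF inner_emb[OF b b d d, of k], of Re] b d
  by (simp add: \<H>.norm_power2 Y.norm_power2) (simp add: power2_eq_square field_simps)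

text \<open>The first bound comes from the lower bound of the gramian of index k + 1, the second
  from mu_k <= 1. They make \<open>emb k\<close> injective and later bound \<open>B\<close> and
  \<open>D\<close> by 1.\<close>

lemma norm_le_emb:
  assumes b: "b \<in> hcarrier X" and d: "d \<in> hcarrier Y"
  shows "hnorm X b \<le> hnorm \<H> (emb k b d)" "hnorm Y d \<le> hnorm \<H> (emb k b d)"
proof -
  have "hnorm \<H> (obs (Suc k) b) \<le> hnorm \<H> (emb k b d)"
  proof (rule power2_le_imp_le)
    show "(hnorm \<H> (obs (Suc k) b))\<^sup>2 \<le> (hnorm \<H> (emb k b d))\<^sup>2"
      unfolding norm_emb[OF b d] by simp
  qed (use b d in simp)
  with norm_le_obs[OF b, of "Suc k"] show "hnorm X b \<le> hnorm \<H> (emb k b d)"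
    by linarith
  show "hnorm Y d \<le> hnorm \<H> (emb k b d)"
  proof (rule power2_le_imp_le)
    have "1 * (hnorm Y d)\<^sup>2 \<le> inverse (\<mu> k) * (hnorm Y d)\<^sup>2"
      using bweight_le_1[OF n_pos, of k] by (intro mult_right_mono one_le_inverse) auto
    then show "(hnorm Y d)\<^sup>2 \<le> (hnorm \<H> (emb k b d))\<^sup>2"
      unfolding norm_emb[OF b d] by (simp add: add_increasing)
  qed (use b d in simp)
qed

lemma emb_eq_0:
  assumes "b \<in> hcarrier X" "d \<in> hcarrier Y" "emb k b d = 0"
  shows "b = 0" "d = 0"
proof -
  have "hnorm X b = 0" "hnorm Y d = 0"
    using norm_le_emb[OF assms(1,2), of k] assms by (auto intro: antisym)
  with assms show "b = 0" "d = 0"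
    by (simp_all add: X.norm_eq_0_iff Y.norm_eq_0_iff)
qed

text \<open>The invariant subspace that the pair represents: the orthogonal complement of the range
  of V_0.\<close>

definition annihilator :: "(complex \<Rightarrow> 'y) set"
  where "annihilator = orth_compl \<H> (obs 0 ` hcarrier X)"

lemma closed_subspace_annihilator: "closed_subspace \<H> annihilator"
  unfolding annihilator_def by (rule \<H>.closed_subspace_orth_compl) auto

lemma orth_compl_annihilator: "orth_compl \<H> annihilator = obs 0 ` hcarrier X"
  unfolding annihilator_def by (rule \<H>.orth_compl_orth_compl[OF closed_subspace_obs])

lemma annihilator_inner:
  "f \<in> annihilator \<longleftrightarrow> f \<in> hcarrier \<H> \<and> (\<forall>x\<in>hcarrier X. hinner \<H> (obs 0 x) f = 0)"
  unfolding annihilator_def orth_compl_def using \<H>.inner_eq_0_commute[of f] by auto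

text \<open>The adjoint of the shift intertwines: pairing \<open>obs 0 x\<close> with
  \<open>shift f\<close> equals pairing \<open>obs 0 (A x)\<close> with \<open>f\<close>.\<close>

lemma shift_annihilator: "shift ` annihilator \<subseteq> annihilator"
proof
  fix g
  assume "g \<in> shift ` annihilator"
  then obtain f where f: "f \<in> hcarrier \<H>" "\<And>x. x \<in> hcarrier X \<Longrightarrow> hinner \<H> (obs 0 x) f = 0" "g = shift f"
    by (auto simp: annihilator_inner)
  have "hinner \<H> (obs 0 x) (shift f) = 0" if x: "x \<in> hcarrier X" for x
  proof -
    have "of_real (\<mu> (j + 1)) * hinner Y (tc (obs 0 x) (j + 1)) (tc f j) =
        of_real (\<mu> j) * hinner Y (tc (obs 0 (A x)) j) (tc f j)" for j
      using x f by (simp add: tc_obs Y.inner_scale funpow_swap1)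
    then have "hinner \<H> (obs 0 x) ((shift ^^ 1) f) = hinner \<H> (obs 0 (A x)) f"
      using inner_shift_pow_sums[of "obs 0 x" f 1, OF obs_mem[OF x] f(1)] inner_sums[OF obs_mem[OF A_mem[OF x]] f(1), of 0]
      by (simp add: sums_unique2)
    then show ?thesis
      using f(2)[of "A x"] x by simp
  qed
  with f show "g \<in> annihilator"
    by (simp add: annihilator_inner)
qed

text \<open>Vanishing low coefficients allow division by z^k; \<open>inner_obs_shift\<close> turns
  orthogonality to V_k into orthogonality of the quotient to V_0.\<close>

lemma shift_pow_annihilator:
  "f \<in> (shift ^^ k) ` annihilator \<longleftrightarrow> f \<in> hcarrier \<H> \<and> (\<forall>i<k. tc f i = 0) \<and>
    (\<forall>x\<in>hcarrier X. hinner \<H> (obs k x) f = 0)" (is "?l \<longleftrightarrow> ?r")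
proof
  assume ?l
  then show ?r
    by (auto simp: annihilator_inner tc_shift_pow inner_obs_shift)
next
  assume r: ?r
  then obtain g where g: "g \<in> hcarrier \<H>" "(shift ^^ k) g = f"
    using shift_pow_divisor[of f k] by metis
  then have "hinner \<H> (obs 0 x) g = 0" if "x \<in> hcarrier X" for x
    using inner_obs_shift[OF that g(1), of k] r that by simp
  with g show ?l
    by (auto simp: annihilator_inner)
qed

definition wandering_pairs :: "nat \<Rightarrow> ('x \<times> 'y) set"
  where "wandering_pairs k = {(b, d). b \<in> hcarrier X \<and> d \<in> hcarrier Y \<and>
    (\<forall>x\<in>hcarrier X. hinner \<H> (emb k b d) (obs k x) = 0)}"

text \<open>The range of \<open>emb k\<close> contains E_k because the adjoint of S^(k+1) maps E_k
  into the complement of M, the range of V_0; this recovers all coefficients above k from a single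
  vector b.\<close>

lemma emb_wandering_pairs: "(\<lambda>(b, d). emb k b d) ` wandering_pairs k = wandering annihilator k"
proof
  show "(\<lambda>(b, d). emb k b d) ` wandering_pairs k \<subseteq> wandering annihilator k"
  proof clarify
    fix b d
    assume bd: "(b, d) \<in> wandering_pairs k"
    then have b: "b \<in> hcarrier X" and d: "d \<in> hcarrier Y"
      and o: "\<And>x. x \<in> hcarrier X \<Longrightarrow> hinner \<H> (emb k b d) (obs k x) = 0"
      by (auto simp: wandering_pairs_def)
    have "emb k b d \<in> (shift ^^ k) ` annihilator"
      unfolding shift_pow_annihilator using b d o \<H>.inner_eq_0_commute[of "emb k b d"] by (auto simp: tc_emb)
    \<comment> \<open>The monomial has degree k while S^(k+1) g starts at k + 1; the pairing of the
      other summand equals that of V_0 b with g, which is 0.\<close>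
    moreover have "hinner \<H> (emb k b d) ((shift ^^ Suc k) g) = 0" if g: "g \<in> annihilator" for g
    proof -
      have gH: "g \<in> hcarrier \<H>" and g0: "hinner \<H> (obs 0 b) g = 0"
        using g b by (auto simp: annihilator_inner)
      have "hinner \<H> ((shift ^^ Suc k) g) (monomial k d) = 0"
        using gH d shift_pow_mem[OF gH, of "Suc k"]
        by (subst inner_monomial) (simp_all add: tc_shift_pow del: funpow.simps)
      then have "hinner \<H> (monomial k d) ((shift ^^ Suc k) g) = 0"
        using gH d \<H>.inner_eq_0_commute[of "monomial k d"] shift_pow_mem[OF gH, of "Suc k"] by (simp add: monomial_eq)
      then show ?thesis
        using b d gH g0 inner_obs_shift[OF b gH, of "Suc k"] shift_pow_mem[OF gH, of "Suc k"]
        by (simp add: emb_def \<H>.inner_add \<H>.inner_scale monomial_eq del: funpow.simps)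
    qed
    ultimately show "emb k b d \<in> wandering annihilator k"
      using b d by (auto simp: wandering_def orth_compl_def simp del: funpow.simps)
  qed
  show "wandering annihilator k \<subseteq> (\<lambda>(b, d). emb k b d) ` wandering_pairs k"
  proof
    fix f
    assume f: "f \<in> wandering annihilator k"
    then have "f \<in> (shift ^^ k) ` annihilator"
      by (simp add: wandering_def)
    then have fH: "f \<in> hcarrier \<H>" and low: "\<And>i. i < k \<Longrightarrow> tc f i = 0"
      and o: "\<And>x. x \<in> hcarrier X \<Longrightarrow> hinner \<H> (obs k x) f = 0"
      unfolding shift_pow_annihilator by auto
    \<comment> \<open>The adjoint of S^(k+1) applied to \<open>f\<close>, in explicit form.\<close>
    let ?g = "bfun (\<lambda>j. of_real (\<mu> (j + Suc k) / \<mu> j) *\<^sub>C tc f (j + Suc k))"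
    note gc = backward_shift_mem[OF fH, of "Suc k"]
    have "hinner \<H> ?g m = 0" if m: "m \<in> annihilator" for m
    proof -
      have "(shift ^^ Suc k) m \<in> (shift ^^ Suc k) ` annihilator"
        using m by (rule imageI)
      then have "hinner \<H> f ((shift ^^ Suc k) m) = 0"
        using f by (auto simp: wandering_def orth_compl_def)
      then show ?thesis
        using m by (simp only: inner_backward_shift[OF fH] annihilator_inner)
    qed
    then have "?g \<in> orth_compl \<H> annihilator"
      unfolding orth_compl_def using bfun_mem[OF gc] by blast
    then obtain b where b: "b \<in> hcarrier X" "?g = obs 0 b"
      unfolding orth_compl_annihilator by blast
    have high: "tc f i = of_real (inverse (\<mu> i)) *\<^sub>C C ((A ^^ (i - Suc k)) b)" if "k < i" for i
    proof -
      define j where "j = i - Suc k"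
      have i: "i = j + Suc k"
        using that by (simp add: j_def)
      have "complex_of_real (\<mu> i / \<mu> j) *\<^sub>C tc f i = tc ?g j"
        unfolding tc_bfun[OF gc] by (simp add: i)
      also have "\<dots> = of_real (inverse (\<mu> j)) *\<^sub>C C ((A ^^ j) b)"
        unfolding b(2) using b(1) by (simp add: tc_obs)
      finally have "complex_of_real (\<mu> j / \<mu> i) *\<^sub>C (complex_of_real (\<mu> i / \<mu> j) *\<^sub>C tc f i) =
          complex_of_real (\<mu> j / \<mu> i) *\<^sub>C (of_real (inverse (\<mu> j)) *\<^sub>C C ((A ^^ j) b))"
        by simp
      then show ?thesis
        by (simp add: scaleC_scaleC scaleC_one j_def field_simps)
    qed
    \<comment> \<open>The factor mu_k undoes the normalisation mu_k^-1 of the monomial in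
      \<open>emb\<close>.\<close>
    let ?d = "complex_of_real (\<mu> k) *\<^sub>C tc f k"
    have f_eq: "f = emb k b ?d"
      using fH b(1) low high by (intro bergman_eqI) (auto simp: tc_emb scaleC_scaleC scaleC_one)
    have "(b, ?d) \<in> wandering_pairs k"
      unfolding wandering_pairs_def using b(1) fH o \<H>.inner_eq_0_commute[of f] by (auto simp flip: f_eq)
    then show "f \<in> (\<lambda>(b, d). emb k b d) ` wandering_pairs k"
      using f_eq by force
  qed
qed

subsection \<open>The Cholesky factorization problem\<close>

abbreviation "ginv k \<equiv> gramian_inv n k X Y A C"
abbreviation "Astar \<equiv> hadjoint X X A"
abbreviation "Cstar \<equiv> hadjoint X Y C"

definition cholesky_rhs :: "nat \<Rightarrow> 'x \<Rightarrow> 'y \<Rightarrow> 'x \<times> 'y"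
  where "cholesky_rhs k x y =
    (let w = ginv k (Astar x + Cstar y)
     in (ginv (k + 1) x, of_real (\<mu> k) *\<^sub>C y) - (A w, C w))"

lemma Astar_mem [simp]: "x \<in> hcarrier X \<Longrightarrow> Astar x \<in> hcarrier X"
  by (rule hadjoint_mem[OF hilbert_X X.inner_product_space_axioms bounded_A])

lemma Cstar_mem [simp]: "y \<in> hcarrier Y \<Longrightarrow> Cstar y \<in> hcarrier X"
  by (rule hadjoint_mem[OF hilbert_X Y.inner_product_space_axioms bounded_C])

lemma inner_Astar: "x \<in> hcarrier X \<Longrightarrow> v \<in> hcarrier X \<Longrightarrow> hinner X v (Astar x) = hinner X (A v) x"
  by (rule inner_hadjoint[OF hilbert_X X.inner_product_space_axioms bounded_A])

lemma inner_Cstar: "y \<in> hcarrier Y \<Longrightarrow> v \<in> hcarrier X \<Longrightarrow> hinner X v (Cstar y) = hinner Y (C v) y"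
  by (rule inner_hadjoint[OF hilbert_X Y.inner_product_space_axioms bounded_C])

lemma cholesky_rhs_mem:
  "x \<in> hcarrier X \<Longrightarrow> y \<in> hcarrier Y \<Longrightarrow> fst (cholesky_rhs k x y) \<in> hcarrier X"
  "x \<in> hcarrier X \<Longrightarrow> y \<in> hcarrier Y \<Longrightarrow> snd (cholesky_rhs k x y) \<in> hcarrier Y"
  by (simp_all add: cholesky_rhs_def Let_def)

text \<open>The diagonal block of the right-hand side inverts the Gram matrix of
  \<open>emb k\<close>, so it represents the pairing with (x, y); the block through A and C
  subtracts a vector of the range of V_k, by \<open>obs_eq_emb\<close>.\<close>

lemma inner_emb_cholesky_rhs:
  assumes b: "b \<in> hcarrier X" and d: "d \<in> hcarrier Y" and x: "x \<in> hcarrier X" and y: "y \<in> hcarrier Y"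
  shows "hinner \<H> (emb k b d) (emb k (fst (cholesky_rhs k x y)) (snd (cholesky_rhs k x y))) =
    hinner X b x + hinner Y d y - hinner \<H> (emb k b d) (obs k (ginv k (Astar x + Cstar y)))"
proof -
  let ?w = "ginv k (Astar x + Cstar y)"
  have w: "?w \<in> hcarrier X"
    using x y by simp
  have "emb k (fst (cholesky_rhs k x y)) (snd (cholesky_rhs k x y)) =
      emb k (ginv (Suc k) x) (of_real (\<mu> k) *\<^sub>C y) - obs k ?w"
    using w x by (simp add: cholesky_rhs_def Let_def emb_diff flip: obs_eq_emb)
  moreover have "hinner \<H> (emb k b d) (emb k (ginv (Suc k) x) (of_real (\<mu> k) *\<^sub>C y)) =
      hinner X b x + hinner Y d y"
    using b d x y by (simp add: inner_emb inner_obs_gramian_inv Y.inner_scale2)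
  ultimately show ?thesis
    using b d x y w by (simp add: \<H>.inner_diff_right)
qed

text \<open>\<open>w\<close> is chosen so that V_k w pairs with each V_k v as (x, y) pairs with (A
  v, C v). Subtracting V_k w therefore removes the component in the range of V_k.\<close>

lemma cholesky_rhs_wandering:
  assumes x: "x \<in> hcarrier X" and y: "y \<in> hcarrier Y"
  shows "cholesky_rhs k x y \<in> wandering_pairs k"
proof -
  let ?w = "ginv k (Astar x + Cstar y)"
  let ?e = "emb k (fst (cholesky_rhs k x y)) (snd (cholesky_rhs k x y))"
  have e: "?e \<in> hcarrier \<H>"
    using x y by (simp add: cholesky_rhs_mem)
  have "hinner \<H> ?e (obs k v) = 0" if v: "v \<in> hcarrier X" for v
  proof -
    have "hinner \<H> (obs k v) ?e =
        hinner X (A v) x + hinner Y (C v) y - hinner \<H> (obs k v) (obs k ?w)"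
      using inner_emb_cholesky_rhs[OF A_mem[OF v] C_mem[OF v] x y, of k] v by (simp add: obs_eq_emb[OF v])
    also have "\<dots> = 0"
      using v x y by (simp add: inner_obs_gramian_inv X.inner_add2 inner_Astar inner_Cstar)
    finally show ?thesis
      using e v \<H>.inner_eq_0_commute[of ?e "obs k v"] by simp
  qed
  then show ?thesis
    using x y by (simp add: wandering_pairs_def cholesky_rhs_mem case_prod_unfold)
qed

lemma wandering_inner_cholesky_rhs:
  assumes bd: "(b, d) \<in> wandering_pairs k" and x: "x \<in> hcarrier X" and y: "y \<in> hcarrier Y"
  shows "hinner \<H> (emb k b d) (emb k (fst (cholesky_rhs k x y)) (snd (cholesky_rhs k x y))) =
    hinner X b x + hinner Y d y"
  using bd x y by (auto simp: wandering_pairs_def inner_emb_cholesky_rhs)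

lemma cholesky_solution_iff:
  "cholesky_solution n k X Y A C U B D \<longleftrightarrow>
    hilbert_space U \<and> bounded_operator U X B \<and> bounded_operator U Y D \<and>
    inj_on (\<lambda>u. (B u, D u)) (hcarrier U) \<and>
    (\<forall>x\<in>hcarrier X. \<forall>y\<in>hcarrier Y.
      (B (hadjoint U X B x + hadjoint U Y D y), D (hadjoint U X B x + hadjoint U Y D y)) = cholesky_rhs k x y)"
  by (simp add: cholesky_solution_def cholesky_rhs_def Let_def)

lemma cholesky_solutionI:
  assumes U: "hilbert_space U"
    and pairs: "(\<lambda>u. (B u, D u)) ` hcarrier U = wandering_pairs k"
    and add: "\<And>u v. u \<in> hcarrier U \<Longrightarrow> v \<in> hcarrier U \<Longrightarrow> B (u + v) = B u + B v \<and> D (u + v) = D u + D v"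
    and scale: "\<And>a u. u \<in> hcarrier U \<Longrightarrow> B (a *\<^sub>C u) = a *\<^sub>C B u \<and> D (a *\<^sub>C u) = a *\<^sub>C D u"
    and inner: "\<And>u v. u \<in> hcarrier U \<Longrightarrow> v \<in> hcarrier U \<Longrightarrow>
      hinner U u v = hinner \<H> (emb k (B u) (D u)) (emb k (B v) (D v))"
  shows "cholesky_solution n k X Y A C U B D"
proof -
  interpret U: hilbert_space U
    by (rule U)
  have pair: "(B u, D u) \<in> wandering_pairs k" if "u \<in> hcarrier U" for u
    using that pairs by blast
  have mem: "B u \<in> hcarrier X" "D u \<in> hcarrier Y" if "u \<in> hcarrier U" for u
    using pair[OF that] by (auto simp: wandering_pairs_def)
  have norm: "hnorm U u = hnorm \<H> (emb k (B u) (D u))" if "u \<in> hcarrier U" for u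
    using inner[OF that that] by (simp add: hnorm_def)
  have B: "bounded_operator U X B"
    by (rule bounded_operatorI[where c = 1]) (use mem add scale norm_le_emb(1) norm in auto)
  have D: "bounded_operator U Y D"
    by (rule bounded_operatorI[where c = 1]) (use mem add scale norm_le_emb(2) norm in auto)
  have inj: "inj_on (\<lambda>u. (B u, D u)) (hcarrier U)"
  proof (rule inj_onI)
    fix u v
    assume u: "u \<in> hcarrier U" and v: "v \<in> hcarrier U" and eq: "(B u, D u) = (B v, D v)"
    have "hnorm U (u - v) = hnorm \<H> (emb k (B u - B v) (D u - D v))"
      using u v by (simp add: norm U.bounded_operator_diff[OF B] U.bounded_operator_diff[OF D])
    also have "\<dots> = 0"
      using eq mem[OF v] by (simp add: emb_diff)
    finally show "u = v"
      using U.norm_eq_0_iff[of "u - v"] u v by simp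
  qed
  have "(B (hadjoint U X B x + hadjoint U Y D y), D (hadjoint U X B x + hadjoint U Y D y)) =
      cholesky_rhs k x y" if x: "x \<in> hcarrier X" and y: "y \<in> hcarrier Y" for x y
  proof -
    note adjB = U X.inner_product_space_axioms B x and adjD = U Y.inner_product_space_axioms D y
    \<comment> \<open>The right-hand side is a wandering pair and hence of the form (B u, D u);
      testing against all vectors of \<open>U\<close> identifies u with the sum of the two
      adjoints.\<close>
    obtain u where u: "u \<in> hcarrier U" "cholesky_rhs k x y = (B u, D u)"
      using cholesky_rhs_wandering[OF x y, of k] unfolding pairs[symmetric] by auto
    have "hadjoint U X B x + hadjoint U Y D y = u"
    proof (rule U.inner_eqI)
      fix v
      assume v: "v \<in> hcarrier U"
      have "hinner U v (hadjoint U X B x + hadjoint U Y D y) = hinner X (B v) x + hinner Y (D v) y"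
        using v by (simp add: U.inner_add2 hadjoint_mem[OF adjB] hadjoint_mem[OF adjD]
            inner_hadjoint[OF adjB] inner_hadjoint[OF adjD])
      also have "\<dots> = hinner U v u"
        using wandering_inner_cholesky_rhs[OF pair[OF v] x y] v u by (simp add: inner)
      finally show "hinner U v (hadjoint U X B x + hadjoint U Y D y) = hinner U v u" .
    qed (use u hadjoint_mem[OF adjB] hadjoint_mem[OF adjD] in auto)
    with u show ?thesis
      by simp
  qed
  with U B D inj show ?thesis
    unfolding cholesky_solution_iff by blast
qed

text \<open>The wandering pairs themselves, with the Bergman inner product of their images, serve as
  \<open>U\<close>, and the two coordinate projections as \<open>B\<close> and
  \<open>D\<close>.\<close>

lemma cholesky_solution_exists:
  "\<exists>(U :: ('x \<times> 'y) hspace) B D. cholesky_solution n k X Y A C U B D"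
proof -
  let ?U = "\<lparr>hcarrier = wandering_pairs k,
      hinner = \<lambda>p q. hinner \<H> (emb k (fst p) (snd p)) (emb k (fst q) (snd q))\<rparr>"
  have mem: "fst p \<in> hcarrier X" "snd p \<in> hcarrier Y" if "p \<in> wandering_pairs k" for p
    using that by (auto simp: wandering_pairs_def)
  have "hilbert_space ?U"
  proof (rule hilbert_space_pullback[OF hilbert_bergman, where \<phi> = "\<lambda>p. emb k (fst p) (snd p)"])
    have "complex_vector.subspace (wandering_pairs k)"
    proof (rule complex_vector.subspaceI)
      show "0 \<in> wandering_pairs k"
        by (simp add: wandering_pairs_def zero_prod_def)
    qed (auto simp: wandering_pairs_def emb_add emb_scale scaleC_prod_def \<H>.inner_add \<H>.inner_scale)
    then show "complex_vector.subspace (hcarrier ?U)"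
      by simp
    have "(\<lambda>p. emb k (fst p) (snd p)) ` hcarrier ?U = wandering annihilator k"
      unfolding emb_wandering_pairs[symmetric] by (simp add: case_prod_unfold)
    then show "closed_subspace \<H> ((\<lambda>p. emb k (fst p) (snd p)) ` hcarrier ?U)"
      using closed_subspace_wandering[OF closed_subspace_annihilator shift_annihilator] by simp
    show "p = 0" if "p \<in> hcarrier ?U" "emb k (fst p) (snd p) = 0" for p
      using emb_eq_0[of "fst p" "snd p" k] mem that by (simp add: prod_eq_iff)
  qed (use mem in \<open>auto simp: emb_add emb_scale scaleC_prod_def\<close>)
  then have "cholesky_solution n k X Y A C ?U fst snd"
    by (rule cholesky_solutionI) (auto simp: scaleC_prod_def)
  then show ?thesis
    by blast
qed

text \<open>Composing the factorization with the Gram matrix of \<open>emb k\<close> yields, in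
  terms of pairs, the orthogonal projection onto E_k. It kills the range of V_k and fixes E_k; with
  the injectivity of (B, D) the first fact gives one inclusion, the second the other inclusion and
  the isometry.\<close>

lemma cholesky_solutionD:
  assumes "cholesky_solution n k X Y A C U B D"
  shows "(\<lambda>u. (B u, D u)) ` hcarrier U = wandering_pairs k"
    and "u \<in> hcarrier U \<Longrightarrow> v \<in> hcarrier U \<Longrightarrow>
      hinner \<H> (emb k (B u) (D u)) (emb k (B v) (D v)) = hinner U u v"
proof -
  have U: "hilbert_space U" and B: "bounded_operator U X B" and D: "bounded_operator U Y D"
    and inj: "inj_on (\<lambda>u. (B u, D u)) (hcarrier U)"
    and eq: "\<And>x y. x \<in> hcarrier X \<Longrightarrow> y \<in> hcarrier Y \<Longrightarrow>
      (B (hadjoint U X B x + hadjoint U Y D y), D (hadjoint U X B x + hadjoint U Y D y)) = cholesky_rhs k x y"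
    using assms by (auto simp: cholesky_solution_iff)
  interpret U: hilbert_space U
    by (rule U)
  define S where "S x y = hadjoint U X B x + hadjoint U Y D y" for x y
  note adjB = U X.inner_product_space_axioms B and adjD = U Y.inner_product_space_axioms D
  note mem = bounded_operator_mem[OF B] bounded_operator_mem[OF D]
  have S_mem: "S x y \<in> hcarrier U" if "x \<in> hcarrier X" "y \<in> hcarrier Y" for x y
    using that by (simp add: S_def hadjoint_mem[OF adjB] hadjoint_mem[OF adjD])
  have inner_S: "hinner U u (S x y) = hinner X (B u) x + hinner Y (D u) y"
    if "x \<in> hcarrier X" "y \<in> hcarrier Y" "u \<in> hcarrier U" for x y u
    using that by (simp add: S_def U.inner_add2 hadjoint_mem[OF adjB] hadjoint_mem[OF adjD]
        inner_hadjoint[OF adjB] inner_hadjoint[OF adjD])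
  \<comment> \<open>\<open>G\<close> and \<open>W\<close> are the diagonal blocks of the Gram matrix
    of \<open>emb k\<close>.\<close>
  define G where "G b = gramian n (Suc k) X Y A C b" for b
  define W where "W d = complex_of_real (inverse (\<mu> k)) *\<^sub>C d" for d :: 'y
  have GW_mem: "G b \<in> hcarrier X" "W d \<in> hcarrier Y" if "b \<in> hcarrier X" "d \<in> hcarrier Y" for b d
    using that by (simp_all add: G_def W_def)
  have GW: "hinner X b' (G b) + hinner Y d' (W d) = hinner \<H> (emb k b' d') (emb k b d)"
    if "b \<in> hcarrier X" "d \<in> hcarrier Y" "b' \<in> hcarrier X" "d' \<in> hcarrier Y" for b d b' d'
    using that by (simp add: G_def W_def inner_gramian inner_emb Y.inner_scale2)
  \<comment> \<open>The image of this pair under \<open>emb k\<close> is the orthogonal projection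
    of \<open>emb k b d\<close> onto E_k.\<close>
  have Q: "(B (S (G b) (W d)), D (S (G b) (W d))) \<in> wandering_pairs k"
      "\<And>b' d'. (b', d') \<in> wandering_pairs k \<Longrightarrow>
        hinner \<H> (emb k b' d') (emb k (B (S (G b) (W d))) (D (S (G b) (W d)))) =
        hinner \<H> (emb k b' d') (emb k b d)"
    if b: "b \<in> hcarrier X" and d: "d \<in> hcarrier Y" for b d
  proof -
    note eq' = eq[OF GW_mem[OF b d], folded S_def]
    show "(B (S (G b) (W d)), D (S (G b) (W d))) \<in> wandering_pairs k"
      unfolding eq' by (rule cholesky_rhs_wandering[OF GW_mem[OF b d]])
    fix b' d'
    assume p: "(b', d') \<in> wandering_pairs k"
    then have "b' \<in> hcarrier X" "d' \<in> hcarrier Y"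
      by (auto simp: wandering_pairs_def)
    then show "hinner \<H> (emb k b' d') (emb k (B (S (G b) (W d))) (D (S (G b) (W d)))) =
        hinner \<H> (emb k b' d') (emb k b d)"
      using wandering_inner_cholesky_rhs[OF p GW_mem[OF b d]] GW[OF b d] unfolding eq'[symmetric] by simp
  qed
  \<comment> \<open>The pair (A x, C x) embeds as V_k x, whose projection onto E_k is 0. Injectivity
    of (B, D) then gives \<open>?s = 0\<close>, and pairing u with \<open>?s\<close> is the required
    orthogonality.\<close>
  have pairs: "(B u, D u) \<in> wandering_pairs k" if u: "u \<in> hcarrier U" for u
  proof -
    have "hinner \<H> (emb k (B u) (D u)) (obs k x) = 0" if x: "x \<in> hcarrier X" for x
    proof -
      let ?s = "S (G (A x)) (W (C x))"
      note q = Q[OF A_mem[OF x] C_mem[OF x]] and s = S_mem[OF GW_mem[OF A_mem[OF x] C_mem[OF x]]]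
      have "hinner \<H> (emb k (B ?s) (D ?s)) (emb k (B ?s) (D ?s)) = 0"
        using q(2)[OF q(1)] q(1) x by (simp add: obs_eq_emb[symmetric] wandering_pairs_def)
      then have "emb k (B ?s) (D ?s) = 0"
        using mem s by (intro \<H>.inner_self_eq_0D) simp_all
      then have "B ?s = 0" "D ?s = 0"
        using emb_eq_0[of "B ?s" "D ?s" k] mem s by auto
      then have "?s = 0"
        using inj_onD[OF inj, of ?s 0] s bounded_operator_zero[OF B U.zero_mem] bounded_operator_zero[OF D U.zero_mem]
        by simp
      then have "hinner X (B u) (G (A x)) + hinner Y (D u) (W (C x)) = 0"
        using inner_S[OF GW_mem[OF A_mem[OF x] C_mem[OF x]] u] u by simp
      then show ?thesis
        using GW[OF A_mem[OF x] C_mem[OF x] mem[OF u]] by (simp add: obs_eq_emb[OF x])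
    qed
    then show ?thesis
      using u mem by (simp add: wandering_pairs_def)
  qed
  \<comment> \<open>On wandering pairs the projection is the identity: the difference
    \<open>?r\<close> is orthogonal to both of its terms.\<close>
  have inv: "B (S (G b) (W d)) = b" "D (S (G b) (W d)) = d" if p: "(b, d) \<in> wandering_pairs k" for b d
  proof -
    have b: "b \<in> hcarrier X" and d: "d \<in> hcarrier Y"
      using p by (auto simp: wandering_pairs_def)
    let ?s = "S (G b) (W d)"
    note q = Q[OF b d] and s = S_mem[OF GW_mem[OF b d]]
    let ?r = "emb k (B ?s - b) (D ?s - d)"
    have r: "?r = emb k (B ?s) (D ?s) - emb k b d"
      using mem s b d by (simp add: emb_diff)
    have "hinner \<H> (emb k (B ?s) (D ?s)) ?r = 0" "hinner \<H> (emb k b d) ?r = 0"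
      using q(2)[OF q(1)] q(2)[OF p] mem s b d by (simp_all add: r \<H>.inner_diff_right)
    then have "hinner \<H> ?r ?r = 0"
      using mem s b d by (subst (1) r) (simp add: \<H>.inner_diff_left)
    then have "?r = 0"
      using mem s b d by (intro \<H>.inner_self_eq_0D) simp_all
    then have "B ?s - b = 0" "D ?s - d = 0"
      using emb_eq_0[of "B ?s - b" "D ?s - d" k] mem s b d by auto
    then show "B ?s = b" "D ?s = d"
      by simp_all
  qed
  show "(\<lambda>u. (B u, D u)) ` hcarrier U = wandering_pairs k"
  proof
    show "wandering_pairs k \<subseteq> (\<lambda>u. (B u, D u)) ` hcarrier U"
    proof clarify
      fix b d
      assume p: "(b, d) \<in> wandering_pairs k"
      then have "S (G b) (W d) \<in> hcarrier U"
        by (intro S_mem GW_mem) (auto simp: wandering_pairs_def)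
      then show "(b, d) \<in> (\<lambda>u. (B u, D u)) ` hcarrier U"
        using inv[OF p] by (intro image_eqI[of _ _ "S (G b) (W d)"]) auto
    qed
  qed (use pairs in auto)
  show "hinner \<H> (emb k (B u) (D u)) (emb k (B v) (D v)) = hinner U u v"
    if u: "u \<in> hcarrier U" and v: "v \<in> hcarrier U"
  proof -
    note GWv = GW_mem[OF mem[OF v]]
    \<comment> \<open>Both sides have the same image under (B, D) by \<open>inv\<close>, so
      injectivity applies; \<open>inner_S\<close> and \<open>GW\<close> then read as the
      isometry.\<close>
    have "S (G (B v)) (W (D v)) = v"
      using inv[OF pairs[OF v]] S_mem[OF GWv] v by (intro inj_onD[OF inj]) auto
    then show ?thesis
      using inner_S[OF GWv u] GW[OF mem[OF v] mem[OF u]] by simp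
  qed
qed

subsection \<open>Transfer functions\<close>

text \<open>The powers of \<open>A\<close> are contractions, so the scalar series with inverse
  weights, convergent in the open disk, dominates.\<close>

lemma hresolvent_hsums:
  assumes x: "x \<in> hcarrier X" and z: "cmod z < 1"
  shows "hsums X (\<lambda>j. (of_nat ((n + j + k - 1) choose (j + k)) * z ^ j) *\<^sub>C (A ^^ j) x)
      (hresolvent n k X A z x)" (is "hsums X ?f _")
    and "hnorm X (hresolvent n k X A z x) \<le> (\<Sum>j. inverse (\<mu> (j + k)) * cmod z ^ j) * hnorm X x"
proof -
  have s: "summable (\<lambda>j. inverse (\<mu> (j + k)) * cmod z ^ j)"
    using z by (intro summable_inverse_bweight_shift n_pos) auto
  have w: "cmod (of_nat ((n + j + k - 1) choose (j + k))) = inverse (\<mu> (j + k))" for j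
    by (simp add: inverse_bweight add.assoc)
  have le: "hnorm X (?f j) \<le> (inverse (\<mu> (j + k)) * cmod z ^ j) * hnorm X x" for j
  proof -
    have "hnorm X (?f j) = (inverse (\<mu> (j + k)) * cmod z ^ j) * hnorm X ((A ^^ j) x)"
      by (simp only: X.norm_scale[OF A_pow_mem[OF x]] norm_mult norm_power w)
    also have "\<dots> \<le> (inverse (\<mu> (j + k)) * cmod z ^ j) * hnorm X x"
      using norm_A_pow_le[OF x] by (intro mult_left_mono) auto
    finally show ?thesis .
  qed
  have "summable (\<lambda>j. hnorm X (?f j))"
    by (rule summable_comparison_test'[OF summable_mult2[OF s]]) (use le x in simp)
  then obtain s' where s': "hsums X ?f s'"
    using X.hsums_absolute[of ?f] x by auto
  then have eq: "hresolvent n k X A z x = s'"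
    unfolding hresolvent_def by (rule X.hsuminf_eqI)
  with s' show "hsums X ?f (hresolvent n k X A z x)"
    by simp
  have "hnorm X s' \<le> (\<Sum>j. (inverse (\<mu> (j + k)) * cmod z ^ j) * hnorm X x)"
    using x by (intro X.hsums_norm_le[OF _ s' le] summable_mult2[OF s]) auto
  then show "hnorm X (hresolvent n k X A z x) \<le> (\<Sum>j. inverse (\<mu> (j + k)) * cmod z ^ j) * hnorm X x"
    unfolding eq suminf_mult2[OF s] .
qed

lemma bounded_operator_hresolvent:
  assumes z: "cmod z < 1"
  shows "bounded_operator X X (hresolvent n k X A z)"
proof (rule bounded_operatorI)
  note sums = hresolvent_hsums(1)[OF _ z, of _ k]
  fix x y
  assume x: "x \<in> hcarrier X" and y: "y \<in> hcarrier X"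
  show "hresolvent n k X A z (x + y) = hresolvent n k X A z x + hresolvent n k X A z y"
    unfolding hresolvent_def[of _ _ _ _ _ "x + y"]
    using X.hsums_add[OF _ _ sums[OF x] sums[OF y]] x y
    by (intro X.hsuminf_eqI) (simp add: bounded_operator_add[OF A_pow_bounded] scaleC_add_right)
next
  note sums = hresolvent_hsums(1)[OF _ z, of _ k]
  fix a x
  assume x: "x \<in> hcarrier X"
  show "hresolvent n k X A z (a *\<^sub>C x) = a *\<^sub>C hresolvent n k X A z x"
    unfolding hresolvent_def[of _ _ _ _ _ "a *\<^sub>C x"]
    using X.hsums_scale[OF _ sums[OF x], of a] x
    by (intro X.hsuminf_eqI) (simp add: bounded_operator_scale[OF A_pow_bounded] scaleC_scaleC mult.commute)
next
  fix x
  assume x: "x \<in> hcarrier X"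
  show "hresolvent n k X A z x \<in> hcarrier X"
    by (rule X.hsums_mem[OF _ hresolvent_hsums(1)[OF x z]]) (use x in simp)
qed (rule hresolvent_hsums(2)[OF _ z])

lemma bounded_operator_transfer_function:
  assumes "inner_product_space U" "bounded_operator U X B" "bounded_operator U Y D" "cmod z < 1"
  shows "bounded_operator U Y (transfer_function n k X A C B D z)"
  unfolding transfer_function_def
  by (intro bounded_operator_plus bounded_operator_compose[OF _ _ _ _ Y.bounded_operator_scaleC]
      bounded_operator_compose[OF _ X.inner_product_space_axioms _ _ bounded_C]
      bounded_operator_compose[OF _ X.inner_product_space_axioms _ assms(2)] bounded_operator_hresolvent
      assms X.inner_product_space_axioms Y.inner_product_space_axioms)

text \<open>The quotient of \<open>emb k (B u) (D u)\<close> by z^k has constant coefficient mu_k^-1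
  D u, and its further coefficients are the terms of the resolvent series; the two functions thus
  have the same power series at z.\<close>

lemma transfer_function_eq:
  assumes b: "B u \<in> hcarrier X" and d: "D u \<in> hcarrier Y"
    and g: "g \<in> hcarrier \<H>" "(shift ^^ k) g = emb k (B u) (D u)" and z: "cmod z < 1"
  shows "transfer_function n k X A C B D z u = g z"
proof -
  have tc: "tc g i = tc (emb k (B u) (D u)) (i + k)" for i
    using g(1) unfolding g(2)[symmetric] by (simp add: tc_shift_pow)
  let ?f = "\<lambda>j. (of_nat ((n + j + (k + 1) - 1) choose (j + (k + 1))) * z ^ j) *\<^sub>C (A ^^ j) (B u)"
  let ?r = "hresolvent n (k + 1) X A z (B u)"
  have "hsums Y (\<lambda>j. C (?f j)) (C ?r)"
    using b by (intro hsums_bounded_operator[OF _ _ bounded_C] hresolvent_hsums(1) z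
        X.inner_product_space_axioms Y.inner_product_space_axioms) auto
  then have "hsums Y (\<lambda>j. z *\<^sub>C C (?f j)) (z *\<^sub>C C ?r)"
    using b by (intro Y.hsums_scale) auto
  moreover have "z *\<^sub>C C (?f j) = z ^ Suc j *\<^sub>C tc g (Suc j)" for j
  proof -
    \<comment> \<open>Term j of the resolvent carries the weight of index j + k + 1, the position of
      coefficient j + 1 of \<open>g\<close> before division by z^k.\<close>
    have "(n + j + (k + 1) - 1) choose (j + (k + 1)) = (n + (Suc j + k) - 1) choose (Suc j + k)"
      by (simp add: add.assoc)
    then have w: "of_nat ((n + j + (k + 1) - 1) choose (j + (k + 1))) = complex_of_real (inverse (\<mu> (Suc j + k)))"
      by (metis of_nat_binomial_bweight)
    show ?thesis
      unfolding w tc using b d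
      by (simp add: tc_emb bounded_operator_scale[OF bounded_C] scaleC_scaleC mult_ac)
  qed
  ultimately have "hsums Y (\<lambda>j. z ^ Suc j *\<^sub>C tc g (Suc j)) (z *\<^sub>C C ?r)"
    by simp
  then have "hsums Y (\<lambda>j. z ^ j *\<^sub>C tc g j) (z ^ 0 *\<^sub>C tc g 0 + z *\<^sub>C C ?r)"
    using g(1) by (intro Y.hsums_Suc) auto
  moreover have "z ^ 0 *\<^sub>C tc g 0 + z *\<^sub>C C ?r = transfer_function n k X A C B D z u"
    unfolding tc transfer_function_def using b d by (simp add: tc_emb scaleC_one)
  ultimately have "hsums Y (\<lambda>j. z ^ j *\<^sub>C tc g j) (transfer_function n k X A C B D z u)"
    by simp
  then show ?thesis
    using eval_sums[OF g(1) z] unfolding hsums_def by (rule Y.limitin_unique)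
qed

lemma emb_divisor:
  assumes "b \<in> hcarrier X" "d \<in> hcarrier Y"
  obtains g where "g \<in> hcarrier \<H>" "(shift ^^ k) g = emb k b d"
  using shift_pow_divisor[of "emb k b d" k] assms by (metis emb_mem tc_emb)

lemma mult_op_transfer_function:
  assumes U: "inner_product_space U" and B: "bounded_operator U X B" and D: "bounded_operator U Y D"
    and u: "u \<in> hcarrier U"
  shows "mult_op (transfer_function n k X A C B D) (monomial k u) = emb k (B u) (D u)"
    and "mult_op (transfer_function n k X A C B D) (monomial 0 u) \<in> hcarrier \<H>"
proof -
  note mem = bounded_operator_mem[OF B u] bounded_operator_mem[OF D u]
  have tf: "bounded_operator U Y (transfer_function n k X A C B D z)" if "cmod z < 1" for z
    using U B D that by (rule bounded_operator_transfer_function)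
  obtain g where g: "g \<in> hcarrier \<H>" "(shift ^^ k) g = emb k (B u) (D u)"
    using emb_divisor[OF mem] by blast
  have "mult_op (transfer_function n k X A C B D) (monomial 0 u) = g"
  proof
    fix z
    show "mult_op (transfer_function n k X A C B D) (monomial 0 u) z = g z"
      using transfer_function_eq[where B = B and D = D, OF mem g, of z] bergman_memD(3)[OF g(1), of z]
      by (cases "cmod z < 1") (simp_all add: mult_op_monomial[OF U tf u] scaleC_one)
  qed
  then show "mult_op (transfer_function n k X A C B D) (monomial 0 u) \<in> hcarrier \<H>"
    "mult_op (transfer_function n k X A C B D) (monomial k u) = emb k (B u) (D u)"
    using g shift_mult_op_monomial[where \<theta> = "transfer_function n k X A C B D" and j = k and k = 0, OF U tf u]
    by simp_all
qed

theorem transfer_functions_bergman_inner: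
  fixes U :: "nat \<Rightarrow> 'u::complex_vector hspace"
  assumes "\<And>k. cholesky_solution n k X Y A C (U k) (B k) (D k)"
  defines "\<Theta> \<equiv> \<lambda>k. transfer_function n k X A C (B k) (D k)"
  shows "bergman_inner_family n Y U \<Theta>" "annihilator = row_mult_op n Y \<Theta> ` hcarrier (tv_hardy U)"
proof -
  have U: "hilbert_space (U k)" and B: "bounded_operator (U k) X (B k)" and D: "bounded_operator (U k) Y (D k)" for k
    using assms(1)[of k] by (auto simp: cholesky_solution_def)
  have ips: "inner_product_space (U k)" for k
    using U[of k] by (simp add: hilbert_space_def)
  note mult = mult_op_transfer_function[OF ips B D, folded \<Theta>_def]
  have norm: "hnorm \<H> (mult_op (\<Theta> k) (monomial k u)) = hnorm (U k) u" if "u \<in> hcarrier (U k)" for k u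
    using cholesky_solutionD(2)[OF assms(1) that that] that by (simp add: \<Theta>_def mult hnorm_def)
  have wandering: "(\<lambda>u. mult_op (\<Theta> k) (monomial k u)) ` hcarrier (U k) = wandering annihilator k" for k
    unfolding emb_wandering_pairs[symmetric] cholesky_solutionD(1)[OF assms(1), symmetric] image_image
    by (rule image_cong) (simp_all add: \<Theta>_def mult)
  have bounded: "bounded_operator (U k) Y (\<Theta> k z)" if "cmod z < 1" for k z
    unfolding \<Theta>_def using ips B D that by (rule bounded_operator_transfer_function)
  have mem: "mult_op (\<Theta> k) (monomial 0 u) \<in> hcarrier \<H>" if "u \<in> hcarrier (U k)" for k u
    using that by (simp add: \<Theta>_def mult)
  note family = bergman_inner_familyI[OF closed_subspace_annihilator shift_annihilator U bounded norm
      wandering mem]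
  show "bergman_inner_family n Y U \<Theta>" "annihilator = row_mult_op n Y \<Theta> ` hcarrier (tv_hardy U)"
    using family by simp_all
qed

text \<open>Each value z^k Theta_k u lies in E_k and so comes from a wandering pair, which is unique
  because \<open>emb k\<close> is injective; linearity of \<open>B\<close> and \<open>D\<close>
  follows from this uniqueness.\<close>

theorem wandering_family_transfer_functions:
  fixes U :: "nat \<Rightarrow> 'u::complex_vector hspace"
  assumes U: "\<And>k. hilbert_space (U k)"
    and bounded: "\<And>k z. cmod z < 1 \<Longrightarrow> bounded_operator (U k) Y (\<Theta> k z)"
    and norm: "\<And>k u. u \<in> hcarrier (U k) \<Longrightarrow> hnorm \<H> (mult_op (\<Theta> k) (monomial k u)) = hnorm (U k) u"
    and wandering: "\<And>k. (\<lambda>u. mult_op (\<Theta> k) (monomial k u)) ` hcarrier (U k) = wandering annihilator k"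
    and mem: "\<And>k u. u \<in> hcarrier (U k) \<Longrightarrow> mult_op (\<Theta> k) (monomial 0 u) \<in> hcarrier \<H>"
  shows "\<exists>B D. \<forall>k. cholesky_solution n k X Y A C (U k) (B k) (D k) \<and>
    (\<forall>z u. cmod z < 1 \<and> u \<in> hcarrier (U k) \<longrightarrow> \<Theta> k z u = transfer_function n k X A C (B k) (D k) z u)"
proof -
  have ips: "inner_product_space (U k)" for k
    using U[of k] by (simp add: hilbert_space_def)
  have "\<exists>B D. cholesky_solution n k X Y A C (U k) B D \<and>
      (\<forall>z u. cmod z < 1 \<and> u \<in> hcarrier (U k) \<longrightarrow> \<Theta> k z u = transfer_function n k X A C B D z u)" for k
  proof -
    interpret U: hilbert_space "U k"
      by (rule U)
    let ?m = "\<lambda>u. mult_op (\<Theta> k) (monomial k u)"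
    note m = mult_op_monomial[OF U.inner_product_space_axioms bounded]
    have m_add: "?m (u + v) = ?m u + ?m v" if "u \<in> hcarrier (U k)" "v \<in> hcarrier (U k)" for u v
      using that by (simp add: fun_eq_iff m bounded_operator_add[OF bounded] scaleC_add_right)
    have m_scale: "?m (a *\<^sub>C u) = a *\<^sub>C ?m u" if "u \<in> hcarrier (U k)" for a u
      using that by (simp add: fun_eq_iff m bounded_operator_scale[OF bounded] scaleC_scaleC
          scaleC_fun_apply mult.commute)
    have "?m u \<in> wandering annihilator k" if "u \<in> hcarrier (U k)" for u
      using wandering[of k] that by blast
    then have "\<forall>u. \<exists>p. u \<in> hcarrier (U k) \<longrightarrow> p \<in> wandering_pairs k \<and> ?m u = emb k (fst p) (snd p)"
      unfolding emb_wandering_pairs[symmetric] by force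
    then obtain T where T: "\<And>u. u \<in> hcarrier (U k) \<Longrightarrow> T u \<in> wandering_pairs k"
      "\<And>u. u \<in> hcarrier (U k) \<Longrightarrow> ?m u = emb k (fst (T u)) (snd (T u))"
      by metis
    define B D where "B u = fst (T u)" and "D u = snd (T u)" for u
    have m_emb: "?m u = emb k (B u) (D u)" and BD: "B u \<in> hcarrier X" "D u \<in> hcarrier Y"
      if "u \<in> hcarrier (U k)" for u
      using T[OF that] by (auto simp: B_def D_def wandering_pairs_def)
    have m_mem: "?m u \<in> hcarrier \<H>" if "u \<in> hcarrier (U k)" for u
      using that BD by (simp add: m_emb)
    have bounded_m: "bounded_operator (U k) \<H> ?m"
      by (rule bounded_operatorI[where c = 1]) (use m_mem m_add m_scale norm in auto)
    have emb_inject: "b = b' \<and> d = d'"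
      if "emb k b d = emb k b' d'" "b \<in> hcarrier X" "b' \<in> hcarrier X" "d \<in> hcarrier Y" "d' \<in> hcarrier Y"
      for b b' d d'
    proof -
      have "emb k (b - b') (d - d') = 0"
        using that by (simp add: emb_diff)
      then have "b - b' = 0" "d - d' = 0"
        using emb_eq_0[of "b - b'" "d - d'" k] that(2-5) by auto
      then show ?thesis
        by simp
    qed
    have "cholesky_solution n k X Y A C (U k) B D"
    proof (rule cholesky_solutionI[OF U])
      show "(\<lambda>u. (B u, D u)) ` hcarrier (U k) = wandering_pairs k"
      proof
        show "(\<lambda>u. (B u, D u)) ` hcarrier (U k) \<subseteq> wandering_pairs k"
          using T(1) by (auto simp: B_def D_def)
        show "wandering_pairs k \<subseteq> (\<lambda>u. (B u, D u)) ` hcarrier (U k)"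
        proof clarify
          fix b d
          assume p: "(b, d) \<in> wandering_pairs k"
          then have "emb k b d \<in> wandering annihilator k"
            unfolding emb_wandering_pairs[symmetric] by force
          then obtain u where u: "u \<in> hcarrier (U k)" "emb k b d = ?m u"
            unfolding wandering[symmetric] by blast
          have "b = B u \<and> d = D u"
            using p BD[OF u(1)] u(2) by (intro emb_inject) (auto simp: m_emb[OF u(1)] wandering_pairs_def)
          with u(1) show "(b, d) \<in> (\<lambda>u. (B u, D u)) ` hcarrier (U k)"
            by auto
        qed
      qed
      show "B (u + v) = B u + B v \<and> D (u + v) = D u + D v"
        if "u \<in> hcarrier (U k)" "v \<in> hcarrier (U k)" for u v
        using that BD m_add[OF that] by (intro emb_inject) (simp_all add: m_emb emb_add)
      show "B (a *\<^sub>C u) = a *\<^sub>C B u \<and> D (a *\<^sub>C u) = a *\<^sub>C D u"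
        if "u \<in> hcarrier (U k)" for a u
        using that BD m_scale[OF that, of a] by (intro emb_inject) (simp_all add: m_emb emb_scale)
      show "hinner (U k) u v = hinner \<H> (emb k (B u) (D u)) (emb k (B v) (D v))"
        if "u \<in> hcarrier (U k)" "v \<in> hcarrier (U k)" for u v
        using isometric_imp_inner[OF ips \<H>.inner_product_space_axioms bounded_m norm that] that
        by (simp add: m_emb)
    qed
    moreover have "\<Theta> k z u = transfer_function n k X A C B D z u"
      if z: "cmod z < 1" and u: "u \<in> hcarrier (U k)" for z u
    proof -
      have "(shift ^^ k) (mult_op (\<Theta> k) (monomial 0 u)) = emb k (B u) (D u)"
        using shift_mult_op_monomial[OF ips bounded[where k = k] u, where j = k and k = 0] m_emb[OF u]
        by simp
      from transfer_function_eq[where B = B and D = D, OF BD[OF u] mem[OF u] this z] show ?thesis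
        using z by (simp add: m[OF _ u] scaleC_one)
    qed
    ultimately show ?thesis
      by blast
  qed
  then show ?thesis
    by metis
qed

end

subsection \<open>Defect operators\<close>

text \<open>Pascal's rule. Applied to the inner products of A^j y and A^j x it says that each defect
  form is a difference of the preceding one at (x, y) and at (A x, A y).\<close>

lemma alternating_binomial_sum_Suc:
  fixes s :: "nat \<Rightarrow> complex"
  shows "(\<Sum>j\<le>Suc m. ((-1) ^ j * of_nat (Suc m choose j)) * s j) =
    (\<Sum>j\<le>m. ((-1) ^ j * of_nat (m choose j)) * s j) - (\<Sum>j\<le>m. ((-1) ^ j * of_nat (m choose j)) * s (Suc j))"
proof -
  let ?t = "\<lambda>m j. ((-1) ^ j * of_nat (m choose j)) * s j"
  have "(\<Sum>j\<le>Suc m. ?t (Suc m) j) = ?t (Suc m) 0 + (\<Sum>j\<le>m. ?t (Suc m) (Suc j))"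
    by (rule sum.atMost_Suc_shift)
  also have "(\<Sum>j\<le>m. ?t (Suc m) (Suc j)) =
      (\<Sum>j\<le>m. ?t m (Suc j)) - (\<Sum>j\<le>m. ((-1) ^ j * of_nat (m choose j)) * s (Suc j))"
    unfolding sum_subtractf[symmetric] by (rule sum.cong) (simp_all add: algebra_simps)
  also have "?t (Suc m) 0 + ((\<Sum>j\<le>m. ?t m (Suc j)) - (\<Sum>j\<le>m. ((-1) ^ j * of_nat (m choose j)) * s (Suc j))) =
      (\<Sum>j\<le>Suc m. ?t m j) - (\<Sum>j\<le>m. ((-1) ^ j * of_nat (m choose j)) * s (Suc j))"
    by (simp only: sum.atMost_Suc_shift) simp
  also have "(\<Sum>j\<le>Suc m. ?t m j) = (\<Sum>j\<le>m. ?t m j)"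
    by simp
  finally show ?thesis .
qed

lemma defect_mem:
  assumes "hilbert_space X" "bounded_operator X X A" "x \<in> hcarrier X"
  shows "defect m X A x \<in> hcarrier X"
proof -
  interpret X: hilbert_space X
    by (rule assms)
  note mem = bounded_operator_mem[OF bounded_operator_funpow[OF X.inner_product_space_axioms assms(2)]]
  show ?thesis
    unfolding defect_def
    by (intro X.sum_mem X.scale_mem inner_hadjoint_pow(2)[OF assms(1,2) assms(3)] mem assms(3))
qed

lemma inner_defect:
  assumes "hilbert_space X" "bounded_operator X X A" "x \<in> hcarrier X" "y \<in> hcarrier X"
  shows "hinner X y (defect m X A x) =
    (\<Sum>j\<le>m. ((-1) ^ j * of_nat (m choose j)) * hinner X ((A ^^ j) y) ((A ^^ j) x))"
proof -
  interpret X: hilbert_space X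
    by (rule assms)
  note mem = bounded_operator_mem[OF bounded_operator_funpow[OF X.inner_product_space_axioms assms(2)]]
  show ?thesis
    unfolding defect_def using assms(3,4)
    by (simp add: X.inner_sum_right X.inner_scale2 mem inner_hadjoint_pow[OF assms(1,2)])
qed

lemma inner_defect_0:
  assumes "hilbert_space X" "bounded_operator X X A" "x \<in> hcarrier X" "y \<in> hcarrier X"
  shows "hinner X y (defect 0 X A x) = hinner X y x"
  unfolding inner_defect[OF assms] by simp

lemma inner_defect_Suc:
  assumes "hilbert_space X" "bounded_operator X X A" "x \<in> hcarrier X" "y \<in> hcarrier X"
  shows "hinner X y (defect (Suc m) X A x) =
    hinner X y (defect m X A x) - hinner X (A y) (defect m X A (A x))"
  unfolding inner_defect[OF assms] inner_defect[OF assms(1,2) bounded_operator_mem[OF assms(2,3)]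
      bounded_operator_mem[OF assms(2,4)]] alternating_binomial_sum_Suc
  by (simp add: funpow_swap1)

subsection \<open>Strongly stable hypercontractions\<close>

text \<open>Disposes of the boundary term in the summation by parts. Past a suitable K the products
  w_j g_N are at most w_j g_j, a small tail; the terms before K are a fixed multiple of g_N.\<close>

lemma sum_times_decseq_tendsto_0:
  fixes w g :: "nat \<Rightarrow> real"
  assumes w: "\<And>j. 0 \<le> w j" and g: "\<And>j. 0 \<le> g j" "\<And>j. g (Suc j) \<le> g j" "g \<longlonglongrightarrow> 0"
    and s: "summable (\<lambda>j. w j * g j)"
  shows "(\<lambda>N. (\<Sum>j<N. w j) * g N) \<longlonglongrightarrow> 0"
  unfolding LIMSEQ_iff
proof (intro allI impI)
  fix e :: real
  assume "e > 0"
  then have e2: "e / 2 > 0"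
    by simp
  from s e2 obtain K where K: "\<And>m n. m \<ge> K \<Longrightarrow> norm (\<Sum>j=m..<n. w j * g j) < e / 2"
    unfolding summable_Cauchy by blast
  have "(\<lambda>N. (\<Sum>j<K. w j) * g N) \<longlonglongrightarrow> 0"
    by (rule tendsto_mult_right_zero[OF g(3)])
  with e2 obtain L where L: "\<And>N. N \<ge> L \<Longrightarrow> norm ((\<Sum>j<K. w j) * g N - 0) < e / 2"
    unfolding LIMSEQ_iff by blast
  have dec: "g N \<le> g j" if "j \<le> N" for j N
    using lift_Suc_antimono_le[of g] g(2) that by blast
  have "norm ((\<Sum>j<N. w j) * g N - 0) < e" if N: "N \<ge> max K L" for N
  proof -
    have "(\<Sum>j<N. w j) = (\<Sum>j<K. w j) + (\<Sum>j=K..<N. w j)"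
      using N sum.atLeastLessThan_concat[of 0 K N w] by (simp add: lessThan_atLeast0)
    then have "(\<Sum>j<N. w j) * g N = (\<Sum>j<K. w j) * g N + (\<Sum>j=K..<N. w j * g N)"
      by (simp add: distrib_right sum_distrib_right)
    also have "\<dots> \<le> (\<Sum>j<K. w j) * g N + (\<Sum>j=K..<N. w j * g j)"
      using w dec by (intro add_left_mono sum_mono mult_left_mono) auto
    also have "\<dots> < e / 2 + e / 2"
      using K[of K N] L[of N] N by (intro add_strict_mono) auto
    finally have "(\<Sum>j<N. w j) * g N < e"
      by simp
    moreover have "0 \<le> (\<Sum>j<N. w j) * g N"
      using w g(1) by (intro mult_nonneg_nonneg sum_nonneg) auto
    ultimately show ?thesis
      by simp
  qed
  then show "\<exists>N0. \<forall>N\<ge>N0. norm ((\<Sum>j<N. w j) * g N - 0) < e"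
    by blast
qed

text \<open>The inverse weights of order m + 1 are the partial sums of those of order m.\<close>

lemma binomial_partial_sum: "(\<Sum>j<Suc N. real ((m + j - 1) choose j)) = real ((m + N) choose N)"
  by (induction N) simp_all

text \<open>The weighted sum of the m-th defect form along the orbit of x equals the squared norm of
  x for every m up to n, by induction on m. At m = n the defect is the adjoint of C composed with C,
  and the sum is the observability series.\<close>

lemma (in bergman_space) isometric_pair_hypercontraction:
  assumes X: "hilbert_space X" and hyper: "hypercontraction n X A" and stable: "strongly_stable X A"
    and C: "bounded_operator X Y C"
    and defect: "\<And>x. x \<in> hcarrier X \<Longrightarrow> hadjoint X Y C (C x) = defect n X A x"
  shows "isometric_pair n Y X A C"
proof (rule isometric_pair.intro[OF bergman_space_axioms], rule isometric_pair_axioms.intro[OF X _ C])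
  interpret X: hilbert_space X
    by (rule X)
  show A: "bounded_operator X X A"
    using hyper by (simp add: hypercontraction_def)
  note A_mem = bounded_operator_mem[OF A]
    and A_pow_mem = bounded_operator_mem[OF bounded_operator_funpow[OF X.inner_product_space_axioms A]]
  fix x
  assume x: "x \<in> hcarrier X"
  define g where "g m j = Re (hinner X ((A ^^ j) x) (defect m X A ((A ^^ j) x)))" for m j
  have g_Suc: "g (Suc m) j = g m j - g m (Suc j)" for m j
    using inner_defect_Suc[OF X A A_pow_mem[OF x] A_pow_mem[OF x], of j m j] by (simp add: g_def)
  have g_nonneg: "0 \<le> g m j" if m: "m \<le> n" for m j
  proof -
    have "hinner X (defect m X A ((A ^^ j) x)) ((A ^^ j) x) \<in> \<real>\<^sub>\<ge>\<^sub>0"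
      using hyper m A_pow_mem[OF x] by (auto simp: hypercontraction_def hpositive_def)
    then show ?thesis
      using X.inner_commute[OF A_pow_mem[OF x] defect_mem[OF X A A_pow_mem[OF x]], of j m j]
      by (simp add: g_def complex_nonneg_Reals_iff)
  qed
  have g_0: "g 0 j = (hnorm X ((A ^^ j) x))\<^sup>2" for j
    using A_pow_mem[OF x] by (simp add: g_def inner_defect_0[OF X A] X.norm_power2)
  have g_0_lim: "g 0 \<longlonglongrightarrow> 0"
    using tendsto_power[OF stable[unfolded strongly_stable_def, rule_format, OF x], of 2] by (simp add: g_0[abs_def])
  \<comment> \<open>Every further difference subtracts a nonnegative term, so all orders inherit the
    decay that strong stability provides at order 0.\<close>
  have g_le: "g m j \<le> g 0 j" if "m \<le> n" for m j
    using that
  proof (induction m)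
    case (Suc m)
    then show ?case
      using g_Suc[of m j] g_nonneg[of m "Suc j"] by simp
  qed simp
  have g_lim: "g m \<longlonglongrightarrow> 0" if "m \<le> n" for m
    by (rule real_tendsto_0_le[OF _ g_0_lim]) (use g_le[OF that] g_nonneg[OF that] in simp)
  have "(\<lambda>j. real ((m + j - 1) choose j) * g m j) sums (hnorm X x)\<^sup>2" if "m \<le> n" for m
    using that
  proof (induction m)
    case 0
    \<comment> \<open>At order 0 the weight \<open>(j - 1) choose j\<close> is 1 at j = 0 and 0
      elsewhere.\<close>
    have "(\<lambda>j. real ((0 + j - 1) choose j) * g 0 j) sums (\<Sum>j\<in>{0}. real ((0 + j - 1) choose j) * g 0 j)"
      by (rule sums_finite) auto
    then show ?case
      by (simp add: g_0)
  next
    case (Suc m)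
    let ?w = "\<lambda>j. real ((m + j - 1) choose j)"
    have IH: "(\<lambda>j. ?w j * g m j) sums (hnorm X x)\<^sup>2"
      using Suc by simp
    \<comment> \<open>Summation by parts: the form of order m + 1 is a difference of that of order
      m, and its weights are partial sums of the weights of order m.\<close>
    have part: "(\<Sum>j<N. real ((Suc m + j - 1) choose j) * g (Suc m) j) =
        (\<Sum>j<N. ?w j * g m j) - (\<Sum>j<N. ?w j) * g m N" for N
    proof (induction N)
      case (Suc N)
      have "real ((Suc m + N - 1) choose N) = (\<Sum>j<N. ?w j) + ?w N"
        using binomial_partial_sum[of m N] by simp
      then show ?case
        using Suc.IH by (simp add: g_Suc algebra_simps)
    qed simp
    have "(\<lambda>N. (\<Sum>j<N. ?w j) * g m N) \<longlonglongrightarrow> 0"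
    proof (rule sum_times_decseq_tendsto_0)
      \<comment> \<open>Monotonicity at order m is positivity at order m + 1, available because m +
        1 does not exceed n.\<close>
      show "g m (Suc j) \<le> g m j" for j
        using g_nonneg[OF Suc.prems, of j] g_Suc[of m j] by simp
    qed (use Suc.prems g_nonneg g_lim IH in \<open>auto simp: sums_iff\<close>)
    with IH have "(\<lambda>N. (\<Sum>j<N. ?w j * g m j) - (\<Sum>j<N. ?w j) * g m N) \<longlonglongrightarrow> (hnorm X x)\<^sup>2 - 0"
      unfolding sums_def by (rule tendsto_diff)
    then show ?case
      unfolding sums_def part by simp
  qed
  from this[of n] have "(\<lambda>j. inverse (\<mu> j) * g n j) sums (hnorm X x)\<^sup>2"
    by (simp add: inverse_bweight)
  moreover have "g n j = (hnorm Y (C ((A ^^ j) x)))\<^sup>2" for j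
    using inner_hadjoint[OF X Y.inner_product_space_axioms C, of "C ((A ^^ j) x)" "(A ^^ j) x"]
      A_pow_mem[OF x] bounded_operator_mem[OF C]
    by (simp add: g_def Y.norm_power2 flip: defect)
  ultimately show "(\<lambda>j. inverse (\<mu> j) * (hnorm Y (C ((A ^^ j) x)))\<^sup>2) sums (hnorm X x)\<^sup>2"
    by simp
qed

subsection \<open>The backward shift on the complement of an invariant subspace\<close>

context bergman_space
begin

abbreviation "Sstar \<equiv> hadjoint \<H> \<H> shift"

lemma Sstar_mem [simp]: "f \<in> hcarrier \<H> \<Longrightarrow> Sstar f \<in> hcarrier \<H>"
  by (rule hadjoint_mem[OF hilbert_bergman \<H>.inner_product_space_axioms bounded_operator_shift])

lemma Sstar_pow_mem [simp]: "f \<in> hcarrier \<H> \<Longrightarrow> (Sstar ^^ k) f \<in> hcarrier \<H>"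
  by (induction k) auto

lemma tc_Sstar:
  assumes f: "f \<in> hcarrier \<H>"
  shows "tc (Sstar f) j = of_real (\<mu> (Suc j) / \<mu> j) *\<^sub>C tc f (Suc j)"
proof -
  note c = backward_shift_mem[OF f, of 1]
  have "Sstar f = bfun (\<lambda>j. of_real (\<mu> (j + 1) / \<mu> j) *\<^sub>C tc f (j + 1))"
  proof (rule hadjoint_eqI[OF \<H>.inner_product_space_axioms bfun_mem[OF c]])
    fix v
    assume v: "v \<in> hcarrier \<H>"
    then have sv: "shift v \<in> hcarrier \<H>"
      by simp
    have "hinner \<H> (bfun (\<lambda>j. of_real (\<mu> (j + 1) / \<mu> j) *\<^sub>C tc f (j + 1))) v = hinner \<H> f (shift v)"
      using inner_backward_shift[OF f v, of 1] by simp
    then show "hinner \<H> (shift v) f = hinner \<H> v (bfun (\<lambda>j. of_real (\<mu> (j + 1) / \<mu> j) *\<^sub>C tc f (j + 1)))"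
      using \<H>.inner_commute[OF sv f] \<H>.inner_commute[OF v bfun_mem[OF c]] by simp
  qed
  then show ?thesis
    using tc_bfun[OF c] by simp
qed

lemma tc_Sstar_pow:
  assumes f: "f \<in> hcarrier \<H>"
  shows "tc ((Sstar ^^ k) f) j = of_real (\<mu> (j + k) / \<mu> j) *\<^sub>C tc f (j + k)"
proof (induction k arbitrary: j)
  case (Suc k)
  have "tc ((Sstar ^^ Suc k) f) j = of_real (\<mu> (Suc j) / \<mu> j) *\<^sub>C (of_real (\<mu> (Suc j + k) / \<mu> (Suc j)) *\<^sub>C tc f (Suc j + k))"
    using f by (simp add: tc_Sstar Suc)
  also have "\<dots> = of_real (\<mu> (j + Suc k) / \<mu> j) *\<^sub>C tc f (j + Suc k)"
    by (simp add: scaleC_scaleC)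
  finally show ?case .
qed (simp add: scaleC_one)

text \<open>Weights decrease, so the squared norm of the k-th backward shift is at most the k-th
  tail of the series for the squared norm of \<open>f\<close>.\<close>

lemma Sstar_pow_tendsto_0:
  assumes f: "f \<in> hcarrier \<H>"
  shows "(\<lambda>k. hnorm \<H> ((Sstar ^^ k) f)) \<longlonglongrightarrow> 0"
proof -
  have s: "summable (\<lambda>j. \<mu> j * (hnorm Y (tc f j))\<^sup>2)"
    using norm_sums[OF f] by (simp add: sums_iff)
  have "(hnorm \<H> ((Sstar ^^ k) f))\<^sup>2 \<le> (\<Sum>j. \<mu> (j + k) * (hnorm Y (tc f (j + k)))\<^sup>2)" for k
  proof (rule sums_le[OF _ norm_sums summable_sums])
    show "summable (\<lambda>j. \<mu> (j + k) * (hnorm Y (tc f (j + k)))\<^sup>2)"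
      using s by (subst summable_iff_shift)
    fix j
    have "\<mu> j * (hnorm Y (tc ((Sstar ^^ k) f) j))\<^sup>2 =
        (\<mu> (j + k) / \<mu> j) * (\<mu> (j + k) * (hnorm Y (tc f (j + k)))\<^sup>2)"
      using f by (simp add: tc_Sstar_pow Y.norm_scale norm_divide power_mult_distrib power2_eq_square)
    also have "\<dots> \<le> 1 * (\<mu> (j + k) * (hnorm Y (tc f (j + k)))\<^sup>2)"
      using bweight_antimono[OF n_pos, of j k] by (intro mult_right_mono) auto
    finally show "\<mu> j * (hnorm Y (tc ((Sstar ^^ k) f) j))\<^sup>2 \<le> \<mu> (j + k) * (hnorm Y (tc f (j + k)))\<^sup>2"
      by simp
  qed (use f in simp)
  then have "(\<lambda>k. (hnorm \<H> ((Sstar ^^ k) f))\<^sup>2) \<longlonglongrightarrow> 0"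
    by (intro real_tendsto_0_le[OF _ suminf_exist_split2[OF s]]) simp
  then have "(\<lambda>k. sqrt ((hnorm \<H> ((Sstar ^^ k) f))\<^sup>2)) \<longlonglongrightarrow> sqrt 0"
    by (rule tendsto_real_sqrt)
  then show ?thesis
    using f by simp
qed

context
  fixes M
  assumes M: "closed_subspace \<H> M" and invariant: "shift ` M \<subseteq> M"
begin

abbreviation "model \<equiv> hsubspace \<H> (orth_compl \<H> M)"

lemma model_mem: "f \<in> orth_compl \<H> M \<Longrightarrow> f \<in> hcarrier \<H>"
  by (simp add: orth_compl_def)

lemma hilbert_model: "hilbert_space model"
  using M by (intro \<H>.hilbert_hsubspace \<H>.closed_subspace_orth_compl) (simp add: closed_subspace_def)

lemma Sstar_model: "f \<in> orth_compl \<H> M \<Longrightarrow> Sstar f \<in> orth_compl \<H> M"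
  using invariant invariant_mem[OF M invariant]
  by (auto simp: orth_compl_def
      inner_hadjoint_left[OF hilbert_bergman \<H>.inner_product_space_axioms bounded_operator_shift])

lemma bounded_operator_Sstar_model: "bounded_operator model model Sstar"
  using bounded_operator_hadjoint[OF hilbert_bergman \<H>.inner_product_space_axioms bounded_operator_shift]
    Sstar_model model_mem
  unfolding bounded_operator_def by simp blast

lemma bounded_operator_eval_model: "bounded_operator model Y (\<lambda>f. f 0)"
  using bounded_operator_eval_0 model_mem unfolding bounded_operator_def by simp blast

lemma eval_Sstar_pow:
  "f \<in> hcarrier \<H> \<Longrightarrow> ((Sstar ^^ j) f) 0 = of_real (\<mu> j) *\<^sub>C tc f j"
  by (simp add: eval_0 tc_Sstar_pow)

text \<open>Evaluation of the j-th backward shift at 0 is mu_j times the j-th coefficient; the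
  observability series is therefore the series of the Bergman norm.\<close>

lemma isometric_pair_model: "isometric_pair n Y model Sstar (\<lambda>f. f 0)"
proof (rule isometric_pair.intro[OF bergman_space_axioms], rule isometric_pair_axioms.intro[OF
      hilbert_model bounded_operator_Sstar_model bounded_operator_eval_model])
  fix f
  assume "f \<in> hcarrier model"
  then have f: "f \<in> hcarrier \<H>"
    by (simp add: model_mem)
  have "inverse (\<mu> j) * (hnorm Y (((Sstar ^^ j) f) 0))\<^sup>2 = \<mu> j * (hnorm Y (tc f j))\<^sup>2" for j
    using f by (simp add: eval_Sstar_pow Y.norm_scale power_mult_distrib power2_eq_square)
  with norm_sums[OF f] show "(\<lambda>j. inverse (\<mu> j) * (hnorm Y (((Sstar ^^ j) f) 0))\<^sup>2) sums (hnorm model f)\<^sup>2"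
    by simp
qed

text \<open>V_0 acts as the identity on the complement of \<open>M\<close>, and the double
  complement returns \<open>M\<close>.\<close>

lemma annihilator_model: "isometric_pair.annihilator n Y model Sstar (\<lambda>f. f 0) = M"
proof -
  interpret isometric_pair n Y model Sstar "\<lambda>f. f 0"
    by (rule isometric_pair_model)
  have "obs 0 f = f" if "f \<in> orth_compl \<H> M" for f
    using that model_mem[OF that]
    by (intro bergman_eqI) (auto simp: tc_obs eval_Sstar_pow scaleC_scaleC scaleC_one)
  then have "obs 0 ` hcarrier model = orth_compl \<H> M"
    by force
  then show ?thesis
    unfolding annihilator_def by (simp add: \<H>.orth_compl_orth_compl[OF M])
qed

text \<open>The defect forms are diagonal in the Taylor coefficients. Each further difference lowers
  the upper binomial index by Pascal's rule, starting from mu_l at m = 0.\<close>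

lemma inner_defect_model:
  assumes "m \<le> n" "f \<in> orth_compl \<H> M" "g \<in> orth_compl \<H> M"
  shows "(\<lambda>l. of_real ((\<mu> l)\<^sup>2 * real ((n - m + l - 1) choose l)) * hinner Y (tc g l) (tc f l)) sums
    hinner \<H> g (defect m model Sstar f)"
  using assms
proof (induction m arbitrary: f g)
  case 0
  have "(\<mu> l)\<^sup>2 * real ((n - 0 + l - 1) choose l) = \<mu> l" for l
    unfolding minus_nat.diff_0 inverse_bweight[symmetric] by (simp add: power2_eq_square)
  then show ?case
    using inner_sums[of g f] 0 model_mem
      inner_defect_0[OF hilbert_model bounded_operator_Sstar_model, of f g] by (simp add: mult.commute)
next
  case (Suc m)
  obtain p where p: "n - m = Suc p" "n - Suc m = p"
    using Suc.prems(1) by (metis Suc_diff_Suc Suc_le_lessD)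
  have fH: "f \<in> hcarrier \<H>" and gH: "g \<in> hcarrier \<H>"
    using Suc.prems model_mem by auto
  let ?c = "\<lambda>q l. of_real ((\<mu> l)\<^sup>2 * real ((q + l - 1) choose l)) * hinner Y (tc g l) (tc f l)"
  \<comment> \<open>The form at the backward shifts, moved up by one index: the ratio in
    \<open>tc_Sstar\<close> replaces mu_l^2 by mu_(l+1)^2. The value 0 at l = 0 reflects that the
    constant coefficient is lost.\<close>
  let ?s = "\<lambda>l. of_real ((\<mu> l)\<^sup>2 * (case l of 0 \<Rightarrow> 0 | Suc i \<Rightarrow> real ((p + i) choose i))) * hinner Y (tc g l) (tc f l)"
  have 1: "?c (Suc p) sums hinner \<H> g (defect m model Sstar f)"
    using Suc.IH[of f g] Suc.prems by (simp add: p)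
  have "(\<lambda>l. of_real ((\<mu> l)\<^sup>2 * real ((Suc p + l - 1) choose l)) * hinner Y (tc (Sstar g) l) (tc (Sstar f) l)) sums
      hinner \<H> (Sstar g) (defect m model Sstar (Sstar f))"
    using Suc.IH[of "Sstar f" "Sstar g"] Suc.prems Sstar_model unfolding p by simp
  moreover have "of_real ((\<mu> l)\<^sup>2 * real ((Suc p + l - 1) choose l)) * hinner Y (tc (Sstar g) l) (tc (Sstar f) l) =
      ?s (Suc l)" for l
    using fH gH by (simp add: tc_Sstar Y.inner_scale Y.inner_scale2 power2_eq_square)
  ultimately have "(\<lambda>l. ?s (Suc l)) sums hinner \<H> (Sstar g) (defect m model Sstar (Sstar f))"
    by (simp only:)
  then have 2: "?s sums hinner \<H> (Sstar g) (defect m model Sstar (Sstar f))"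
    by (subst (asm) sums_Suc_iff) simp
  have "?c (Suc p) l - ?s l = ?c p l" for l
    by (cases l) (simp_all add: algebra_simps)
  with sums_diff[OF 1 2] show ?case
    using inner_defect_Suc[OF hilbert_model bounded_operator_Sstar_model, of f g m] Suc.prems
    by (simp add: p)
qed

lemma defect_model_mem: "f \<in> orth_compl \<H> M \<Longrightarrow> defect m model Sstar f \<in> orth_compl \<H> M"
  using defect_mem[OF hilbert_model bounded_operator_Sstar_model, of f m] by simp

text \<open>The diagonal weights are nonnegative, so each defect form is a real, nonnegative
  sum.\<close>

lemma hypercontraction_model: "hypercontraction n model Sstar"
  unfolding hypercontraction_def
proof (intro conjI allI impI bounded_operator_Sstar_model)
  fix m
  assume m: "m \<le> n"
  have "hinner \<H> (defect m model Sstar f) f \<in> \<real>\<^sub>\<ge>\<^sub>0" if f: "f \<in> orth_compl \<H> M" for f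
  proof -
    note fH = model_mem[OF f] and dH = model_mem[OF defect_model_mem[OF f]]
    have s: "(\<lambda>l. complex_of_real (((\<mu> l)\<^sup>2 * real ((n - m + l - 1) choose l)) * (hnorm Y (tc f l))\<^sup>2)) sums
        hinner \<H> f (defect m model Sstar f)"
      using inner_defect_model[OF m f f] fH by (simp add: Y.inner_self)
    have "(\<lambda>l. 0) sums Im (hinner \<H> f (defect m model Sstar f))"
      using sums_Im[OF s] by (simp only: Im_complex_of_real)
    then have "Im (hinner \<H> f (defect m model Sstar f)) = 0"
      by (rule sums_unique2[OF _ sums_zero])
    moreover have "0 \<le> Re (hinner \<H> f (defect m model Sstar f))"
      using sums_Re[OF s] unfolding Re_complex_of_real by (rule sums_le[OF _ sums_zero, rotated]) simp
    ultimately show ?thesis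
      using \<H>.inner_commute[OF fH dH, of m] by (simp add: complex_nonneg_Reals_iff)
  qed
  then show "hpositive model (defect m model Sstar)"
    by (simp add: hpositive_def)
qed

lemma strongly_stable_model: "strongly_stable model Sstar"
  by (simp add: strongly_stable_def Sstar_pow_tendsto_0 model_mem)

text \<open>At m = n the weight \<open>(l - 1) choose l\<close> leaves only the constant
  coefficient, which is the value at 0.\<close>

lemma defect_eq_model:
  assumes f: "f \<in> orth_compl \<H> M"
  shows "hadjoint model Y (\<lambda>f. f 0) (f 0) = defect n model Sstar f"
proof (rule hadjoint_eqI)
  show "inner_product_space model"
    using hilbert_model by (simp add: hilbert_space_def)
  show "defect n model Sstar f \<in> hcarrier model"
    using defect_model_mem[OF f] by simp
  fix g
  assume "g \<in> hcarrier model"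
  then have g: "g \<in> orth_compl \<H> M"
    by simp
  let ?c = "\<lambda>l. of_real ((\<mu> l)\<^sup>2 * real ((n - n + l - 1) choose l)) * hinner Y (tc g l) (tc f l)"
  have "?c sums (\<Sum>l\<in>{0}. ?c l)"
    by (rule sums_finite) auto
  then have "hinner \<H> g (defect n model Sstar f) = hinner Y (tc g 0) (tc f 0)"
    using sums_unique2[OF inner_defect_model[OF order_refl f g]] by simp
  then show "hinner Y (g 0) (f 0) = hinner model g (defect n model Sstar f)"
    using f g model_mem by (simp add: eval_0)
qed

text \<open>A vector y orthogonal to all values f(0) makes the constant function y orthogonal to the
  complement of \<open>M\<close>, so this constant lies in \<open>M\<close>.\<close>

lemma dense_range_model:
  assumes const: "\<And>y. y \<in> hcarrier Y \<Longrightarrow> monomial 0 y \<in> M \<Longrightarrow> y = 0"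
  shows "dense_range model Y (\<lambda>f. f 0)"
proof -
  let ?R = "(\<lambda>f. f 0) ` hcarrier model"
  interpret X: hilbert_space model
    by (rule hilbert_model)
  note C = bounded_operator_eval_model
  have R: "?R \<subseteq> hcarrier Y"
    using bounded_operator_mem[OF C] by auto
  have sub: "complex_vector.subspace ?R"
  proof (rule complex_vector.subspaceI)
    show "0 \<in> ?R"
      using X.zero_mem by (intro image_eqI[of _ _ 0]) simp_all
    show "x + y \<in> ?R" if xy: "x \<in> ?R" "y \<in> ?R" for x y
    proof -
      obtain f where "x = f 0" "f \<in> hcarrier model"
        using xy(1) by (rule imageE)
      moreover obtain g where "y = g 0" "g \<in> hcarrier model"
        using xy(2) by (rule imageE)
      ultimately show ?thesis
        using X.add_mem by (intro image_eqI[of _ _ "f + g"]) simp_all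
    qed
    show "a *\<^sub>C x \<in> ?R" if x: "x \<in> ?R" for a x
    proof -
      obtain f where "x = f 0" "f \<in> hcarrier model"
        using x by (rule imageE)
      then show ?thesis
        using X.scale_mem by (intro image_eqI[of _ _ "a *\<^sub>C f"]) (simp_all add: scaleC_fun_apply)
    qed
  qed
  have "hcarrier Y = htopology Y closure_of ?R"
  proof (rule Y.closed_subspace_eqI[OF Y.closed_subspace_closure_of[OF R sub] order_refl Y.subspace])
    show "htopology Y closure_of ?R \<subseteq> hcarrier Y"
      using closure_of_subset_topspace[of "htopology Y"] by (simp add: Y.topspace_eq)
    fix y
    assume y: "y \<in> hcarrier Y" and o: "\<And>v. v \<in> htopology Y closure_of ?R \<Longrightarrow> hinner Y v y = 0"
    have "?R \<subseteq> htopology Y closure_of ?R"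
      using R by (intro closure_of_subset) (simp add: Y.topspace_eq)
    then have "hinner Y (f 0) y = 0" if "f \<in> orth_compl \<H> M" for f
      using o that by auto
    then have "hinner \<H> f (monomial 0 y) = 0" if "f \<in> orth_compl \<H> M" for f
      using that y model_mem[OF that] by (simp add: inner_monomial flip: eval_0)
    then have "hinner \<H> (monomial 0 y) f = 0" if "f \<in> orth_compl \<H> M" for f
      using that y model_mem[OF that] \<H>.inner_eq_0_commute[of "monomial 0 y" f] by (simp add: monomial_eq)
    then have "monomial 0 y \<in> orth_compl \<H> (orth_compl \<H> M)"
      unfolding orth_compl_def[of _ "orth_compl \<H> M"] using y by (simp add: monomial_eq)
    then show "y = 0"
      using const[OF y] by (simp add: \<H>.orth_compl_orth_compl[OF M])
  qed
  then show ?thesis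
    by (simp add: dense_range_def)
qed

end

end

section \<open>The representation theorem\<close>

lemma (in isometric_pair) cholesky_solutions_exist:
  "\<exists>(U :: nat \<Rightarrow> ('x \<times> 'y) hspace) B D. \<forall>k. cholesky_solution n k X Y A C (U k) (B k) (D k)"
  using cholesky_solution_exists by metis

text \<open>Types cannot be quantified existentially, so spaces asserted to exist live in concrete
  types: pairs for the Cholesky solutions, functions of a complex variable for the model. Density of
  the range of \<open>C\<close> is tied to the absence of nonzero constants because a constant y in
  the subspace is orthogonal to every f(0) with f in the complement.\<close>

theorem theorem7p8:
  fixes n :: nat and Y :: "'y::complex_vector hspace"
  assumes "n \<ge> 1" and "hilbert_space Y"
  shows
    "(\<forall>M. closed_subspace (bergman n Y) M \<and> shift ` M \<subseteq> M \<longrightarrow>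
        (\<exists>(U :: nat \<Rightarrow> ((complex \<Rightarrow> 'y) \<times> 'y) hspace) \<Theta>.
           bergman_inner_family n Y U \<Theta> \<and> M = row_mult_op n Y \<Theta> ` hcarrier (tv_hardy U)) \<and>
        (let X = hsubspace (bergman n Y) (orth_compl (bergman n Y) M);
             A = hadjoint (bergman n Y) (bergman n Y) shift;
             C = (\<lambda>f. f 0)
         in hilbert_space X \<and> bounded_operator X X A \<and> bounded_operator X Y C \<and>
            (\<exists>(U :: nat \<Rightarrow> ((complex \<Rightarrow> 'y) \<times> 'y) hspace) B D.
               \<forall>k. cholesky_solution n k X Y A C (U k) (B k) (D k)) \<and>
            (\<forall>(U :: nat \<Rightarrow> 'u::complex_vector hspace) B D.
               (\<forall>k. cholesky_solution n k X Y A C (U k) (B k) (D k)) \<longrightarrow>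
               (let \<Theta> = (\<lambda>k. transfer_function n k X A C (B k) (D k))
                in bergman_inner_family n Y U \<Theta> \<and>
                   M = row_mult_op n Y \<Theta> ` hcarrier (tv_hardy U))))) \<and>
     (\<forall>(X :: 'x::complex_vector hspace) A C.
        hilbert_space X \<and> hypercontraction n X A \<and> strongly_stable X A \<and>
        bounded_operator X Y C \<and> dense_range X Y C \<and>
        (\<forall>x\<in>hcarrier X. hadjoint X Y C (C x) = defect n X A x) \<longrightarrow>
        (\<exists>(U :: nat \<Rightarrow> ('x \<times> 'y) hspace) B D.
           \<forall>k. cholesky_solution n k X Y A C (U k) (B k) (D k)) \<and>
        (\<forall>(U :: nat \<Rightarrow> 'v::complex_vector hspace) B D.
           (\<forall>k. cholesky_solution n k X Y A C (U k) (B k) (D k)) \<longrightarrow>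
           bergman_inner_family n Y U (\<lambda>k. transfer_function n k X A C (B k) (D k)))) \<and>
     (\<forall>(U :: nat \<Rightarrow> 'w::complex_vector hspace) \<Theta>.
        bergman_inner_family n Y U \<Theta> \<and>
        (\<forall>k. mult_op (\<Theta> k) ` hcarrier (shifted_space 0 (U k))
               \<subseteq> row_mult_op n Y \<Theta> ` hcarrier (tv_hardy U)) \<longrightarrow>
        (\<exists>(X :: (complex \<Rightarrow> 'y) hspace) A C B D.
           hilbert_space X \<and> hypercontraction n X A \<and> strongly_stable X A \<and>
           bounded_operator X Y C \<and>
           ((\<forall>y\<in>hcarrier Y. monomial 0 y \<in> row_mult_op n Y \<Theta> ` hcarrier (tv_hardy U)
                \<longrightarrow> y = 0) \<longrightarrow> dense_range X Y C) \<and>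
           (\<forall>x\<in>hcarrier X. hadjoint X Y C (C x) = defect n X A x) \<and>
           (\<forall>k. cholesky_solution n k X Y A C (U k) (B k) (D k) \<and>
              (\<forall>z u. cmod z < 1 \<and> u \<in> hcarrier (U k) \<longrightarrow>
                 \<Theta> k z u = transfer_function n k X A C (B k) (D k) z u))))"
proof (intro conjI allI impI, goal_cases)
  interpret bergman_space n Y
    by (rule bergman_space.intro[OF assms])
  let ?A = "hadjoint (bergman n Y) (bergman n Y) shift"
  let ?C = "\<lambda>f :: complex \<Rightarrow> 'y. f 0"
  {
    case (1 M)
    then have M: "closed_subspace (bergman n Y) M" "shift ` M \<subseteq> M"
      by auto
    let ?X = "hsubspace (bergman n Y) (orth_compl (bergman n Y) M)"
    interpret P: isometric_pair n Y ?X ?A ?C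
      by (rule isometric_pair_model[OF M])
    obtain U :: "nat \<Rightarrow> ((complex \<Rightarrow> 'y) \<times> 'y) hspace" and B D
      where "\<And>k. cholesky_solution n k ?X Y ?A ?C (U k) (B k) (D k)"
      using P.cholesky_solutions_exist by blast
    from P.transfer_functions_bergman_inner[OF this] show ?case
      unfolding annihilator_model[OF M] by blast
  next
    case (2 M)
    then have M: "closed_subspace (bergman n Y) M" "shift ` M \<subseteq> M"
      by auto
    let ?X = "hsubspace (bergman n Y) (orth_compl (bergman n Y) M)"
    interpret P: isometric_pair n Y ?X ?A ?C
      by (rule isometric_pair_model[OF M])
    note family = P.transfer_functions_bergman_inner[unfolded annihilator_model[OF M]]
    show ?case
      unfolding Let_def
      by (intro conjI allI impI P.hilbert_X P.bounded_A P.bounded_C P.cholesky_solutions_exist family)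
        (erule spec)+
  next
    case (3 X A C)
    then interpret P: isometric_pair n Y X A C
      by (intro isometric_pair_hypercontraction) auto
    show ?case
      by (rule P.cholesky_solutions_exist)
  next
    case (4 X A C U B D)
    then interpret P: isometric_pair n Y X A C
      by (intro isometric_pair_hypercontraction) auto
    show ?case
      by (rule P.transfer_functions_bergman_inner(1)) (rule 4(2)[rule_format])
  next
    case (5 U \<Theta>)
    define M where "M = row_mult_op n Y \<Theta> ` hcarrier (tv_hardy U)"
    from 5 have family: "bergman_inner_family n Y U \<Theta>"
      and sub: "mult_op (\<Theta> k) ` hcarrier (shifted_space 0 (U k)) \<subseteq> M" for k
      by (auto simp: M_def)
    note wandering = bergman_inner_familyD[OF family M_def sub]
    note M = wandering(1,2)
    \<comment> \<open>The realization of the given family is the backward shift on the complement of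
      its range.\<close>
    let ?X = "hsubspace (bergman n Y) (orth_compl (bergman n Y) M)"
    interpret P: isometric_pair n Y ?X ?A ?C
      by (rule isometric_pair_model[OF M])
    have "\<exists>B D. \<forall>k. cholesky_solution n k ?X Y ?A ?C (U k) (B k) (D k) \<and>
        (\<forall>z u. cmod z < 1 \<and> u \<in> hcarrier (U k) \<longrightarrow>
          \<Theta> k z u = transfer_function n k ?X ?A ?C (B k) (D k) z u)"
    proof (rule P.wandering_family_transfer_functions)
      show "hilbert_space (U k)" "cmod z < 1 \<Longrightarrow> bounded_operator (U k) Y (\<Theta> k z)" for k z
        using family by (auto simp: bergman_inner_family_def)
      show "mult_op (\<Theta> k) (monomial 0 u) \<in> hcarrier (bergman n Y)" if "u \<in> hcarrier (U k)" for k u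
        using sub[of k] that invariant_mem[OF M] by (auto simp: hcarrier_shifted_space)
    qed (use wandering(3,4) annihilator_model[OF M] in simp_all)
    then obtain B D where BD: "\<forall>k. cholesky_solution n k ?X Y ?A ?C (U k) (B k) (D k) \<and>
        (\<forall>z u. cmod z < 1 \<and> u \<in> hcarrier (U k) \<longrightarrow>
          \<Theta> k z u = transfer_function n k ?X ?A ?C (B k) (D k) z u)"
      by blast
    show ?case
      unfolding M_def[symmetric]
    proof (rule exI[of _ ?X], rule exI[of _ ?A], rule exI[of _ ?C], rule exI[of _ B], rule exI[of _ D],
        intro conjI[OF P.hilbert_X] conjI[OF hypercontraction_model[OF M]]
        conjI[OF strongly_stable_model[OF M]] conjI[OF P.bounded_C] conjI[OF _ conjI[OF _ BD]]
        impI ballI)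
      assume "\<forall>y\<in>hcarrier Y. monomial 0 y \<in> M \<longrightarrow> y = 0"
      then show "dense_range ?X Y ?C"
        by (intro dense_range_model[OF M]) auto
    next
      fix x
      assume "x \<in> hcarrier ?X"
      then show "hadjoint ?X Y ?C (x 0) = defect n ?X ?A x"
        by (intro defect_eq_model[OF M]) simp
    qed
  }
qed

end
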